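(* Under the standing assumptions on the domain $\mathcal{D}$ and the data $(\xi,f)$ described in the context, the reflected BSDE (R) has at most one solution in the class $\mathscr{U}(2)$.
   Context: **Basis.** $d,d'\ge1$, $T>0$; $(\Omega,\mathbb{F},\mathbb{P})$ is a stochastic basis, $\mathbb{F}=(\mathcal{F}_t)_{t\in[0,T]}$ being the completed natural filtration of a Brownian motion $W$ in $\mathbb{R}^{d'}$. **Domain (standing assumption).** $\mathcal{D}=\{y\in\mathbb{R}^d:\phi(y)<0\}$ with $\phi:\mathbb{R}^d\to\mathbb{R}$ such that: (Compactness) there is $R_1>0$ with $\phi(y)>0$ for $|y|\ge R_1$; (Smoothness) $\phi\in C^2(\mathbb{R}^d)$, $|\nabla\phi|>0$ on $\partial\mathcal{D}$, $\nabla^2\phi$ is locally Lipschitz; (Weak star-shape) there is a non-empty open convex set $\mathcal{C}\subset\mathcal{D}$ with $0\in\mathcal{C}$ and a convex function $\phi_{\mathcal{C}}\in C^2(\mathbb{R}^d)$ with $\mathcal{C}=\{\phi_{\mathcal{C}}<0\}$, $\phi_{\mathcal{C}}\ge\phi_{\mathcal{C}}(0)$, $\phi_{\mathcal{C}}(y)=|y-\mathfrak{P}_{\bar{\mathcal{C}}}(y)|$ for $y\in\mathbb{R}^d\setminus\mathcal{C}$ ($\mathfrak{P}_{\bar{\mathcal{C}}}$ is the projection onto $\bar{\mathcal{C}}$), and $\gamma:=\inf_{y\in\partial\mathcal{D}}\nabla\phi_{\mathcal{C}}(y)\cdot\frac{\nabla\phi(y)}{|\nabla\phi(y)|}>0$.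 Let $\mathfrak{n}(y)=\nabla\phi(y)/|\nabla\phi(y)|$ for $y\in\partial\mathcal{D}$ and $\mathfrak{n}(y)=0$ for $y\in\mathcal{D}$. $R_0>0$ is a fixed constant with $(y-y')\cdot\mathfrak{n}(y)+\frac1{2R_0}|y-y'|^2\ge0$ for all $y\in\partial\mathcal{D}$, $y'\in\bar{\mathcal{D}}$ (such $R_0$ exists). **Spaces.** $\mathscr{S}^2$: continuous adapted $U$ with $\|U\|_{\mathscr{S}^2}=\mathbb{E}[\sup_t|U_t|^2]^{1/2}<\infty$. $\mathscr{H}^2$: progressively measurable $Z$ with $\|Z\|_{\mathscr{H}^2}=\mathbb{E}[\int_0^T|Z_t|^2dt]^{1/2}<\infty$. $\mathscr{K}^1$: finite-variation processes $K$ with $K_0=0$ and $\mathbb{E}[\mathrm{Var}_T(K)]<\infty$, where $\mathrm{Var}_t(K)$ is the variation of $K$ on $[0,t]$. **Data (standing assumption).** $\xi$ is $\mathcal{F}_T$-measurable and $\bar{\mathcal{D}}$-valued; $f(\cdot,y,z)$ is progressively measurable; $f(t,\cdot,\cdot)$ is globally Lipschitz ($K_{f,y}$ in $y$, $K_{f,z}$ in $z$) uniformly in $(t,\omega)$; $f(\cdot,0,0)$ is essentially bounded; there is a compact $\mathcal{K}\subset\mathbb{R}^d$ with $f(t,y,z)=0$ whenever $y\notin\mathcal{K}$. **Reflected BSDE (R).** $(Y,Z,K)\in\mathscr{S}^2\times\mathscr{H}^2\times\mathscr{K}^1$ with (i) $Y_t=\xi+\int_t^Tf(s,Y_s,Z_s)ds-\int_t^TdK_s-\int_t^TZ_sdW_s$,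 $0\le t\le T$; (ii) $Y_t\in\bar{\mathcal{D}}$ a.s. and $K_t=\int_0^t\mathfrak{n}(Y_s)\,d\mathrm{Var}_s(K)$, $0\le t\le T$. **Class $\mathscr{U}(\theta)$**, $\theta\ge1$: all solutions $(Y,Z,K)\in\mathscr{S}^2\times\mathscr{H}^2\times\mathscr{K}^1$ of (R) with $\mathbb{E}[e^{\frac{\theta p}{R_0}\mathrm{Var}_T(K)}]<\infty$ for some $p>1$. *)

theory Defs
  imports "HOL-Probability.Probability"
begin

section \<open>The domain\<close>

definition grad :: "(real ^ 'n \<Rightarrow> real) \<Rightarrow> real ^ 'n \<Rightarrow> real ^ 'n" where
  "grad h y = (THE g. GDERIV h y :> g)"

definition hess :: "(real ^ 'n \<Rightarrow> real) \<Rightarrow> real ^ 'n \<Rightarrow> real ^ 'n ^ 'n" where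
  "hess h y = matrix (frechet_derivative (grad h) (at y))"

definition C2 :: "(real ^ 'n \<Rightarrow> real) \<Rightarrow> bool" where
  "C2 h \<longleftrightarrow> (\<forall>y. h differentiable (at y)) \<and> (\<forall>y. grad h differentiable (at y)) \<and>
    continuous_on UNIV (hess h)"

definition locally_lipschitz :: "('a::metric_space \<Rightarrow> 'b::metric_space) \<Rightarrow> bool" where
  "locally_lipschitz h \<longleftrightarrow> (\<forall>x. \<exists>u>0. \<exists>L. L-lipschitz_on (cball x u) h)"

definition sublevel :: "('a \<Rightarrow> real) \<Rightarrow> 'a set" where
  "sublevel \<phi> = {y. \<phi> y < 0}"

text \<open>The outward unit normal on the boundary, extended by zero. The value outside the closure
  of the domain is irrelevant, since solutions stay in the closure.\<close>

definition normal_field :: "(real ^ 'n \<Rightarrow> real) \<Rightarrow> real ^ 'n \<Rightarrow> real ^ 'n" where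
  "normal_field \<phi> y =
    (if y \<in> frontier (sublevel \<phi>) then grad \<phi> y /\<^sub>R norm (grad \<phi> y) else 0)"

definition compactness_cond :: "(real ^ 'n \<Rightarrow> real) \<Rightarrow> bool" where
  "compactness_cond \<phi> \<longleftrightarrow> (\<exists>R1>0. \<forall>y. norm y \<ge> R1 \<longrightarrow> \<phi> y > 0)"

definition smoothness_cond :: "(real ^ 'n \<Rightarrow> real) \<Rightarrow> bool" where
  "smoothness_cond \<phi> \<longleftrightarrow> C2 \<phi> \<and> (\<forall>y \<in> frontier (sublevel \<phi>). norm (grad \<phi> y) > 0) \<and>
    locally_lipschitz (hess \<phi>)"

text \<open>Under the compactness and smoothness conditions the infimum below is taken over a nonempty
  compact set of values, so the real-valued infimum has its usual meaning.\<close>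

definition weakly_star_shaped :: "(real ^ 'n \<Rightarrow> real) \<Rightarrow> bool" where
  "weakly_star_shaped \<phi> \<longleftrightarrow> (\<exists>C \<phi>C.
     C \<noteq> {} \<and> open C \<and> convex C \<and> C \<subseteq> sublevel \<phi> \<and> 0 \<in> C \<and>
     convex_on UNIV \<phi>C \<and> C2 \<phi>C \<and> C = sublevel \<phi>C \<and> (\<forall>y. \<phi>C y \<ge> \<phi>C 0) \<and>
     (\<forall>y. y \<notin> C \<longrightarrow> \<phi>C y = norm (y - closest_point (closure C) y)) \<and>
     (INF y \<in> frontier (sublevel \<phi>). grad \<phi>C y \<bullet> (grad \<phi> y /\<^sub>R norm (grad \<phi> y))) > 0)"

definition standing_domain :: "(real ^ 'n \<Rightarrow> real) \<Rightarrow> bool" where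
  "standing_domain \<phi> \<longleftrightarrow> compactness_cond \<phi> \<and> smoothness_cond \<phi> \<and> weakly_star_shaped \<phi>"

definition exterior_sphere_constant :: "(real ^ 'n \<Rightarrow> real) \<Rightarrow> real \<Rightarrow> bool" where
  "exterior_sphere_constant \<phi> R0 \<longleftrightarrow> R0 > 0 \<and>
    (\<forall>y \<in> frontier (sublevel \<phi>). \<forall>y' \<in> closure (sublevel \<phi>).
       (y - y') \<bullet> normal_field \<phi> y + 1 / (2 * R0) * (norm (y - y'))\<^sup>2 \<ge> 0)"

section \<open>The stochastic basis\<close>

text \<open>All processes are indexed by the reals; only their restriction to the time interval from
  0 to T is constrained.\<close>

definition natural_filtration ::
    "'w measure \<Rightarrow> (real \<Rightarrow> 'w \<Rightarrow> real ^ 'm) \<Rightarrow> real \<Rightarrow> 'w measure" where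
  "natural_filtration M W t =
    sigma (space M) (\<Union>s\<in>{0..t}. {W s -` A \<inter> space M | A. A \<in> sets borel})"

text \<open>To be used with a complete measure M, so that the null sets of M are all the negligible
  sets.\<close>

definition completed_filtration ::
    "'w measure \<Rightarrow> (real \<Rightarrow> 'w \<Rightarrow> real ^ 'm) \<Rightarrow> real \<Rightarrow> 'w measure" where
  "completed_filtration M W t =
    sigma (space M) (sets (natural_filtration M W t) \<union> null_sets M)"

definition brownian_motion ::
    "'w measure \<Rightarrow> real \<Rightarrow> (real \<Rightarrow> 'w \<Rightarrow> real ^ 'm) \<Rightarrow> bool" where
  "brownian_motion M T W \<longleftrightarrow>
    (\<forall>t\<in>{0..T}. W t \<in> borel_measurable M) \<and>
    (AE \<omega> in M. W 0 \<omega> = 0) \<and>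
    (AE \<omega> in M. continuous_on {0..T} (\<lambda>t. W t \<omega>)) \<and>
    (\<forall>s t. 0 \<le> s \<and> s < t \<and> t \<le> T \<longrightarrow>
       prob_space.indep_set M (sets (natural_filtration M W s))
         {(\<lambda>\<omega>. W t \<omega> - W s \<omega>) -` A \<inter> space M | A. A \<in> sets borel} \<and>
       distributed M lborel (\<lambda>\<omega>. W t \<omega> - W s \<omega>)
         (\<lambda>x. ennreal (\<Prod>i\<in>UNIV. normal_density 0 (sqrt (t - s)) (x $ i))))"

definition adapted ::
    "(real \<Rightarrow> 'w measure) \<Rightarrow> real \<Rightarrow> (real \<Rightarrow> 'w \<Rightarrow> 'b::topological_space) \<Rightarrow> bool" where
  "adapted F T X \<longleftrightarrow> (\<forall>t\<in>{0..T}. X t \<in> borel_measurable (F t))"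

definition progressive ::
    "(real \<Rightarrow> 'w measure) \<Rightarrow> real \<Rightarrow> (real \<Rightarrow> 'w \<Rightarrow> 'b::topological_space) \<Rightarrow> bool" where
  "progressive F T X \<longleftrightarrow> (\<forall>t\<in>{0..T}.
     (\<lambda>(s, \<omega>). X s \<omega>) \<in> borel_measurable (restrict_space borel {0..t} \<Otimes>\<^sub>M F t))"

definition time_measure :: "real \<Rightarrow> real measure" where
  "time_measure T = restrict_space lborel {0..T}"

section \<open>Spaces of processes\<close>

definition space_S2 ::
    "'w measure \<Rightarrow> (real \<Rightarrow> 'w measure) \<Rightarrow> real \<Rightarrow> (real \<Rightarrow> 'w \<Rightarrow> real ^ 'n) set" where
  "space_S2 M F T = {U. adapted F T U \<and>
     (AE \<omega> in M. continuous_on {0..T} (\<lambda>t. U t \<omega>)) \<and>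
     (\<integral>\<^sup>+\<omega>. (SUP t\<in>{0..T}. ennreal ((norm (U t \<omega>))\<^sup>2)) \<partial>M) < \<infinity>}"

text \<open>The norm on the matrix type is the Frobenius norm.\<close>

definition space_H2 ::
    "'w measure \<Rightarrow> (real \<Rightarrow> 'w measure) \<Rightarrow> real \<Rightarrow> (real \<Rightarrow> 'w \<Rightarrow> real ^ 'm ^ 'n) set" where
  "space_H2 M F T = {Z. progressive F T Z \<and>
     (\<integral>\<^sup>+\<omega>. (\<integral>\<^sup>+t. ennreal ((norm (Z t \<omega>))\<^sup>2) \<partial>time_measure T) \<partial>M) < \<infinity>}"

text \<open>Variation of a path on the interval from 0 to t, as the supremum over finite monotone
  sequences of partition points.\<close>

definition variation :: "(real \<Rightarrow> 'a::real_normed_vector) \<Rightarrow> real \<Rightarrow> ennreal" where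
  "variation k t = (SUP (n, \<tau>) \<in> {(n::nat, \<tau>::nat \<Rightarrow> real). mono \<tau> \<and> range \<tau> \<subseteq> {0..t}}.
     \<Sum>i<n. ennreal (norm (k (\<tau> (Suc i)) - k (\<tau> i))))"

text \<open>Finite-variation processes are, as usual, adapted and right-continuous with left limits; the
  left limits are implied by finite variation.\<close>

definition space_K1 ::
    "'w measure \<Rightarrow> (real \<Rightarrow> 'w measure) \<Rightarrow> real \<Rightarrow> (real \<Rightarrow> 'w \<Rightarrow> real ^ 'n) set" where
  "space_K1 M F T = {K. adapted F T K \<and>
     (AE \<omega> in M. K 0 \<omega> = 0 \<and>
        (\<forall>t\<in>{0..<T}. continuous (at_right t) (\<lambda>s. K s \<omega>)) \<and>
        variation (\<lambda>s. K s \<omega>) T < \<infinity>) \<and>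
     (\<integral>\<^sup>+\<omega>. variation (\<lambda>s. K s \<omega>) T \<partial>M) < \<infinity>}"

text \<open>The Lebesgue-Stieltjes measure of the variation function of a path, the latter being
  extended to the whole line by its values at 0 and at T.\<close>

definition variation_measure :: "real \<Rightarrow> (real \<Rightarrow> 'a::real_normed_vector) \<Rightarrow> real measure" where
  "variation_measure T k = interval_measure (\<lambda>s. enn2real (variation k (max 0 (min s T))))"

section \<open>The Ito integral\<close>

definition elementary_data ::
    "'w measure \<Rightarrow> (real \<Rightarrow> 'w measure) \<Rightarrow> real \<Rightarrow>
      nat \<Rightarrow> (nat \<Rightarrow> real) \<Rightarrow> (nat \<Rightarrow> 'w \<Rightarrow> real ^ 'm ^ 'n) \<Rightarrow> bool" where
  "elementary_data M F T n \<tau> \<zeta> \<longleftrightarrow> mono \<tau> \<and> range \<tau> \<subseteq> {0..T} \<and>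
     (\<forall>i<n. \<zeta> i \<in> borel_measurable (F (\<tau> i))) \<and>
     (\<exists>B. \<forall>i<n. \<forall>\<omega>\<in>space M. norm (\<zeta> i \<omega>) \<le> B)"

definition elementary_process ::
    "nat \<Rightarrow> (nat \<Rightarrow> real) \<Rightarrow> (nat \<Rightarrow> 'w \<Rightarrow> real ^ 'm ^ 'n) \<Rightarrow> real \<Rightarrow> 'w \<Rightarrow> real ^ 'm ^ 'n" where
  "elementary_process n \<tau> \<zeta> t \<omega> = (\<Sum>i<n. indicator {\<tau> i<..\<tau> (Suc i)} t *\<^sub>R \<zeta> i \<omega>)"

definition elementary_integral ::
    "(real \<Rightarrow> 'w \<Rightarrow> real ^ 'm) \<Rightarrow> nat \<Rightarrow> (nat \<Rightarrow> real) \<Rightarrow> (nat \<Rightarrow> 'w \<Rightarrow> real ^ 'm ^ 'n) \<Rightarrow>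
      real \<Rightarrow> 'w \<Rightarrow> real ^ 'n" where
  "elementary_integral W n \<tau> \<zeta> t \<omega> =
     (\<Sum>i<n. \<zeta> i \<omega> *v (W (min t (\<tau> (Suc i))) \<omega> - W (min t (\<tau> i)) \<omega>))"

text \<open>The process J is (a continuous version of) the Ito integral of Z from 0: the limit in
  mean square of the integrals of elementary processes that converge to Z in mean square. This
  determines J up to indistinguishability.\<close>

definition has_ito_integral ::
    "'w measure \<Rightarrow> (real \<Rightarrow> 'w measure) \<Rightarrow> real \<Rightarrow> (real \<Rightarrow> 'w \<Rightarrow> real ^ 'm) \<Rightarrow>
      (real \<Rightarrow> 'w \<Rightarrow> real ^ 'm ^ 'n) \<Rightarrow> (real \<Rightarrow> 'w \<Rightarrow> real ^ 'n) \<Rightarrow> bool" where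
  "has_ito_integral M F T W Z J \<longleftrightarrow>
     adapted F T J \<and> (AE \<omega> in M. continuous_on {0..T} (\<lambda>t. J t \<omega>)) \<and>
     (\<exists>N \<tau> \<zeta>.
        (\<forall>k. elementary_data M F T (N k) (\<tau> k) (\<zeta> k)) \<and>
        (\<lambda>k. \<integral>\<^sup>+\<omega>. (\<integral>\<^sup>+t. ennreal
            ((norm (elementary_process (N k) (\<tau> k) (\<zeta> k) t \<omega> - Z t \<omega>))\<^sup>2) \<partial>time_measure T) \<partial>M)
          \<longlonglongrightarrow> 0 \<and>
        (\<forall>t\<in>{0..T}.
          (\<lambda>k. \<integral>\<^sup>+\<omega>. ennreal
              ((norm (elementary_integral W (N k) (\<tau> k) (\<zeta> k) t \<omega> - J t \<omega>))\<^sup>2) \<partial>M)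
            \<longlonglongrightarrow> 0))"

section \<open>The reflected BSDE\<close>

definition standing_data ::
    "'w measure \<Rightarrow> (real \<Rightarrow> 'w measure) \<Rightarrow> real \<Rightarrow> (real ^ 'n \<Rightarrow> real) \<Rightarrow> ('w \<Rightarrow> real ^ 'n) \<Rightarrow>
      (real \<Rightarrow> 'w \<Rightarrow> real ^ 'n \<Rightarrow> real ^ 'm ^ 'n \<Rightarrow> real ^ 'n) \<Rightarrow> bool" where
  "standing_data M F T \<phi> \<xi> f \<longleftrightarrow>
     \<xi> \<in> borel_measurable (F T) \<and> (AE \<omega> in M. \<xi> \<omega> \<in> closure (sublevel \<phi>)) \<and>
     (\<forall>y z. progressive F T (\<lambda>t \<omega>. f t \<omega> y z)) \<and>
     (\<exists>Kfy\<ge>0. \<exists>Kfz\<ge>0. \<forall>t\<in>{0..T}. \<forall>\<omega>\<in>space M. \<forall>y y' z z'.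
        norm (f t \<omega> y z - f t \<omega> y' z') \<le> Kfy * norm (y - y') + Kfz * norm (z - z')) \<and>
     (\<exists>B. AE (t, \<omega>) in time_measure T \<Otimes>\<^sub>M M. norm (f t \<omega> 0 0) \<le> B) \<and>
     (\<exists>S. compact S \<and> (\<forall>t\<in>{0..T}. \<forall>\<omega>\<in>space M. \<forall>y z. y \<notin> S \<longrightarrow> f t \<omega> y z = 0))"

definition rbsde_solution ::
    "'w measure \<Rightarrow> (real \<Rightarrow> 'w measure) \<Rightarrow> real \<Rightarrow> (real \<Rightarrow> 'w \<Rightarrow> real ^ 'm) \<Rightarrow>
      (real ^ 'n \<Rightarrow> real) \<Rightarrow> ('w \<Rightarrow> real ^ 'n) \<Rightarrow>
      (real \<Rightarrow> 'w \<Rightarrow> real ^ 'n \<Rightarrow> real ^ 'm ^ 'n \<Rightarrow> real ^ 'n) \<Rightarrow>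
      (real \<Rightarrow> 'w \<Rightarrow> real ^ 'n) \<Rightarrow> (real \<Rightarrow> 'w \<Rightarrow> real ^ 'm ^ 'n) \<Rightarrow>
      (real \<Rightarrow> 'w \<Rightarrow> real ^ 'n) \<Rightarrow> bool" where
  "rbsde_solution M F T W \<phi> \<xi> f Y Z K \<longleftrightarrow>
     Y \<in> space_S2 M F T \<and> Z \<in> space_H2 M F T \<and> K \<in> space_K1 M F T \<and>
     (\<exists>J. has_ito_integral M F T W Z J \<and>
        (AE \<omega> in M. \<forall>t\<in>{0..T}.
           Y t \<omega> = \<xi> \<omega> + (LINT s:{t..T}|lborel. f s \<omega> (Y s \<omega>) (Z s \<omega>))
             - (K T \<omega> - K t \<omega>) - (J T \<omega> - J t \<omega>))) \<and>
     (AE \<omega> in M. \<forall>t\<in>{0..T}. Y t \<omega> \<in> closure (sublevel \<phi>)) \<and>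
     (AE \<omega> in M. \<forall>t\<in>{0..T}.
        K t \<omega> = (LINT s:{0<..t}|variation_measure T (\<lambda>s. K s \<omega>). normal_field \<phi> (Y s \<omega>)))"

definition class_U ::
    "'w measure \<Rightarrow> (real \<Rightarrow> 'w measure) \<Rightarrow> real \<Rightarrow> (real \<Rightarrow> 'w \<Rightarrow> real ^ 'm) \<Rightarrow>
      (real ^ 'n \<Rightarrow> real) \<Rightarrow> real \<Rightarrow> ('w \<Rightarrow> real ^ 'n) \<Rightarrow>
      (real \<Rightarrow> 'w \<Rightarrow> real ^ 'n \<Rightarrow> real ^ 'm ^ 'n \<Rightarrow> real ^ 'n) \<Rightarrow> real \<Rightarrow>
      ((real \<Rightarrow> 'w \<Rightarrow> real ^ 'n) \<times> (real \<Rightarrow> 'w \<Rightarrow> real ^ 'm ^ 'n) \<times> (real \<Rightarrow> 'w \<Rightarrow> real ^ 'n)) set"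
  where
  "class_U M F T W \<phi> R0 \<xi> f \<theta> = {(Y, Z, K). rbsde_solution M F T W \<phi> \<xi> f Y Z K \<and>
     (\<exists>p>1. (\<integral>\<^sup>+\<omega>. ennreal (exp (\<theta> * p / R0 * enn2real (variation (\<lambda>s. K s \<omega>) T))) \<partial>M) < \<infinity>)}"

end

(*
Let X, A, J be the differences of the Y-, K- and Ito-integral components of two solutions, V the sum
of the variations of the two reflection terms, and a = 2 Kfy + 2 Kfz^2. The exterior sphere condition
gives 2 X . dA >= - |X|^2 dV / R0, so that E[exp(a t + V_t / R0) |X_t|^2] is forced to vanish, the
terminal value being zero. Membership in the class with exponent 2 makes exp(V_T / R0) V_T integrable.

The argument is carried out without stochastic calculus. On an equidistant grid the weight is
exp(a t_i + min(L_i, N) / R0), with L_i the discrete variation up to t_i, hence adapted and bounded,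
and the increments of |X|^2 are expanded pathwise. In expectation the martingale terms drop out and the
squares of the increments of J become the time integrals of |Z - Z'|^2; this needs only the martingale
property and the isometry for a single increment of J, which pass to the limit from elementary
integrands. The pathwise error is dominated by a square of V_T and tends to N-dependent terms that
vanish for large N.
*)
theory Submission
  imports Defs
begin

section \<open>Variation of paths\<close>

text \<open>The weight grows like exp(V / R0) in order to neutralise the term - |X|^2 dV / R0. The
  factor exp(a t) does this for the drift, where Young's inequality 2 Kfz |X| |z| <= 2 Kfz^2 |X|^2 +
  |z|^2 / 2 with z = Z - Z' leaves half of the energy of z, enough to force Z = Z' as well. The
  obstacle is that continuity of paths gives no control over sums of squared increments of J. They
  stay exact in the pathwise balance; only products of increments of J with the reflection and drift
  terms are estimated, by a modulus of continuity times a total variation. The result is one-sided,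
  so the limit of fine grids is taken for a positive part. Beyond the truncation level N the weight
  no longer absorbs the reflection, at a cost of order exp(N / R0) max(V - N, 0). This is at most
  exp(V / R0) V and vanishes once N >= V. Hence the order of limits, first the grid with N fixed and
  then N, and the role of p > 1, which pays for the factor V.\<close>

definition var_on :: "(real \<Rightarrow> 'a::real_normed_vector) \<Rightarrow> real \<Rightarrow> real \<Rightarrow> ennreal" where
  "var_on k a b = (SUP (n, \<tau>) \<in> {(n::nat, \<tau>::nat \<Rightarrow> real). mono \<tau> \<and> range \<tau> \<subseteq> {a..b}}.
     \<Sum>i<n. ennreal (norm (k (\<tau> (Suc i)) - k (\<tau> i))))"

text \<open>The grid with index n has Suc n cells, so the mesh never involves a division by zero.\<close>

definition grid :: "real \<Rightarrow> real \<Rightarrow> nat \<Rightarrow> nat \<Rightarrow> real" where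
  "grid a b n i = a + real i * (b - a) / real (Suc n)"

text \<open>\<open>variation\<close> always starts at 0, whereas additivity over adjacent intervals
  needs a free left endpoint. This equation carries the results for \<open>var_on\<close>
  back.\<close>

lemma variation_eq_var_on: "variation k t = var_on k 0 t"
  by (simp add: variation_def var_on_def)

lemma var_on_upper:
  assumes "mono \<tau>" "range \<tau> \<subseteq> {a..b}"
  shows "(\<Sum>i<n. ennreal (norm (k (\<tau> (Suc i)) - k (\<tau> i)))) \<le> var_on k a b"
  unfolding var_on_def using assms by (intro SUP_upper2[of "(n, \<tau>)"]) auto

lemma var_on_least:
  assumes "\<And>n \<tau>. mono \<tau> \<Longrightarrow> range \<tau> \<subseteq> {a..b} \<Longrightarrow>
    (\<Sum>i<n. ennreal (norm (k (\<tau> (Suc i)) - k (\<tau> i)))) \<le> x"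
  shows "var_on k a b \<le> x"
  unfolding var_on_def using assms by (intro SUP_least) auto

lemma var_on_mono:
  assumes "a' \<le> a" "b \<le> b'"
  shows "var_on k a b \<le> var_on k a' b'"
proof (rule var_on_least)
  fix n and \<tau> :: "nat \<Rightarrow> real" assume "mono \<tau>" "range \<tau> \<subseteq> {a..b}"
  moreover have "{a..b} \<subseteq> {a'..b'}" using assms by auto
  ultimately show "(\<Sum>i<n. ennreal (norm (k (\<tau> (Suc i)) - k (\<tau> i)))) \<le> var_on k a' b'"
    by (intro var_on_upper) auto
qed

text \<open>Clamping to either side of b inserts the point b into a partition without refining it.
  An increment that does not straddle b is unchanged on one side and zero on the other; otherwise
  this is the triangle inequality.\<close>

lemma split_increment_le:
  fixes k :: "real \<Rightarrow> 'a::real_normed_vector"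
  assumes "x \<le> y"
  shows "norm (k y - k x) \<le> norm (k (min b y) - k (min b x)) + norm (k (max b y) - k (max b x))"
proof -
  consider "y \<le> b" | "b \<le> x" | "x < b" "b < y" by linarith
  then show ?thesis
  proof cases
    case 3
    have "norm (k y - k x) = norm ((k b - k x) + (k y - k b))" by simp
    also have "\<dots> \<le> norm (k b - k x) + norm (k y - k b)" by (rule norm_triangle_ineq)
    finally show ?thesis using 3 by (simp add: min_def max_def)
  qed (use assms in \<open>auto simp: min_def max_def\<close>)
qed

lemma sum_split_le:
  fixes k :: "real \<Rightarrow> 'a::real_normed_vector"
  assumes "mono \<tau>"
  shows "(\<Sum>i<n. ennreal (norm (k (\<tau> (Suc i)) - k (\<tau> i)))) \<le>
    (\<Sum>i<n. ennreal (norm (k (min b (\<tau> (Suc i))) - k (min b (\<tau> i))))) +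
    (\<Sum>i<n. ennreal (norm (k (max b (\<tau> (Suc i))) - k (max b (\<tau> i)))))"
  unfolding sum.distrib[symmetric]
proof (rule sum_mono)
  fix i
  have "\<tau> i \<le> \<tau> (Suc i)" using assms by (simp add: mono_def)
  from split_increment_le[OF this, of k b]
  show "ennreal (norm (k (\<tau> (Suc i)) - k (\<tau> i))) \<le>
      ennreal (norm (k (min b (\<tau> (Suc i))) - k (min b (\<tau> i)))) +
      ennreal (norm (k (max b (\<tau> (Suc i))) - k (max b (\<tau> i))))"
    by (simp add: ennreal_leI flip: ennreal_plus)
qed

lemma var_on_le_add:
  assumes "a \<le> b" "b \<le> c"
  shows "var_on k a c \<le> var_on k a b + var_on k b c"
proof (rule var_on_least)
  fix n and \<tau> :: "nat \<Rightarrow> real" assume \<tau>: "mono \<tau>" "range \<tau> \<subseteq> {a..c}"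
  have 1: "mono (\<lambda>i. min b (\<tau> i))" "range (\<lambda>i. min b (\<tau> i)) \<subseteq> {a..b}"
    using \<tau> assms by (auto simp: mono_def image_subset_iff) (metis min.coboundedI2 min.commute)
  have 2: "mono (\<lambda>i. max b (\<tau> i))" "range (\<lambda>i. max b (\<tau> i)) \<subseteq> {b..c}"
    using \<tau> assms by (auto simp: mono_def image_subset_iff) (metis max.coboundedI2)
  show "(\<Sum>i<n. ennreal (norm (k (\<tau> (Suc i)) - k (\<tau> i)))) \<le> var_on k a b + var_on k b c"
    using sum_split_le[OF \<tau>(1), where k = k and n = n and b = b] var_on_upper[OF 1, where k = k and n = n] var_on_upper[OF 2, where k = k and n = n]
    by (meson add_mono order_trans)
qed

lemma sum_concat_le:
  fixes k :: "real \<Rightarrow> 'a::real_normed_vector"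
  assumes "mono \<tau>" "range \<tau> \<subseteq> {a..b}" "mono \<sigma>" "range \<sigma> \<subseteq> {b..c}"
  shows "(\<Sum>i<n. ennreal (norm (k (\<tau> (Suc i)) - k (\<tau> i)))) +
    (\<Sum>i<m. ennreal (norm (k (\<sigma> (Suc i)) - k (\<sigma> i)))) \<le> var_on k a c"
proof -
  define \<rho> where "\<rho> i = (if i \<le> n then \<tau> i else \<sigma> (i - Suc n))" for i
  have t: "a \<le> \<tau> i" "\<tau> i \<le> b" "b \<le> \<sigma> i" "\<sigma> i \<le> c" for i
    using assms(2,4) by (auto simp: image_subset_iff)
  have \<rho>: "mono \<rho>"
  proof (rule monoI)
    fix i j :: nat assume ij: "i \<le> j"
    show "\<rho> i \<le> \<rho> j"
      using ij monoD[OF assms(1) ij] monoD[OF assms(3), of "i - Suc n" "j - Suc n"]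
        t(2)[of i] t(3)[of "j - Suc n"]
      by (auto simp: \<rho>_def)
  qed
  have r: "range \<rho> \<subseteq> {a..c}"
  proof
    fix x assume "x \<in> range \<rho>"
    then obtain i where "x = \<rho> i" by auto
    then show "x \<in> {a..c}" using t(1,2)[of i] t(3,4)[of "i - Suc n"] t(1,2)[of 0] t(3,4)[of 0]
      by (auto simp: \<rho>_def)
  qed
  let ?g = "\<lambda>i. ennreal (norm (k (\<rho> (Suc i)) - k (\<rho> i)))"
  have "(\<Sum>i<m. ennreal (norm (k (\<sigma> (Suc i)) - k (\<sigma> i)))) = (\<Sum>i\<in>{Suc n..<Suc n + m}. ?g i)"
    by (rule sum.reindex_bij_witness[of _ "\<lambda>i. i - Suc n" "\<lambda>i. i + Suc n"])
      (auto simp: \<rho>_def Suc_diff_le)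
  moreover have "(\<Sum>i<n. ennreal (norm (k (\<tau> (Suc i)) - k (\<tau> i)))) = (\<Sum>i<n. ?g i)"
    by (rule sum.cong) (auto simp: \<rho>_def)
  moreover have "(\<Sum>i<n. ?g i) + (\<Sum>i\<in>{Suc n..<Suc n + m}. ?g i)
      = (\<Sum>i\<in>{..<n} \<union> {Suc n..<Suc n + m}. ?g i)"
    by (rule sum.union_disjoint[symmetric]) auto
  moreover have "\<dots> \<le> (\<Sum>i<Suc n + m. ?g i)"
    by (rule sum_mono2) auto
  moreover have "\<dots> \<le> var_on k a c" by (rule var_on_upper[OF \<rho> r])
  ultimately show ?thesis by (simp only:)
qed

lemma var_on_add:
  assumes "a \<le> b" "b \<le> c"
  shows "var_on k a c = var_on k a b + var_on k b c"
proof (rule antisym)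
  \<comment> \<open>A constant can be pulled into a supremum in \<open>ennreal\<close> only over a
    nonempty index set; the empty supremum is 0 and would lose it.\<close>
  have ne: "{(n::nat, \<tau>::nat \<Rightarrow> real). mono \<tau> \<and> range \<tau> \<subseteq> {x..y}} \<noteq> {}" if "x \<le> y" for x y :: real
  proof -
    have "(0::nat, \<lambda>_. x) \<in> {(n::nat, \<tau>::nat \<Rightarrow> real). mono \<tau> \<and> range \<tau> \<subseteq> {x..y}}"
      using that by (auto simp: mono_def)
    then show ?thesis by blast
  qed
  have "(\<Sum>i<n. ennreal (norm (k (\<tau> (Suc i)) - k (\<tau> i)))) + var_on k b c \<le> var_on k a c"
    if \<tau>: "mono \<tau>" "range \<tau> \<subseteq> {a..b}" for n and \<tau> :: "nat \<Rightarrow> real"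
  proof -
    let ?x = "\<Sum>i<n. ennreal (norm (k (\<tau> (Suc i)) - k (\<tau> i)))"
    let ?A = "{(n::nat, \<tau>::nat \<Rightarrow> real). mono \<tau> \<and> range \<tau> \<subseteq> {b..c}}"
    let ?f = "\<lambda>(n, \<tau>). \<Sum>i<n. ennreal (norm (k (\<tau> (Suc i)) - k (\<tau> i)))"
    have "?x + var_on k b c = (SUP i\<in>?A. ?x + ?f i)"
      unfolding var_on_def[of k b c] by (rule ennreal_SUP_add_right[OF ne[OF assms(2)]])
    also have "\<dots> \<le> var_on k a c"
      by (rule SUP_least) (use sum_concat_le[OF \<tau>, where k = k and n = n] in \<open>auto simp del: sum_ennreal\<close>)
    finally show ?thesis .
  qed
  then have "(SUP (n, \<tau>) \<in> {(n::nat, \<tau>::nat \<Rightarrow> real). mono \<tau> \<and> range \<tau> \<subseteq> {a..b}}.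
     (\<Sum>i<n. ennreal (norm (k (\<tau> (Suc i)) - k (\<tau> i)))) + var_on k b c) \<le> var_on k a c"
    by (auto intro!: SUP_least)
  then show "var_on k a b + var_on k b c \<le> var_on k a c"
    unfolding var_on_def[of k a b]
    using ennreal_SUP_add_left[OF ne[OF assms(1)], where c = "var_on k b c" and f =
        "\<lambda>(n, \<tau>). \<Sum>i<n. ennreal (norm (k (\<tau> (Suc i)) - k (\<tau> i)))"]
    by (simp add: case_prod_beta)
qed (rule var_on_le_add[OF assms])

lemma var_on_refl [simp]: "var_on k a a = 0"
proof -
  have "var_on k a a \<le> 0"
  proof (rule var_on_least)
    fix n and \<tau> :: "nat \<Rightarrow> real" assume "range \<tau> \<subseteq> {a..a}"
    then have "\<tau> i = a" for i by auto
    then show "(\<Sum>i<n. ennreal (norm (k (\<tau> (Suc i)) - k (\<tau> i)))) \<le> 0" by simp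
  qed
  then show ?thesis by simp
qed

text \<open>A monotone sequence with only two values jumps at most once, and g records whether the
  jump has happened.\<close>

lemma sum_two_valued_le:
  fixes k :: "real \<Rightarrow> 'a::real_normed_vector"
  assumes "mono \<rho>" "\<And>i::nat. \<rho> i \<in> {t, u}" "t < u"
  shows "(\<Sum>i<n. norm (k (\<rho> (Suc i)) - k (\<rho> i))) \<le> norm (k u - k t)"
proof -
  define g where "g i = (if \<rho> i = u then norm (k u - k t) else 0)" for i
  have "(\<Sum>i<n. norm (k (\<rho> (Suc i)) - k (\<rho> i))) = (\<Sum>i<n. g (Suc i) - g i)"
  proof (rule sum.cong)
    fix i
    show "norm (k (\<rho> (Suc i)) - k (\<rho> i)) = g (Suc i) - g i"
      using assms(2)[of i] assms(2)[of "Suc i"] monoD[OF assms(1), of i "Suc i"] assms(3)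
      by (auto simp: g_def)
  qed simp
  also have "\<dots> = g n - g 0" by (rule sum_lessThan_telescope)
  also have "\<dots> \<le> norm (k u - k t)" by (simp add: g_def)
  finally show ?thesis .
qed

text \<open>Take a partition of the whole interval that is optimal up to e / 2. For u below all its
  points other than t, the part in the interval from t to u consists of the single increment of k
  from t to u, which is small by right continuity; the remainder is at most the variation from u to
  b, and additivity cancels it.\<close>

lemma var_on_right_continuous_0:
  fixes k :: "real \<Rightarrow> 'a::real_normed_vector"
  assumes "t < b" "continuous (at_right t) k" "var_on k t b < \<infinity>" "0 < e"
  shows "\<forall>\<^sub>F u in at_right t. enn2real (var_on k t u) < e"
proof -
  have "var_on k t b \<noteq> \<infinity>" using assms(3) by auto
  then obtain n \<tau> where \<tau>: "mono \<tau>" "range \<tau> \<subseteq> {t..b}"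
    and *: "var_on k t b < (\<Sum>i<n. ennreal (norm (k (\<tau> (Suc i)) - k (\<tau> i)))) + ennreal (e / 2)"
  proof -
    assume a: "\<And>\<tau> n. mono \<tau> \<Longrightarrow> range \<tau> \<subseteq> {t..b} \<Longrightarrow>
      var_on k t b < (\<Sum>i<n. ennreal (norm (k (\<tau> (Suc i)) - k (\<tau> i)))) + ennreal (e / 2) \<Longrightarrow> thesis"
    show thesis
    \<comment> \<open>Subtraction in \<open>ennreal\<close> truncates at 0, so a variation below e /
      2 is treated apart, with no increments at all.\<close>
    proof (cases "var_on k t b < ennreal (e / 2)")
      case True
      show thesis
        by (rule a[of "\<lambda>_. t" 0]) (use True assms in \<open>auto simp: mono_def\<close>)
    next
      case False
      have "var_on k t b - ennreal (e / 2) < var_on k t b"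
        using False assms by (intro ennreal_between)
          (auto simp: less_top not_less intro: order_less_le_trans[of _ "ennreal (e / 2)"])
      then obtain n \<tau> where "mono \<tau>" "range \<tau> \<subseteq> {t..b}"
        "var_on k t b - ennreal (e / 2) < (\<Sum>i<n. ennreal (norm (k (\<tau> (Suc i)) - k (\<tau> i))))"
        unfolding var_on_def[of k t b] less_SUP_iff by auto
      then show thesis
        by (intro a[of \<tau> n]) (use False in \<open>auto simp: minus_less_iff_ennreal\<close>)
    qed
  qed
  have ev: "\<forall>\<^sub>F u in at_right t. u < b" "\<forall>\<^sub>F u in at_right t. t < u"
    by (auto intro: eventually_at_rightI[OF _ assms(1)])
  have ev2: "\<forall>\<^sub>F u in at_right t. \<forall>i\<in>{..n}. \<tau> i = t \<or> u < \<tau> i"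
  proof (rule eventually_ball_finite, simp, rule ballI)
    fix i
    show "\<forall>\<^sub>F u in at_right t. \<tau> i = t \<or> u < \<tau> i"
    proof (cases "\<tau> i = t")
      case False
      then have "t < \<tau> i" using \<tau>(2) by (metis atLeastAtMost_iff order_le_less range_subsetD)
      then show ?thesis by (auto intro!: eventually_at_rightI[of t "\<tau> i"])
    qed simp
  qed
  have "((\<lambda>u. norm (k u - k t)) \<longlongrightarrow> 0) (at_right t)"
    using assms(2) by (simp add: continuous_within tendsto_norm_zero_iff LIM_zero_iff)
  then have ev3: "\<forall>\<^sub>F u in at_right t. norm (k u - k t) < e / 2"
    using assms(4) by (intro order_tendstoD) auto
  show ?thesis
    using ev ev2 ev3
  proof eventually_elim
    case (elim u)
    \<comment> \<open>Points with index beyond n are not known to avoid the open interval from t to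
      u, hence the index is frozen at n.\<close>
    define \<rho> where "\<rho> i = min u (\<tau> (min i n))" for i
    have \<rho>: "mono \<rho>"
    proof (rule monoI)
      fix i j :: nat assume "i \<le> j"
      then have "\<tau> (min i n) \<le> \<tau> (min j n)" by (intro monoD[OF \<tau>(1)]) auto
      then show "\<rho> i \<le> \<rho> j" by (auto simp: \<rho>_def)
    qed
    have \<rho>2: "\<rho> i \<in> {t, u}" for i
      using elim(3)[rule_format, of "min i n"] elim(2) by (auto simp: \<rho>_def min_def)
    have m: "mono (\<lambda>i. max u (\<tau> i))" "range (\<lambda>i. max u (\<tau> i)) \<subseteq> {u..b}"
      using \<tau> elim by (auto simp: mono_def image_subset_iff) (metis max.coboundedI2)
    have "(\<Sum>i<n. ennreal (norm (k (min u (\<tau> (Suc i))) - k (min u (\<tau> i)))))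
      = ennreal (\<Sum>i<n. norm (k (\<rho> (Suc i)) - k (\<rho> i)))"
      unfolding sum_ennreal[OF norm_ge_zero, symmetric] by (intro sum.cong) (auto simp: \<rho>_def)
    also have "\<dots> \<le> ennreal (norm (k u - k t))"
      by (intro ennreal_leI sum_two_valued_le \<rho> \<rho>2 elim)
    finally have "var_on k t b < ennreal (norm (k u - k t)) + var_on k u b + ennreal (e / 2)"
      using order_less_le_trans[OF * add_right_mono[OF order_trans[OF
            sum_split_le[OF \<tau>(1), where k = k and n = n and b = u]
            add_mono[OF _ var_on_upper[OF m, where k = k and n = n]]]]] by blast
    also have "\<dots> = var_on k u b + ennreal (norm (k u - k t) + e / 2)"
      using assms by (simp add: ac_simps)
    finally have "var_on k t u + var_on k u b < var_on k u b + ennreal (norm (k u - k t) + e / 2)"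
      using var_on_add[of t u b k] elim by simp
    then have "var_on k t u < ennreal (norm (k u - k t) + e / 2)"
      by (simp add: add.commute ennreal_add_left_cancel_less)
    also have "\<dots> \<le> ennreal e" using elim by (intro ennreal_leI) auto
    finally have *: "var_on k t u < ennreal e" .
    also have "\<dots> < top" by simp
    finally show ?case using * by (rule enn2real_less_iff[THEN iffD2])
  qed
qed

text \<open>\<open>interval_measure\<close> behaves as a Stieltjes measure only for right-continuous
  functions, so this is the regularity on which \<open>variation_measure\<close> rests.\<close>

lemma var_on_right_continuous:
  fixes k :: "real \<Rightarrow> 'a::real_normed_vector"
  assumes "a \<le> t" "t < b" "continuous (at_right t) k" "var_on k a b < \<infinity>"
  shows "continuous (at_right t) (\<lambda>u. enn2real (var_on k a u))"
proof -
  have fin: "var_on k c d < \<infinity>" if "a \<le> c" "d \<le> b" for c d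
    using var_on_mono[OF that, of k] assms(4) by order
  have "((\<lambda>u. enn2real (var_on k t u)) \<longlongrightarrow> 0) (at_right t)"
    using var_on_right_continuous_0[OF assms(2,3) fin] assms(1)
    by (intro tendstoI) (auto simp: dist_real_def)
  then have "((\<lambda>u. enn2real (var_on k a t) + enn2real (var_on k t u)) \<longlongrightarrow>
      enn2real (var_on k a t) + 0) (at_right t)"
    by (rule tendsto_add[OF tendsto_const])
  moreover have "\<forall>\<^sub>F u in at_right t. enn2real (var_on k a t) + enn2real (var_on k t u) =
      enn2real (var_on k a u)"
  proof (rule eventually_at_rightI[OF _ assms(2)])
    fix u assume "u \<in> {t<..<b}"
    then show "enn2real (var_on k a t) + enn2real (var_on k t u) = enn2real (var_on k a u)"
      using var_on_add[of a t u k] fin[of a t] fin[of t u] assms by (simp add: enn2real_plus)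
  qed
  ultimately show ?thesis
    unfolding continuous_within by (simp add: filterlim_cong)
qed

section \<open>Equidistant grids and the convergence of their sums to the variation\<close>

lemma grid_0 [simp]: "grid a b n 0 = a"
  by (simp add: grid_def)

lemma grid_Suc_n [simp]: "grid a b n (Suc n) = b"
  by (simp add: grid_def del: of_nat_Suc)

lemma grid_mono: "a \<le> b \<Longrightarrow> i \<le> j \<Longrightarrow> grid a b n i \<le> grid a b n j"
  by (simp add: grid_def divide_right_mono mult_right_mono)

lemma grid_in: "a \<le> b \<Longrightarrow> i \<le> Suc n \<Longrightarrow> grid a b n i \<in> {a..b}"
  using grid_mono[of a b 0 i n] grid_mono[of a b i "Suc n" n] by simp

lemma grid_diff: "grid a b n (Suc i) - grid a b n i = (b - a) / real (Suc n)"
  by (simp add: grid_def distrib_right add_divide_distrib)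

lemma norm_diff_le_sum:
  fixes h :: "nat \<Rightarrow> 'a::real_normed_vector"
  assumes "p \<le> q"
  shows "norm (h q - h p) \<le> (\<Sum>l\<in>{p..<q}. norm (h (Suc l) - h l))"
proof -
  have "h q - h p = (\<Sum>l\<in>{p..<q}. h (Suc l) - h l)"
    using sum_Suc_diff'[OF assms, of h] by simp
  then show ?thesis by (simp add: norm_sum)
qed

text \<open>By the triangle inequality, skipping intermediate points can only decrease the sum of
  increments.\<close>

lemma chain_le_sum:
  fixes h :: "nat \<Rightarrow> 'a::real_normed_vector"
  assumes "mono p"
  shows "(\<Sum>j<m. norm (h (p (Suc j)) - h (p j))) \<le> (\<Sum>l\<in>{p 0..<p m}. norm (h (Suc l) - h l))"
proof (induction m)
  case (Suc m)
  have "p 0 \<le> p m" "p m \<le> p (Suc m)" using assms by (auto simp: mono_def)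
  then show ?case
    using Suc norm_diff_le_sum[of "p m" "p (Suc m)" h]
    by (simp add: sum.atLeastLessThan_concat[symmetric, of "p 0" "p m" "p (Suc m)"])
qed simp

lemma grid_sum_le_var_on:
  assumes "a \<le> b" "var_on k a b < \<infinity>"
  shows "(\<Sum>i<Suc n. norm (k (grid a b n (Suc i)) - k (grid a b n i))) \<le> enn2real (var_on k a b)"
proof -
  \<comment> \<open>\<open>var_on\<close> asks for an infinite monotone sequence inside the
    interval, so the grid is continued by its right endpoint.\<close>
  define \<tau> where "\<tau> i = grid a b n (min i (Suc n))" for i
  have "mono \<tau>" unfolding \<tau>_def by (intro monoI grid_mono assms) auto
  moreover have "range \<tau> \<subseteq> {a..b}" unfolding \<tau>_def using grid_in[OF assms(1)]
    by (auto simp del: atLeastAtMost_iff)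
  ultimately have "(\<Sum>i<Suc n. ennreal (norm (k (\<tau> (Suc i)) - k (\<tau> i)))) \<le> var_on k a b"
    by (rule var_on_upper)
  moreover have "(\<Sum>i<Suc n. ennreal (norm (k (\<tau> (Suc i)) - k (\<tau> i)))) =
      ennreal (\<Sum>i<Suc n. norm (k (grid a b n (Suc i)) - k (grid a b n i)))"
    unfolding sum_ennreal[OF norm_ge_zero, symmetric] by (intro sum.cong) (auto simp: \<tau>_def)
  ultimately have "ennreal (\<Sum>i<Suc n. norm (k (grid a b n (Suc i)) - k (grid a b n i)))
      \<le> ennreal (enn2real (var_on k a b))"
    using assms(2) by simp
  then show ?thesis by (subst (asm) ennreal_le_iff) auto
qed

text \<open>Rounding is upwards so that the grid points approach x from the right, where k is
  continuous. The endpoint b, at which nothing is assumed, is itself a grid point of every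
  grid.\<close>

lemma grid_round_up:
  fixes k :: "real \<Rightarrow> 'a::real_normed_vector"
  assumes "a < b" "\<And>x. x \<in> {a..<b} \<Longrightarrow> continuous (at_right x) k"
  obtains r where "\<And>n x. x \<in> {a..b} \<Longrightarrow> r n x \<le> Suc n" "\<And>n. mono (r n)"
    "\<And>x. x \<in> {a..b} \<Longrightarrow> (\<lambda>n. k (grid a b n (r n x))) \<longlonglongrightarrow> k x"
proof
  define r where "r n x = nat \<lceil>(x - a) / (b - a) * real (Suc n)\<rceil>" for n x
  show r_le: "r n x \<le> Suc n" if "x \<in> {a..b}" for n x
  proof -
    have "(x - a) / (b - a) * real (Suc n) \<le> 1 * real (Suc n)"
      using that assms(1) by (intro mult_right_mono) auto
    then show ?thesis unfolding r_def by (simp add: nat_le_iff ceiling_le_iff)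
  qed
  show "mono (r n)" for n
    unfolding r_def using assms(1)
    by (intro monoI nat_mono ceiling_mono mult_right_mono divide_right_mono) auto
  show "(\<lambda>n. k (grid a b n (r n x))) \<longlonglongrightarrow> k x" if x: "x \<in> {a..b}" for x
  proof (cases "x = b")
    case True
    then have "r n x = Suc n" for n using assms(1) by (simp add: r_def del: of_nat_Suc)
    then show ?thesis using True by simp
  next
    case False
    let ?y = "\<lambda>n. grid a b n (r n x)"
    have ge: "x \<le> ?y n" and le: "?y n \<le> x + (b - a) / real (Suc n)" for n
    proof -
      have q: "0 \<le> (x - a) / (b - a) * real (Suc n)" using x assms(1) by auto
      have "real (r n x) = of_int \<lceil>(x - a) / (b - a) * real (Suc n)\<rceil>"
        unfolding r_def using q by (simp add: of_nat_nat)
      then have "(x - a) / (b - a) * real (Suc n) \<le> real (r n x)"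
        "real (r n x) \<le> (x - a) / (b - a) * real (Suc n) + 1"
        by (simp_all only: of_int_ceiling_le_add_one le_of_int_ceiling)
      from this[THEN mult_right_mono, of "(b - a) / real (Suc n)"]
      have "(x - a) / (b - a) * real (Suc n) * ((b - a) / real (Suc n)) \<le> real (r n x) * ((b - a) / real (Suc n))"
        "real (r n x) * ((b - a) / real (Suc n)) \<le> ((x - a) / (b - a) * real (Suc n) + 1) * ((b - a) / real (Suc n))"
        using assms(1) by simp_all
      moreover have "(x - a) / (b - a) * real (Suc n) * ((b - a) / real (Suc n)) = x - a"
        using assms(1) by (simp del: of_nat_Suc)
      moreover have "((x - a) / (b - a) * real (Suc n) + 1) * ((b - a) / real (Suc n)) = x - a + (b - a) / real (Suc n)"
        using assms(1) by (simp add: distrib_right add_divide_distrib del: of_nat_Suc)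
      ultimately show "x \<le> ?y n" "?y n \<le> x + (b - a) / real (Suc n)"
        unfolding grid_def by auto
    qed
    have "(\<lambda>n. x + (b - a) / real (Suc n)) \<longlonglongrightarrow> x + 0"
      by (intro tendsto_intros lim_const_over_n LIMSEQ_Suc[of "\<lambda>n. (b - a) / real n"])
    then have "?y \<longlonglongrightarrow> x"
      by (intro tendsto_sandwich[of "\<lambda>_. x" ?y]) (use ge le in \<open>auto\<close>)
    show ?thesis
    proof (rule tendstoI)
      fix e :: real assume "0 < e"
      then have "\<forall>\<^sub>F y in at_right x. dist (k y) (k x) < e"
        using assms(2)[of x] x False by (auto simp: continuous_within tendsto_iff)
      then obtain d where d: "x < d" "\<And>y. x < y \<Longrightarrow> y < d \<Longrightarrow> dist (k y) (k x) < e"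
        by (auto simp: eventually_at_right_field)
      from order_tendstoD(2)[OF \<open>?y \<longlonglongrightarrow> x\<close> d(1)]
      show "\<forall>\<^sub>F n in sequentially. dist (k (?y n)) (k x) < e"
      proof eventually_elim
        case (elim n)
        then show ?case using d(2)[of "?y n"] ge[of n] \<open>0 < e\<close> by (cases "?y n = x") auto
      qed
    qed
  qed
qed

text \<open>A nearly optimal partition is moved onto the grid by rounding up. Its sum converges by
  right continuity and is bounded by the grid sum. For the indicator of a single point that no grid
  meets, the grid sums vanish although the variation does not, so some continuity is
  essential.\<close>

lemma grid_sum_tendsto_var_on:
  fixes k :: "real \<Rightarrow> 'a::real_normed_vector"
  assumes "a < b" "\<And>x. x \<in> {a..<b} \<Longrightarrow> continuous (at_right x) k" "var_on k a b < \<infinity>"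
  shows "(\<lambda>n. \<Sum>i<Suc n. norm (k (grid a b n (Suc i)) - k (grid a b n i))) \<longlonglongrightarrow>
    enn2real (var_on k a b)"
proof (rule order_tendstoI)
  let ?S = "\<lambda>n. \<Sum>i<Suc n. norm (k (grid a b n (Suc i)) - k (grid a b n i))"
  fix y assume y: "y < enn2real (var_on k a b)"
  show "\<forall>\<^sub>F n in sequentially. y < ?S n"
  proof (cases "y < 0")
    case True
    then show ?thesis by (intro always_eventually allI order_less_le_trans[OF True] sum_nonneg) auto
  next
    case False
    then have "ennreal y < ennreal (enn2real (var_on k a b))"
      using y by (intro ennreal_lessI) auto
    then have "ennreal y < var_on k a b" using assms(3) by simp
    then obtain m \<tau> where \<tau>: "mono \<tau>" "range \<tau> \<subseteq> {a..b}"
      "ennreal y < (\<Sum>i<m. ennreal (norm (k (\<tau> (Suc i)) - k (\<tau> i))))"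
      unfolding var_on_def[of k a b] less_SUP_iff by auto
    have *: "y < (\<Sum>i<m. norm (k (\<tau> (Suc i)) - k (\<tau> i)))"
      using \<tau>(3) False unfolding sum_ennreal[OF norm_ge_zero] by (subst (asm) ennreal_less_iff) auto
    obtain r where r: "\<And>n x. x \<in> {a..b} \<Longrightarrow> r n x \<le> Suc n" "\<And>n. mono (r n)"
      "\<And>x. x \<in> {a..b} \<Longrightarrow> (\<lambda>n. k (grid a b n (r n x))) \<longlonglongrightarrow> k x"
      using grid_round_up[OF assms(1,2)] by metis
    have in_ab: "\<tau> i \<in> {a..b}" for i using \<tau>(2) by (rule range_subsetD)
    have "(\<lambda>n. \<Sum>i<m. norm (k (grid a b n (r n (\<tau> (Suc i)))) - k (grid a b n (r n (\<tau> i))))) \<longlonglongrightarrow>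
        (\<Sum>i<m. norm (k (\<tau> (Suc i)) - k (\<tau> i)))"
      by (intro tendsto_sum tendsto_norm tendsto_diff r(3) in_ab)
    from order_tendstoD(1)[OF this *] show ?thesis
    proof eventually_elim
      case (elim n)
      define h where "h i = k (grid a b n i)" for i
      have "mono (\<lambda>i. r n (\<tau> i))" using r(2)[of n] \<tau>(1) by (auto simp: mono_def)
      note elim
      also have "(\<Sum>i<m. norm (k (grid a b n (r n (\<tau> (Suc i)))) - k (grid a b n (r n (\<tau> i)))))
          \<le> (\<Sum>l\<in>{r n (\<tau> 0)..<r n (\<tau> m)}. norm (h (Suc l) - h l))"
        using chain_le_sum[OF \<open>mono (\<lambda>i. r n (\<tau> i))\<close>, of h m] by (simp add: h_def)
      also have "\<dots> \<le> (\<Sum>l<Suc n. norm (h (Suc l) - h l))"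
        using r(1)[OF in_ab, of n m] by (intro sum_mono2) auto
      finally show ?case by (simp add: h_def)
    qed
  qed
next
  let ?S = "\<lambda>n. \<Sum>i<Suc n. norm (k (grid a b n (Suc i)) - k (grid a b n i))"
  fix y assume "enn2real (var_on k a b) < y"
  then show "\<forall>\<^sub>F n in sequentially. ?S n < y"
    using grid_sum_le_var_on[OF less_imp_le[OF assms(1)] assms(3)]
    by (intro always_eventually allI) (rule order_le_less_trans)
qed

section \<open>The reflection term\<close>

lemma variation_measure_Ioc:
  fixes k :: "real \<Rightarrow> 'a::real_normed_vector"
  assumes "0 \<le> a" "a \<le> b" "b \<le> T"
    and rc: "\<And>t. t \<in> {0..<T} \<Longrightarrow> continuous (at_right t) k" and fin: "var_on k 0 T < \<infinity>"
  shows "emeasure (variation_measure T k) {a<..b} = ennreal (enn2real (var_on k a b))"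
proof -
  define F where "F s = enn2real (var_on k 0 (max 0 (min s T)))" for s
  have finite: "var_on k c d < \<infinity>" if "0 \<le> c" "d \<le> T" for c d
    using var_on_mono[OF that, of k] fin by order
  have "F x \<le> F y" if "x \<le> y" for x y
    unfolding F_def using that finite[of 0 "max 0 (min y T)"] assms
    by (intro enn2real_mono var_on_mono) (auto simp: less_top)
  moreover have "continuous (at_right t) F" for t
  proof -
    \<comment> \<open>The clamping in \<open>variation_measure\<close> makes F constant to the left
      of 0 and to the right of T; only in between does the continuity of the variation
      matter.\<close>
    consider "t < 0" | "T \<le> t" | "t \<in> {0..<T}" by force
    then show ?thesis
    proof cases
      case 1
      then have "\<forall>\<^sub>F u in at_right t. F u = F t"
        using assms by (intro eventually_at_rightI[of t 0]) (auto simp: F_def)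
      then show ?thesis unfolding continuous_within by (rule tendsto_eventually)
    next
      case 2
      then have "\<forall>\<^sub>F u in at_right t. F u = F t"
        using assms by (intro eventually_at_rightI[of t "t + 1"]) (auto simp: F_def)
      then show ?thesis unfolding continuous_within by (rule tendsto_eventually)
    next
      case 3
      then have "continuous (at_right t) (\<lambda>u. enn2real (var_on k 0 u))"
        by (intro var_on_right_continuous[where b = T] rc fin) auto
      moreover have "\<forall>\<^sub>F u in at_right t. enn2real (var_on k 0 u) = F u"
        using 3 by (intro eventually_at_rightI[of t T]) (auto simp: F_def)
      moreover have "F t = enn2real (var_on k 0 t)" using 3 by (auto simp: F_def)
      ultimately show ?thesis unfolding continuous_within by (simp add: filterlim_cong)
    qed
  qed
  ultimately have "emeasure (interval_measure F) {a<..b} = F b - F a"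
    using assms(2) by (intro emeasure_interval_measure_Ioc)
  moreover have "F b - F a = enn2real (var_on k a b)"
    using assms var_on_add[of 0 a b k] finite[of 0 a] finite[of a b]
    by (simp add: F_def enn2real_plus)
  moreover have "variation_measure T k = interval_measure F"
    by (simp add: variation_measure_def F_def[abs_def] variation_eq_var_on)
  ultimately show ?thesis by simp
qed

lemma normal_field_norm_le: "norm (normal_field \<phi> y) \<le> 1"
  by (cases "grad \<phi> y = 0") (simp_all add: normal_field_def)

lemma normal_field_measurable:
  fixes \<phi> :: "real ^ 'n \<Rightarrow> real"
  assumes "smoothness_cond \<phi>"
  shows "normal_field \<phi> \<in> borel_measurable borel"
proof -
  have "isCont (grad \<phi>) y" for y
    using assms differentiable_imp_continuous_within[of "grad \<phi>" y UNIV]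
    by (auto simp: smoothness_cond_def C2_def)
  then have [measurable]: "grad \<phi> \<in> borel_measurable borel"
    by (intro borel_measurable_continuous_onI continuous_at_imp_continuous_on) auto
  have [measurable]: "frontier (sublevel \<phi>) \<in> sets borel"
    by (simp add: borel_closed)
  show ?thesis unfolding normal_field_def by measurable
qed

lemma set_integrable_variation_measure:
  fixes k :: "real \<Rightarrow> 'a::real_normed_vector" and h :: "'b::euclidean_space \<Rightarrow> 'b"
  assumes "0 \<le> a" "a \<le> b" "b \<le> T"
    and "\<And>t. t \<in> {0..<T} \<Longrightarrow> continuous (at_right t) k" and "var_on k 0 T < \<infinity>"
    and "h \<in> borel_measurable borel" "\<And>x. norm (h x) \<le> 1" "continuous_on {0..T} y"
  shows "set_integrable (variation_measure T k) {a<..b} (\<lambda>s. h (y s))"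
proof -
  have [measurable_cong]: "sets (variation_measure T k) = sets borel"
    by (simp add: variation_measure_def)
  have "continuous_on {a<..b} y"
    using assms by (intro continuous_on_subset[OF assms(8)]) auto
  then have y: "y \<in> borel_measurable (restrict_space borel {a<..b})"
    by (rule borel_measurable_continuous_on_restrict)
  have "(\<lambda>s. h (y s)) \<in> borel_measurable (restrict_space borel {a<..b})"
    using measurable_compose[OF y assms(6)] .
  then have "set_borel_measurable borel {a<..b} (\<lambda>s. h (y s))"
    by (simp add: set_borel_measurable_def borel_measurable_restrict_space_iff)
  then have m: "(\<lambda>s. indicator {a<..b} s *\<^sub>R h (y s)) \<in> borel_measurable (variation_measure T k)"
    unfolding set_borel_measurable_def by measurable
  have "emeasure (variation_measure T k) {a<..b} < \<infinity>"
    using variation_measure_Ioc[OF assms(1-5)] by simp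
  then have "integrable (variation_measure T k) (indicator {a<..b} :: real \<Rightarrow> real)"
    by (intro integrable_real_indicator) (auto simp: variation_measure_def)
  then show ?thesis unfolding set_integrable_def
    by (rule Bochner_Integration.integrable_bound[OF _ m])
      (use assms(7) in \<open>auto split: split_indicator\<close>)
qed

lemma increment_eq_set_integral:
  fixes k :: "real \<Rightarrow> 'b::euclidean_space" and h :: "'b \<Rightarrow> 'b"
  assumes "0 \<le> a" "a \<le> b" "b \<le> T"
    and "\<And>t. t \<in> {0..<T} \<Longrightarrow> continuous (at_right t) k" and "var_on k 0 T < \<infinity>"
    and "h \<in> borel_measurable borel" "\<And>x. norm (h x) \<le> 1" "continuous_on {0..T} y"
    and eq: "\<And>t. t \<in> {0..T} \<Longrightarrow> k t = (LINT s:{0<..t}|variation_measure T k. h (y s))"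
  shows "k b - k a = (LINT s:{a<..b}|variation_measure T k. h (y s))"
proof -
  have "{0<..b} = {0<..a} \<union> {a<..b}" using assms by auto
  moreover have "(LINT s:{0<..a} \<union> {a<..b}|variation_measure T k. h (y s)) =
      (LINT s:{0<..a}|variation_measure T k. h (y s)) + (LINT s:{a<..b}|variation_measure T k. h (y s))"
    using assms(1-3)
    by (intro set_integral_Un set_integrable_variation_measure[OF _ _ _ assms(4-8)]) auto
  ultimately have "k b = (LINT s:{0<..a}|variation_measure T k. h (y s)) +
      (LINT s:{a<..b}|variation_measure T k. h (y s))"
    using eq[of b] assms(1-3) by simp
  then show ?thesis using assms(1-3) eq[of a] by simp
qed

text \<open>A constant vector x passes through the Stieltjes integral, so a lower bound on its
  product with the direction of reflection becomes a bound proportional to the variation. The energy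
  sum evaluates x at the left grid point, which makes it constant on each cell.\<close>

lemma inner_increment_ge:
  fixes k :: "real \<Rightarrow> 'b::euclidean_space" and h :: "'b \<Rightarrow> 'b"
  assumes "0 \<le> a" "a \<le> b" "b \<le> T"
    and "\<And>t. t \<in> {0..<T} \<Longrightarrow> continuous (at_right t) k" and "var_on k 0 T < \<infinity>"
    and "h \<in> borel_measurable borel" "\<And>x. norm (h x) \<le> 1" "continuous_on {0..T} y"
    and "\<And>t. t \<in> {0..T} \<Longrightarrow> k t = (LINT s:{0<..t}|variation_measure T k. h (y s))"
    and bound: "\<And>s. s \<in> {a<..b} \<Longrightarrow> c \<le> x \<bullet> h (y s)"
  shows "c * enn2real (var_on k a b) \<le> x \<bullet> (k b - k a)"
proof -
  have int: "set_integrable (variation_measure T k) {a<..b} (\<lambda>s. h (y s))"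
    by (intro set_integrable_variation_measure assms)
  have em: "emeasure (variation_measure T k) {a<..b} = ennreal (enn2real (var_on k a b))"
    by (intro variation_measure_Ioc assms)
  have "c * enn2real (var_on k a b) = (LINT s:{a<..b}|variation_measure T k. c)"
    using em by (simp add: set_lebesgue_integral_def measure_def variation_measure_def)
  also have "\<dots> \<le> (LINT s:{a<..b}|variation_measure T k. x \<bullet> h (y s))"
  proof (rule set_integral_mono)
    show "set_integrable (variation_measure T k) {a<..b} (\<lambda>s. c)"
      using em by (simp add: set_integrable_def variation_measure_def)
    show "set_integrable (variation_measure T k) {a<..b} (\<lambda>s. x \<bullet> h (y s))"
      using int by (simp add: set_integrable_def flip: inner_scaleR_right)
  qed (rule bound)
  also have "\<dots> = x \<bullet> (LINT s:{a<..b}|variation_measure T k. h (y s))"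
    using int by (simp add: set_lebesgue_integral_def set_integrable_def flip: inner_scaleR_right)
  also have "(LINT s:{a<..b}|variation_measure T k. h (y s)) = k b - k a"
    by (intro increment_eq_set_integral[symmetric] assms)
  finally show ?thesis .
qed

lemma norm_diff_le_var_on:
  fixes k :: "real \<Rightarrow> 'a::real_normed_vector"
  assumes "a \<le> b" "var_on k a b < \<infinity>"
  shows "norm (k b - k a) \<le> enn2real (var_on k a b)"
  using grid_sum_le_var_on[OF assms, of 0] by simp

text \<open>The sphere condition concerns y - y' at the running time, while the energy sum needs x
  frozen at a grid point; e is the distance between the two. The exchange costs
  \<open>C / R0 * e\<close> in the squared norm and e in the inner product with a vector of norm at
  most 1. Off the boundary the normal is zero and the bound is trivial.\<close>

lemma exterior_sphere_inner_ge:
  fixes \<phi> :: "real ^ 'n \<Rightarrow> real"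
  assumes "exterior_sphere_constant \<phi> R0"
    and "y \<in> closure (sublevel \<phi>)" "y' \<in> closure (sublevel \<phi>)"
    and "norm ((y - y') - x) \<le> e" "norm (y - y') \<le> C" "norm x \<le> C"
  shows "- ((norm x)\<^sup>2 / (2 * R0) + (C / R0 + 1) * e) \<le> x \<bullet> normal_field \<phi> y"
proof -
  have R0: "R0 > 0" using assms(1) by (simp add: exterior_sphere_constant_def)
  have "norm (y - y') \<le> norm x + e"
    using norm_triangle_ineq[of x "(y - y') - x"] assms(4) by simp
  then have "(norm (y - y'))\<^sup>2 - (norm x)\<^sup>2 \<le> 2 * C * e"
  proof -
    have "(norm (y - y'))\<^sup>2 - (norm x)\<^sup>2 = (norm (y - y') - norm x) * (norm (y - y') + norm x)"
      by (simp add: power2_eq_square algebra_simps)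
    also have "\<dots> \<le> e * (norm (y - y') + norm x)"
      using \<open>norm (y - y') \<le> norm x + e\<close> by (intro mult_right_mono) auto
    also have "\<dots> \<le> e * (2 * C)"
      using assms(4-6) norm_ge_zero[of "(y - y') - x"] by (intro mult_left_mono) linarith+
    finally show ?thesis by (simp add: ac_simps)
  qed
  then have "((norm (y - y'))\<^sup>2 - (norm x)\<^sup>2) / (2 * R0) \<le> (2 * C * e) / (2 * R0)"
    using R0 by (intro divide_right_mono) auto
  then have 1: "(norm (y - y'))\<^sup>2 / (2 * R0) \<le> (norm x)\<^sup>2 / (2 * R0) + C / R0 * e"
    by (simp add: diff_divide_distrib)
  have 2: "- ((norm (y - y'))\<^sup>2 / (2 * R0)) \<le> (y - y') \<bullet> normal_field \<phi> y"
  proof (cases "y \<in> frontier (sublevel \<phi>)")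
    case True
    then show ?thesis using assms(1,3) by (force simp: exterior_sphere_constant_def)
  next
    case False
    then show ?thesis using R0 by (simp add: normal_field_def)
  qed
  have "\<bar>((y - y') - x) \<bullet> normal_field \<phi> y\<bar> \<le> norm ((y - y') - x) * norm (normal_field \<phi> y)"
    by (rule Cauchy_Schwarz_ineq2)
  also have "\<dots> \<le> e * 1"
    using assms(4) normal_field_norm_le by (intro mult_mono) (auto intro: order_trans[OF norm_ge_zero])
  finally have "(y - y') \<bullet> normal_field \<phi> y - e \<le> x \<bullet> normal_field \<phi> y"
    by (simp add: inner_diff_left abs_le_iff)
  then show ?thesis using 1 2 by (simp add: distrib_right)
qed

section \<open>Gaussian increments and the completed filtration\<close>

lemma borel_measurable_vec_nth [measurable]: "(\<lambda>x :: real ^ 'm. x $ k) \<in> borel_measurable borel"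
  by (intro borel_measurable_continuous_onI continuous_intros)

text \<open>Converts a product over coordinates, as in the density of
  \<open>brownian_motion\<close>, into the product over \<open>Basis\<close> to which Fubini's
  theorem for \<open>lborel\<close> applies; the \<open>THE\<close> term inverts
  \<open>axis\<close>.\<close>

lemma prod_UNIV_eq_prod_Basis:
  fixes g :: "'m::finite \<Rightarrow> 'b::comm_monoid_mult"
  shows "(\<Prod>i\<in>UNIV. g i) = (\<Prod>b\<in>(Basis :: (real ^ 'm) set). g (THE i. b = axis i 1))"
proof -
  let ?ax = "\<lambda>i::'m. axis i (1::real)"
  have inj: "inj ?ax" by (auto simp: inj_def axis_eq_axis)
  have Basis: "(Basis :: (real ^ 'm) set) = range ?ax" by (auto simp: Basis_vec_def)
  have "(\<Prod>b\<in>(Basis :: (real ^ 'm) set). g (THE i. b = axis i 1)) =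
      (\<Prod>i\<in>UNIV. g (THE j. ?ax i = ?ax j))"
    unfolding Basis prod.reindex[OF inj] o_def by (rule refl)
  then show ?thesis by (simp add: axis_eq_axis)
qed

lemma gaussian_second_moment:
  fixes i :: "'m::finite" and \<sigma> :: real
  assumes "\<sigma> > 0"
  shows "(\<integral>\<^sup>+x. ennreal ((x $ i)\<^sup>2) * ennreal (\<Prod>j\<in>UNIV. normal_density 0 \<sigma> (x $ j))
    \<partial>(lborel :: (real ^ 'm) measure)) = ennreal (\<sigma>\<^sup>2)"
proof -
  \<comment> \<open>Only factor i carries the square; every other factor is a density of total mass
    1.\<close>
  define h where "h j y = (if j = i then ennreal (y\<^sup>2) else 1) * ennreal (normal_density 0 \<sigma> y)"
    for j and y :: real
  have one: "(\<integral>\<^sup>+y. h j y \<partial>lborel) = (if j = i then ennreal (\<sigma>\<^sup>2) else 1)" for j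
  proof (cases "j = i")
    case True
    have "has_bochner_integral lborel (\<lambda>y. normal_density 0 \<sigma> y * y\<^sup>2) (\<sigma>\<^sup>2)"
      using normal_moment_even[OF assms, of 0 1] assms
      by (simp add: power2_eq_square field_simps)
    then have "(\<integral>\<^sup>+y. ennreal (normal_density 0 \<sigma> y * y\<^sup>2) \<partial>lborel) = ennreal (\<sigma>\<^sup>2)"
      by (simp add: has_bochner_integral_iff nn_integral_eq_integral)
    then show ?thesis using True by (simp add: h_def ennreal_mult' mult.commute)
  next
    case False
    have "(\<integral>\<^sup>+y. ennreal (normal_density 0 \<sigma> y) \<partial>lborel) = ennreal 1"
      using assms by (subst nn_integral_eq_integral) auto
    then show ?thesis using False by (simp add: h_def)
  qed
  have [measurable]: "h j \<in> borel_measurable borel" for j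
    unfolding h_def[abs_def] by measurable
  have "ennreal ((x $ i)\<^sup>2) * ennreal (\<Prod>j\<in>UNIV. normal_density 0 \<sigma> (x $ j)) =
      (\<Prod>j\<in>UNIV. h j (x $ j))" for x :: "real ^ 'm"
    by (simp add: h_def prod.distrib prod_ennreal[symmetric])
  also have "(\<Prod>j\<in>UNIV. h j (x $ j)) = (\<Prod>b\<in>Basis. h (THE j. b = axis j 1) (x \<bullet> b))"
    for x :: "real ^ 'm"
    unfolding prod_UNIV_eq_prod_Basis
    by (rule prod.cong) (auto simp: Basis_vec_def axis_eq_axis inner_axis)
  finally have "(\<integral>\<^sup>+x. ennreal ((x $ i)\<^sup>2) * ennreal (\<Prod>j\<in>UNIV. normal_density 0 \<sigma> (x $ j))
      \<partial>(lborel :: (real ^ 'm) measure)) =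
      (\<integral>\<^sup>+x. (\<Prod>b\<in>Basis. h (THE j. b = axis j 1) (x \<bullet> b)) \<partial>(lborel :: (real ^ 'm) measure))"
    by simp
  also have "\<dots> = (\<Prod>b\<in>(Basis :: (real ^ 'm) set). \<integral>\<^sup>+y. h (THE j. b = axis j 1) y \<partial>lborel)"
    by (rule nn_integral_lborel_prod) auto
  also have "\<dots> = (\<Prod>j\<in>UNIV. if j = i then ennreal (\<sigma>\<^sup>2) else 1)"
    unfolding one by (rule prod_UNIV_eq_prod_Basis[symmetric])
  also have "\<dots> = ennreal (\<sigma>\<^sup>2)" by simp
  finally show ?thesis .
qed

text \<open>A reflection is a diagonal linear map with entries 1 and -1, so the density in the
  change of variables is 1.\<close>

lemma lborel_flip:
  fixes i :: "'m::finite"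
  shows "distr lborel borel (\<lambda>x. \<chi> j. if j = i then - x $ j else x $ j) = (lborel :: (real ^ 'm) measure)"
proof -
  define c :: "real ^ 'm \<Rightarrow> real" where "c b = (if b = axis i 1 then -1 else 1)" for b
  have eq: "0 + (\<Sum>b\<in>Basis. (c b * (x \<bullet> b)) *\<^sub>R b) = (\<chi> j. if j = i then - x $ j else x $ j)" for x
  proof (rule vec_eq_iff[THEN iffD2], rule allI)
    fix j
    have "(0 + (\<Sum>b\<in>Basis. (c b * (x \<bullet> b)) *\<^sub>R b)) $ j = (\<Sum>b\<in>Basis. (c b * (x \<bullet> b)) *\<^sub>R b) \<bullet> axis j 1"
      by (simp add: inner_axis)
    also have "\<dots> = c (axis j 1) * (x \<bullet> axis j 1)"
      by (rule inner_sum_left_Basis) (simp add: axis_in_Basis_iff)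
    finally show "(0 + (\<Sum>b\<in>Basis. (c b * (x \<bullet> b)) *\<^sub>R b)) $ j = (\<chi> j. if j = i then - x $ j else x $ j) $ j"
      by (auto simp: c_def inner_axis axis_eq_axis)
  qed
  have "lborel = density (distr lborel borel (\<lambda>x. 0 + (\<Sum>b\<in>Basis. (c b * (x \<bullet> b)) *\<^sub>R b)))
      (\<lambda>_. ennreal (\<Prod>b\<in>Basis. \<bar>c b\<bar>))"
    by (rule lborel_affine_euclidean) (simp add: c_def)
  moreover have "(\<Prod>b\<in>Basis. \<bar>c b\<bar>) = 1" by (intro prod.neutral) (simp add: c_def)
  ultimately show ?thesis unfolding eq by (simp add: density_1)
qed

text \<open>Flipping the sign of one coordinate preserves the centred Gaussian law, so every integrand
  that is odd in that coordinate integrates to zero.\<close>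

lemma gaussian_odd_integral:
  fixes g :: "real ^ 'm::finite \<Rightarrow> real" and i :: 'm
  assumes [measurable]: "g \<in> borel_measurable borel"
    and odd: "\<And>x. g (\<chi> j. if j = i then - x $ j else x $ j) = - g x"
  shows "(\<integral>x. (\<Prod>j\<in>UNIV. normal_density 0 \<sigma> (x $ j)) * g x \<partial>lborel) = 0"
proof -
  let ?p = "\<lambda>x :: real ^ 'm. \<Prod>j\<in>UNIV. normal_density 0 \<sigma> (x $ j)"
  let ?T = "\<lambda>x :: real ^ 'm. \<chi> j. if j = i then - x $ j else x $ j"
  have p: "?p (?T x) = ?p x" for x
    by (rule prod.cong) (auto simp: normal_density_def)
  have "continuous_on UNIV (\<lambda>x :: real ^ 'm. if j = i then - x $ j else x $ j)" for j
    by (cases "j = i") (auto intro!: continuous_intros)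
  then have [measurable]: "?T \<in> borel_measurable borel"
    by (intro borel_measurable_continuous_onI continuous_on_vec_lambda)
  have "(\<integral>x. ?p x * g x \<partial>lborel) = (\<integral>x. ?p x * g x \<partial>distr lborel borel ?T)"
    by (simp add: lborel_flip)
  also have "\<dots> = (\<integral>x. ?p (?T x) * g (?T x) \<partial>lborel)"
    by (rule integral_distr) measurable
  also have "\<dots> = (\<integral>x. - (?p x * g x) \<partial>lborel)"
    by (simp only: p odd) simp
  finally show ?thesis by simp
qed

text \<open>The mean and the mixed moment are odd in coordinate i, hence zero by symmetry; only the
  square needs a computed integral.\<close>

lemma gaussian_moments:
  fixes X :: "'w \<Rightarrow> real ^ 'm"
  assumes X: "distributed M lborel X (\<lambda>x. ennreal (\<Prod>i\<in>UNIV. normal_density 0 \<sigma> (x $ i)))"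
    and "\<sigma> > 0"
  shows "integrable M (\<lambda>\<omega>. (X \<omega> $ i)\<^sup>2)" "(\<integral>\<omega>. (X \<omega> $ i)\<^sup>2 \<partial>M) = \<sigma>\<^sup>2"
    "(\<integral>\<omega>. X \<omega> $ i \<partial>M) = 0"
    "i \<noteq> j \<Longrightarrow> (\<integral>\<omega>. X \<omega> $ i * X \<omega> $ j \<partial>M) = 0"
proof -
  have [measurable]: "X \<in> borel_measurable M"
    using distributed_measurable[OF X] by simp
  have [measurable]: "(\<lambda>\<omega>. X \<omega> $ k) \<in> borel_measurable M" for k
    by (rule measurable_compose[OF _ borel_measurable_vec_nth]) simp
  have [measurable]: "(\<lambda>\<omega>. (X \<omega> $ i)\<^sup>2) \<in> borel_measurable M" by measurable
  have nn: "(\<integral>\<^sup>+\<omega>. ennreal ((X \<omega> $ i)\<^sup>2) \<partial>M) = ennreal (\<sigma>\<^sup>2)"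
    using distributed_nn_integral[OF X, of "\<lambda>x. ennreal ((x $ i)\<^sup>2)"]
      gaussian_second_moment[OF assms(2), of i]
    by (simp add: mult.commute)
  show int: "integrable M (\<lambda>\<omega>. (X \<omega> $ i)\<^sup>2)"
    by (rule integrableI_nonneg) (use nn in \<open>auto simp del: power2_eq_square\<close>)
  show "(\<integral>\<omega>. (X \<omega> $ i)\<^sup>2 \<partial>M) = \<sigma>\<^sup>2"
    using nn by (simp add: integral_eq_nn_integral)
  have nonneg: "0 \<le> (\<Prod>i\<in>UNIV. normal_density 0 \<sigma> (x $ i))" for x :: "real ^ 'm"
    by (intro prod_nonneg) auto
  have *: "(\<integral>\<omega>. g (X \<omega>) \<partial>M) = (\<integral>x. (\<Prod>i\<in>UNIV. normal_density 0 \<sigma> (x $ i)) * g x \<partial>lborel)"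
    if "g \<in> borel_measurable borel" for g :: "real ^ 'm \<Rightarrow> real"
    using distributed_integral[OF X, of g] that nonneg by simp
  show "(\<integral>\<omega>. X \<omega> $ i \<partial>M) = 0"
    using *[of "\<lambda>x. x $ i"] gaussian_odd_integral[of "\<lambda>x. x $ i" i \<sigma>] by simp
  show "(\<integral>\<omega>. X \<omega> $ i * X \<omega> $ j \<partial>M) = 0" if "i \<noteq> j"
    using *[of "\<lambda>x. x $ i * x $ j"] gaussian_odd_integral[of "\<lambda>x. x $ i * x $ j" i \<sigma>] that by simp
qed

section \<open>The Brownian basis and independence of increments from the completed past\<close>

locale brownian_basis = prob_space M + complete_measure M
  for M :: "'w measure" and T :: real and W :: "real \<Rightarrow> 'w \<Rightarrow> real ^ 'm" +
  assumes bm: "brownian_motion M T W"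
begin

abbreviation F :: "real \<Rightarrow> 'w measure" where
  "F \<equiv> completed_filtration M W"

abbreviation inc :: "real \<Rightarrow> real \<Rightarrow> 'm \<Rightarrow> 'w \<Rightarrow> real" where
  "inc s t c \<omega> \<equiv> (W t \<omega> - W s \<omega>) $ c"

lemma W_measurable [measurable]: "t \<in> {0..T} \<Longrightarrow> W t \<in> borel_measurable M"
  using bm by (simp add: brownian_motion_def)

lemma space_natural [simp]: "space (natural_filtration M W t) = space M"
  by (simp add: natural_filtration_def space_measure_of_conv)

lemma space_F [simp]: "space (F t) = space M"
  by (simp add: completed_filtration_def space_measure_of_conv)

lemma sets_natural: "sets (natural_filtration M W t) =
    sigma_sets (space M) (\<Union>s\<in>{0..t}. {W s -` A \<inter> space M | A. A \<in> sets borel})"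
  unfolding natural_filtration_def by (rule sets_measure_of) auto

lemma sets_natural_subset:
  assumes "t \<le> T"
  shows "sets (natural_filtration M W t) \<subseteq> sets M"
  unfolding sets_natural
  by (rule sets.sigma_sets_subset) (use assms in \<open>auto intro!: measurable_sets[OF W_measurable]\<close>)

lemma sets_F:
  assumes "t \<le> T"
  shows "sets (F t) = sigma_sets (space M) (sets (natural_filtration M W t) \<union> null_sets M)"
  unfolding completed_filtration_def
  by (rule sets_measure_of)
    (use sets_natural_subset[OF assms] sets.sets_into_space in \<open>auto simp: null_sets_def\<close>)

lemma sets_F_subset: "t \<le> T \<Longrightarrow> sets (F t) \<subseteq> sets M"
  by (subst sets_F, assumption, rule sets.sigma_sets_subset)
    (use sets_natural_subset in \<open>auto simp: null_sets_def\<close>)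

lemma sets_F_mono:
  assumes "s \<le> t" "t \<le> T"
  shows "sets (F s) \<subseteq> sets (F t)"
proof -
  have "sets (natural_filtration M W s) \<subseteq> sets (natural_filtration M W t)"
    unfolding sets_natural
    by (rule sigma_sets_mono'[OF UN_mono]) (use assms in auto)
  then have "sigma_sets (space M) (sets (natural_filtration M W s) \<union> null_sets M) \<subseteq>
      sigma_sets (space M) (sets (natural_filtration M W t) \<union> null_sets M)"
    by (intro sigma_sets_mono' Un_mono order_refl)
  then show ?thesis using assms by (simp add: sets_F)
qed

lemma F_measurable_mono: "g \<in> measurable (F s) N \<Longrightarrow> s \<le> t \<Longrightarrow> t \<le> T \<Longrightarrow> g \<in> measurable (F t) N"
  using sets_F_mono[of s t] by (auto simp: measurable_def)

lemma F_measurable_M: "g \<in> measurable (F s) N \<Longrightarrow> s \<le> T \<Longrightarrow> g \<in> measurable M N"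
  using sets_F_subset[of s] by (auto simp: measurable_def)

lemma W_measurable_F:
  assumes "0 \<le> s" "s \<le> t" "t \<le> T"
  shows "W s \<in> borel_measurable (F t)"
proof (rule measurableI)
  fix A :: "(real ^ 'm) set" assume "A \<in> sets borel"
  then have "W s -` A \<inter> space M \<in> sets (natural_filtration M W t)"
    unfolding sets_natural using assms by (intro sigma_sets.Basic UN_I[of s]) auto
  then show "W s -` A \<inter> space (F t) \<in> sets (F t)"
    using assms by (simp add: sets_F)
qed simp

text \<open>The sets that agree with a set of the natural filtration up to a null set form a
  sigma-algebra containing all generators of \<open>F t\<close>. This is what carries independence
  over to the completion.\<close>

lemma F_eq_natural_mod_null:
  assumes "t \<le> T" "A \<in> sets (F t)"
  shows "\<exists>B\<in>sets (natural_filtration M W t). (A - B) \<union> (B - A) \<in> null_sets M"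
  using assms(2) unfolding sets_F[OF assms(1)]
proof induction
  case (Basic a)
  then show ?case
  proof
    assume "a \<in> null_sets M"
    then show ?thesis by (intro bexI[of _ "{}"]) auto
  qed (auto intro!: bexI[of _ a])
next
  case (Compl a)
  then obtain B where B: "B \<in> sets (natural_filtration M W t)" "(a - B) \<union> (B - a) \<in> null_sets M"
    by auto
  have "a \<in> sets M"
    using Compl.hyps sets_F_subset[OF assms(1)] unfolding sets_F[OF assms(1)] by auto
  then have "((space M - a) - (space M - B)) \<union> ((space M - B) - (space M - a)) = (a - B) \<union> (B - a)"
    using sets.sets_into_space[of a M] sets.sets_into_space[of B M] B(1) sets_natural_subset[OF assms(1)]
    by auto
  moreover have "space M - B \<in> sets (natural_filtration M W t)"
    using sets.compl_sets[OF B(1)] by simp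
  ultimately show ?case using B(2) by (intro bexI[of _ "space M - B"]) simp_all
next
  case (Union a)
  then obtain B where B: "\<And>i. B i \<in> sets (natural_filtration M W t)"
    "\<And>i. (a i - B i) \<union> (B i - a i) \<in> null_sets M"
    by metis
  have "a i \<in> sets M" for i
    using Union.hyps sets_F_subset[OF assms(1)] unfolding sets_F[OF assms(1)] by auto
  moreover have "B i \<in> sets M" for i using B(1) sets_natural_subset[OF assms(1)] by auto
  ultimately have "(\<Union>i. a i) - (\<Union>i. B i) \<union> ((\<Union>i. B i) - (\<Union>i. a i)) \<in> sets M" by auto
  moreover have "(\<Union>i. a i) - (\<Union>i. B i) \<union> ((\<Union>i. B i) - (\<Union>i. a i)) \<subseteq> (\<Union>i. (a i - B i) \<union> (B i - a i))"
    by auto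
  moreover have "(\<Union>i. (a i - B i) \<union> (B i - a i)) \<in> null_sets M" using B(2) by auto
  ultimately have "(\<Union>i. a i) - (\<Union>i. B i) \<union> ((\<Union>i. B i) - (\<Union>i. a i)) \<in> null_sets M"
    by (meson null_sets_subset)
  then show ?case using B(1) by (intro bexI[of _ "\<Union>i. B i"]) auto
qed auto

text \<open>\<open>brownian_motion\<close> grants independence only from the uncompleted past.
  Replacing an event by an almost surely equal one of the natural filtration changes neither
  probability.\<close>

lemma F_increment_indep:
  assumes "0 \<le> s" "s < t" "t \<le> T"
  shows "indep_set (sets (F s)) {(\<lambda>\<omega>. W t \<omega> - W s \<omega>) -` A \<inter> space M | A. A \<in> sets borel}"
  unfolding indep_sets2_eq
proof (intro conjI ballI)
  have indep: "indep_set (sets (natural_filtration M W s))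
      {(\<lambda>\<omega>. W t \<omega> - W s \<omega>) -` A \<inter> space M | A. A \<in> sets borel}"
    using bm assms by (simp add: brownian_motion_def)
  note indep' = indep[unfolded indep_sets2_eq]
  show "sets (F s) \<subseteq> events" using assms by (intro sets_F_subset) auto
  show "{(\<lambda>\<omega>. W t \<omega> - W s \<omega>) -` A \<inter> space M | A. A \<in> sets borel} \<subseteq> events"
    using indep' by blast
  fix a b assume a: "a \<in> sets (F s)" and b: "b \<in> {(\<lambda>\<omega>. W t \<omega> - W s \<omega>) -` A \<inter> space M | A. A \<in> sets borel}"
  obtain B where B: "B \<in> sets (natural_filtration M W s)" "(a - B) \<union> (B - a) \<in> null_sets M"
    using F_eq_natural_mod_null[OF _ a] assms by auto
  have ev: "a \<in> events" "B \<in> events" "b \<in> events"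
    using a b B indep' sets_F_subset[of s] assms by auto
  have AE: "AE \<omega> in M. \<omega> \<in> a \<longleftrightarrow> \<omega> \<in> B"
    using AE_not_in[OF B(2)] by eventually_elim auto
  have "prob (a \<inter> b) = prob (B \<inter> b)" "prob a = prob B"
    by (intro finite_measure_eq_AE; use AE ev in auto)+
  then show "prob (a \<inter> b) = prob a * prob b"
    using indep' B(1) b by auto
qed

lemma F_increment_indep_var:
  fixes h :: "'w \<Rightarrow> 'a::topological_space" and g :: "real ^ 'm \<Rightarrow> 'a::topological_space"
  assumes "0 \<le> s" "s < t" "t \<le> T" and h: "h \<in> borel_measurable (F s)" and g: "g \<in> borel_measurable borel"
  shows "indep_var borel h borel (\<lambda>\<omega>. g (W t \<omega> - W s \<omega>))"
  unfolding indep_var_eq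
proof (intro conjI)
  let ?D = "\<lambda>\<omega>. W t \<omega> - W s \<omega>"
  have [measurable]: "?D \<in> borel_measurable M"
    using assms by (intro borel_measurable_diff W_measurable) auto
  show "random_variable borel h" using F_measurable_M[OF h] assms by simp
  show gD: "random_variable borel (\<lambda>\<omega>. g (?D \<omega>))" using g by measurable
  let ?B = "{?D -` A \<inter> space M | A. A \<in> sets borel}"
  \<comment> \<open>\<open>indep_var\<close> speaks of generated sigma-algebras,
    \<open>F_increment_indep\<close> of plain preimages. The preimages of all Borel sets already
    form a sigma-algebra, so nothing is added.\<close>
  have sB: "sigma_sets (space M) ?B = ?B"
  proof -
    have "sigma_sets (space M) ?B = sets (vimage_algebra (space M) ?D borel)"
      by (simp add: sets_vimage_algebra)
    also have "\<dots> = ?B" by (rule sets_vimage_algebra2) simp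
    finally show ?thesis .
  qed
  have "{h -` A \<inter> space M | A. A \<in> sets borel} \<subseteq> sets (F s)"
    using measurable_sets[OF h] by auto
  from sets.sigma_sets_subset[OF this]
  have 1: "sigma_sets (space M) {h -` A \<inter> space M | A. A \<in> sets borel} \<subseteq> sets (F s)" by simp
  have "{(\<lambda>\<omega>. g (?D \<omega>)) -` A \<inter> space M | A. A \<in> sets borel} \<subseteq> ?B"
  proof clarify
    fix A :: "'a set" assume "A \<in> sets borel"
    then have "g -` A \<in> sets borel" using measurable_sets[OF g] by simp
    moreover have "(\<lambda>\<omega>. g (?D \<omega>)) -` A \<inter> space M = ?D -` (g -` A) \<inter> space M" by auto
    ultimately show "\<exists>A'. (\<lambda>\<omega>. g (?D \<omega>)) -` A \<inter> space M = ?D -` A' \<inter> space M \<and> A' \<in> sets borel"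
      by blast
  qed
  from sigma_sets_mono'[OF this, of "space M"]
  have 2: "sigma_sets (space M) {(\<lambda>\<omega>. g (?D \<omega>)) -` A \<inter> space M | A. A \<in> sets borel} \<subseteq> ?B"
    unfolding sB .
  show "indep_set (sigma_sets (space M) {h -` A \<inter> space M | A. A \<in> sets borel})
     (sigma_sets (space M) {(\<lambda>\<omega>. g (?D \<omega>)) -` A \<inter> space M | A. A \<in> sets borel})"
    using F_increment_indep[OF assms(1-3)] unfolding indep_set_def
    by (rule indep_sets_mono_sets) (use 1 2 in \<open>simp split: bool.split\<close>)
qed

end

lemma integrable_weighted:
  fixes w h :: "'q \<Rightarrow> real"
  assumes "w \<in> borel_measurable N" "AE x in N. \<bar>w x\<bar> \<le> B" "integrable N h"
  shows "integrable N (\<lambda>x. w x * h x)"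
proof (rule Bochner_Integration.integrable_bound)
  show "integrable N (\<lambda>x. B * h x)" using assms(3) by simp
  show "AE x in N. norm (w x * h x) \<le> norm (B * h x)"
    using assms(2) by eventually_elim (simp add: abs_mult mult_right_mono)
  have "h \<in> borel_measurable N" using assms(3) by (rule borel_measurable_integrable)
  with assms(1) show "(\<lambda>x. w x * h x) \<in> borel_measurable N" by measurable
qed

section \<open>Expectations of products of Brownian increments with adapted weights\<close>

context brownian_basis
begin

lemma inc_moments:
  assumes "0 \<le> s" "s < t" "t \<le> T"
  shows "integrable M (\<lambda>\<omega>. (inc s t c \<omega>)\<^sup>2)" "(\<integral>\<omega>. (inc s t c \<omega>)\<^sup>2 \<partial>M) = t - s"
    "(\<integral>\<omega>. inc s t c \<omega> \<partial>M) = 0"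
    "c \<noteq> c' \<Longrightarrow> (\<integral>\<omega>. inc s t c \<omega> * inc s t c' \<omega> \<partial>M) = 0"
proof -
  have X: "distributed M lborel (\<lambda>\<omega>. W t \<omega> - W s \<omega>)
      (\<lambda>x. ennreal (\<Prod>i\<in>UNIV. normal_density 0 (sqrt (t - s)) (x $ i)))"
    using bm assms by (simp add: brownian_motion_def)
  have "sqrt (t - s) > 0" using assms by simp
  note m = gaussian_moments[OF X this]
  show "integrable M (\<lambda>\<omega>. (inc s t c \<omega>)\<^sup>2)" "(\<integral>\<omega>. (inc s t c \<omega>)\<^sup>2 \<partial>M) = t - s"
    "(\<integral>\<omega>. inc s t c \<omega> \<partial>M) = 0"
    "c \<noteq> c' \<Longrightarrow> (\<integral>\<omega>. inc s t c \<omega> * inc s t c' \<omega> \<partial>M) = 0"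
    using m(1)[of c] m(2)[of c] m(3)[of c] m(4)[of c c'] assms by auto
qed

lemma inc_measurable [measurable]:
  assumes "s \<in> {0..T}" "t \<in> {0..T}"
  shows "inc s t c \<in> borel_measurable M"
proof -
  have "(\<lambda>\<omega>. W t \<omega> - W s \<omega>) \<in> borel_measurable M"
    using assms by (intro borel_measurable_diff W_measurable)
  then show ?thesis by (rule measurable_compose[OF _ borel_measurable_vec_nth])
qed

lemma inc_measurable_F:
  assumes "s \<in> {0..u}" "t \<in> {0..u}" "u \<le> T"
  shows "inc s t c \<in> borel_measurable (F u)"
proof -
  have "(\<lambda>\<omega>. W t \<omega> - W s \<omega>) \<in> borel_measurable (F u)"
    using assms by (intro borel_measurable_diff W_measurable_F) auto
  then show ?thesis by (rule measurable_compose[OF _ borel_measurable_vec_nth])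
qed

lemma inc_sq_integrable:
  assumes "0 \<le> s" "s \<le> t" "t \<le> T"
  shows "integrable M (\<lambda>\<omega>. (inc s t c \<omega>)\<^sup>2)"
  using inc_moments(1)[of s t c] assms by (cases "s = t") auto

lemma inc_prod_integrable:
  assumes "0 \<le> a" "a \<le> b" "b \<le> T" "0 \<le> a'" "a' \<le> b'" "b' \<le> T"
  shows "integrable M (\<lambda>\<omega>. inc a b c \<omega> * inc a' b' c' \<omega>)"
proof (rule Bochner_Integration.integrable_bound)
  show "integrable M (\<lambda>\<omega>. (inc a b c \<omega>)\<^sup>2 + (inc a' b' c' \<omega>)\<^sup>2)"
    by (intro Bochner_Integration.integrable_add inc_sq_integrable assms)
  show "(\<lambda>\<omega>. inc a b c \<omega> * inc a' b' c' \<omega>) \<in> borel_measurable M"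
    by (intro borel_measurable_times inc_measurable) (use assms in auto)
  have "\<bar>x * y\<bar> \<le> x\<^sup>2 + y\<^sup>2" for x y :: real
    using sum_squares_bound[of "\<bar>x\<bar>" "\<bar>y\<bar>"] abs_ge_zero[of "x * y"]
    unfolding power2_abs abs_mult by linarith
  then show "AE \<omega> in M. norm (inc a b c \<omega> * inc a' b' c' \<omega>) \<le> norm ((inc a b c \<omega>)\<^sup>2 + (inc a' b' c' \<omega>)\<^sup>2)"
    by simp
qed

lemma inc_integrable:
  assumes "0 \<le> s" "s \<le> t" "t \<le> T"
  shows "integrable M (inc s t c)"
proof -
  have "inc s t c \<in> borel_measurable M" using assms by (intro inc_measurable) auto
  then show ?thesis using inc_sq_integrable[OF assms, of c]
    by (rule square_integrable_imp_integrable)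
qed

text \<open>Independence factors the expectation and the increment has mean zero. The Gaussian law
  is given for s < t only, so equal times form a separate case.\<close>

lemma martingale_inc:
  assumes "0 \<le> s" "s \<le> t" "t \<le> T" "h \<in> borel_measurable (F s)" "integrable M h"
  shows "has_bochner_integral M (\<lambda>\<omega>. h \<omega> * inc s t c \<omega>) 0"
proof (cases "s = t")
  case False
  then have st: "s < t" using assms by simp
  have "indep_var borel h borel (\<lambda>\<omega>. inc s t c \<omega>)"
    using F_increment_indep_var[OF assms(1) st assms(3,4) borel_measurable_vec_nth] .
  note ind = this assms(5) inc_integrable[OF assms(1-3)]
  show ?thesis
    unfolding has_bochner_integral_iff
    using indep_var_integrable[OF ind] indep_var_lebesgue_integral[OF ind]
      inc_moments(3)[OF assms(1) st assms(3)] by simp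
qed (simp add: has_bochner_integral_zero)

lemma isometry_inc:
  assumes "0 \<le> s" "s \<le> t" "t \<le> T" "h \<in> borel_measurable (F s)" "integrable M h"
  shows "has_bochner_integral M (\<lambda>\<omega>. h \<omega> * (inc s t c \<omega> * inc s t c' \<omega>))
    ((if c = c' then t - s else 0) * (\<integral>\<omega>. h \<omega> \<partial>M))"
proof (cases "s = t")
  case False
  then have st: "s < t" using assms by simp
  have "(\<lambda>x :: real ^ 'm. x $ c * x $ c') \<in> borel_measurable borel" by measurable
  from F_increment_indep_var[OF assms(1) st assms(3,4) this]
  have "indep_var borel h borel (\<lambda>\<omega>. inc s t c \<omega> * inc s t c' \<omega>)" .
  note ind = this assms(5) inc_prod_integrable[OF assms(1-3) assms(1-3)]
  show ?thesis
    unfolding has_bochner_integral_iff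
    using indep_var_integrable[OF ind] indep_var_lebesgue_integral[OF ind]
      inc_moments(2,4)[OF assms(1) st assms(3)]
    by (auto simp: power2_eq_square mult.commute)
qed (simp add: has_bochner_integral_zero)

text \<open>The earlier increment is known at time s and can be absorbed into the weight; the later
  one then has mean zero.\<close>

lemma orthogonal_inc:
  assumes "0 \<le> a" "a \<le> b" "b \<le> s" "s \<le> t" "t \<le> T"
    and h: "h \<in> borel_measurable (F s)" and B: "AE \<omega> in M. \<bar>h \<omega>\<bar> \<le> B"
  shows "has_bochner_integral M (\<lambda>\<omega>. h \<omega> * (inc a b c \<omega> * inc s t c' \<omega>)) 0"
proof -
  have "(\<lambda>\<omega>. h \<omega> * inc a b c \<omega>) \<in> borel_measurable (F s)"
    using assms by (intro borel_measurable_times h inc_measurable_F) auto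
  moreover have "integrable M (\<lambda>\<omega>. h \<omega> * inc a b c \<omega>)"
    using assms by (intro integrable_weighted[OF _ B] inc_integrable F_measurable_M[OF h]) auto
  ultimately have "has_bochner_integral M (\<lambda>\<omega>. (h \<omega> * inc a b c \<omega>) * inc s t c' \<omega>) 0"
    using assms by (intro martingale_inc) auto
  then show ?thesis by (simp add: mult.assoc)
qed

lemma bounded_integrable:
  fixes h :: "'w \<Rightarrow> real"
  assumes "h \<in> borel_measurable M" "AE \<omega> in M. \<bar>h \<omega>\<bar> \<le> B"
  shows "integrable M h"
  using assms by (intro integrable_const_bound[of _ B]) auto

lemma isometry_inc_common_start:
  assumes "0 \<le> s" "s \<le> t" "t \<le> t'" "t' \<le> T"
    and h: "h \<in> borel_measurable (F s)" and B: "AE \<omega> in M. \<bar>h \<omega>\<bar> \<le> B"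
  shows "has_bochner_integral M (\<lambda>\<omega>. h \<omega> * (inc s t c \<omega> * inc s t' c' \<omega>))
    ((if c = c' then t - s else 0) * (\<integral>\<omega>. h \<omega> \<partial>M))"
proof -
  have int: "integrable M h"
    using assms by (intro bounded_integrable[OF _ B] F_measurable_M[OF h]) auto
  have "has_bochner_integral M (\<lambda>\<omega>. h \<omega> * (inc s t c \<omega> * inc s t c' \<omega>) + h \<omega> * (inc s t c \<omega> * inc t t' c' \<omega>))
      ((if c = c' then t - s else 0) * (\<integral>\<omega>. h \<omega> \<partial>M) + 0)"
    using assms
    by (intro has_bochner_integral_add isometry_inc orthogonal_inc[OF _ _ _ _ _ _ B] int
        F_measurable_mono[OF h]) auto
  moreover have "h \<omega> * (inc s t c \<omega> * inc s t c' \<omega>) + h \<omega> * (inc s t c \<omega> * inc t t' c' \<omega>) =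
      h \<omega> * (inc s t c \<omega> * inc s t' c' \<omega>)" for \<omega>
    by (simp add: algebra_simps)
  ultimately show ?thesis by simp
qed

lemma isometry_inc_common_start':
  assumes "0 \<le> s" "s \<le> t" "t \<le> T" "s \<le> t'" "t' \<le> T"
    and h: "h \<in> borel_measurable (F s)" and B: "AE \<omega> in M. \<bar>h \<omega>\<bar> \<le> B"
  shows "has_bochner_integral M (\<lambda>\<omega>. h \<omega> * (inc s t c \<omega> * inc s t' c' \<omega>))
    ((if c = c' then min t t' - s else 0) * (\<integral>\<omega>. h \<omega> \<partial>M))"
proof (cases "t \<le> t'")
  case True
  then show ?thesis using isometry_inc_common_start[OF assms(1,2) True assms(5) h B, of c c']
    by (cases "c = c'") (simp_all add: min_absorb1)
next
  case False
  then have "t' \<le> t" by simp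
  from isometry_inc_common_start[OF assms(1,4) this assms(3) h B, of c' c]
  show ?thesis using False by (cases "c = c'") (simp_all add: mult.commute min_def)
qed

text \<open>Cutting the increment that starts first at the point a' leaves a piece orthogonal to the
  other increment and a piece with the same starting time as it.\<close>

lemma isometry_inc_overlap_ordered:
  assumes "0 \<le> a" "a \<le> a'" "a \<le> b" "b \<le> T" "a' \<le> b'" "b' \<le> T"
    and h: "h \<in> borel_measurable (F a')" and B: "AE \<omega> in M. \<bar>h \<omega>\<bar> \<le> B"
  shows "has_bochner_integral M (\<lambda>\<omega>. h \<omega> * (inc a b c \<omega> * inc a' b' c' \<omega>))
    ((if c = c' then max 0 (min b b' - a') else 0) * (\<integral>\<omega>. h \<omega> \<partial>M))"
proof (cases "b \<le> a'")
  case True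
  then show ?thesis using orthogonal_inc[OF assms(1,3) True assms(5,6) h B, of c c']
    by (cases "c = c'") (simp_all add: max_absorb1 min.coboundedI1)
next
  case False
  have "has_bochner_integral M
      (\<lambda>\<omega>. h \<omega> * (inc a a' c \<omega> * inc a' b' c' \<omega>) + h \<omega> * (inc a' b c \<omega> * inc a' b' c' \<omega>))
      (0 + (if c = c' then min b b' - a' else 0) * (\<integral>\<omega>. h \<omega> \<partial>M))"
    using assms False
    by (intro has_bochner_integral_add isometry_inc_common_start'[OF _ _ _ _ _ h B]
        orthogonal_inc[OF _ _ _ _ _ h B]) auto
  moreover have "h \<omega> * (inc a a' c \<omega> * inc a' b' c' \<omega>) + h \<omega> * (inc a' b c \<omega> * inc a' b' c' \<omega>) =
      h \<omega> * (inc a b c \<omega> * inc a' b' c' \<omega>)" for \<omega>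
    by (simp add: algebra_simps)
  ultimately show ?thesis using False assms by (cases "c = c'") simp_all
qed

text \<open>Only the common part of the two intervals contributes, through its length. Intervals in
  arbitrary position are allowed because the simple integrands below come from unrelated
  partitions.\<close>

lemma isometry_inc_overlap:
  assumes "0 \<le> a" "a \<le> b" "b \<le> T" "0 \<le> a'" "a' \<le> b'" "b' \<le> T"
    and h: "h \<in> borel_measurable (F (max a a'))" and B: "AE \<omega> in M. \<bar>h \<omega>\<bar> \<le> B"
  shows "has_bochner_integral M (\<lambda>\<omega>. h \<omega> * (inc a b c \<omega> * inc a' b' c' \<omega>))
    ((if c = c' then max 0 (min b b' - max a a') else 0) * (\<integral>\<omega>. h \<omega> \<partial>M))"
proof (cases "a \<le> a'")
  case True
  then show ?thesis
    using isometry_inc_overlap_ordered[OF assms(1) True assms(2,3,5,6) _ B, of c c'] h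
    by (cases "c = c'") (simp_all add: max_absorb2)
next
  case False
  then have "a' \<le> a" by simp
  from isometry_inc_overlap_ordered[OF assms(4) this assms(5,6,2,3) _ B, of c' c]
  show ?thesis using h False
    by (cases "c = c'") (simp_all add: max_absorb1 mult.commute min.commute)
qed

end

lemma norm_nth_nth_le:
  fixes A :: "real ^ 'm ^ 'n"
  shows "\<bar>A $ r $ c\<bar> \<le> norm A"
  using component_le_norm_cart[of "A $ r" c] Finite_Cartesian_Product.norm_nth_le[of A r] by simp

lemma borel_measurable_nth_nth:
  fixes \<zeta> :: "'w \<Rightarrow> real ^ 'm ^ 'n"
  assumes "\<zeta> \<in> borel_measurable N"
  shows "(\<lambda>\<omega>. \<zeta> \<omega> $ r $ c) \<in> borel_measurable N"
proof -
  have "(\<lambda>A :: real ^ 'm ^ 'n. A $ r $ c) \<in> borel_measurable borel"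
    by (intro borel_measurable_continuous_onI continuous_intros)
  then show ?thesis by (rule measurable_compose[OF assms])
qed

lemma inner_mult_vec_expand:
  fixes A B :: "real ^ 'm ^ 'n"
  shows "(A *v x) \<bullet> (B *v y) = (\<Sum>r\<in>UNIV. \<Sum>c\<in>UNIV. \<Sum>c'\<in>UNIV. (A $ r $ c * B $ r $ c') * (x $ c * y $ c'))"
  unfolding inner_vec_def matrix_vector_mult_def vec_lambda_beta inner_real_def sum_product
  by (intro sum.cong refl) (simp add: ac_simps)

text \<open>The deterministic counterpart of \<open>isometry_inc_overlap\<close>: the same overlap
  length as a time integral of indicators. The outer \<open>max 0\<close> covers disjoint
  intervals.\<close>

lemma overlap_integral:
  fixes s u p q p' q' :: real
  assumes "s \<le> max p p'" "min q q' \<le> u"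
  shows "has_bochner_integral lborel
    (\<lambda>t. indicator {s<..u} t * (indicator {p<..q} t * indicator {p'<..q'} t))
    (max 0 (min q q' - max p p'))"
proof -
  have "(\<lambda>t. indicator {s<..u} t * (indicator {p<..q} t * indicator {p'<..q'} t)) =
      (indicator {max p p'<..min q q'} :: real \<Rightarrow> real)"
    using assms by (auto simp: fun_eq_iff split: split_indicator)
  moreover have em: "emeasure lborel {max p p'<..min q q'} = ennreal (max 0 (min q q' - max p p'))"
  proof (cases "max p p' \<le> min q q'")
    case True
    then show ?thesis by (subst emeasure_lborel_Ioc[OF True]) (simp add: max_absorb2)
  next
    case False
    then have "{max p p'<..min q q'} = {}" by auto
    then show ?thesis using False by (simp add: max_absorb1 del: max.bounded_iff min.bounded_iff)
  qed
  moreover have "has_bochner_integral lborel (indicator {max p p'<..min q q'} :: real \<Rightarrow> real)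
      (measure lborel {max p p'<..min q q'})"
    by (rule has_bochner_integral_real_indicator) (simp_all add: em)
  moreover have "measure lborel {max p p'<..min q q'} = max 0 (min q q' - max p p')"
    unfolding measure_def em by (rule enn2real_ennreal) simp
  ultimately show ?thesis by simp
qed

lemma norm_sum_square:
  fixes x :: "'i \<Rightarrow> 'a::real_inner"
  shows "(norm (\<Sum>i\<in>I. x i))\<^sup>2 = (\<Sum>i\<in>I. \<Sum>j\<in>I. x i \<bullet> x j)"
  unfolding power2_norm_eq_inner by (subst inner_sum_left, subst inner_sum_right) (rule refl)

section \<open>Martingale property and isometry for simple integrands\<close>

context brownian_basis
begin

lemma martingale_simple_term:
  fixes \<zeta> :: "'w \<Rightarrow> real ^ 'm ^ 'n" and g :: "'w \<Rightarrow> real ^ 'n"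
  assumes "0 \<le> s" "s \<le> a" "a \<le> b" "b \<le> T"
    and \<zeta>: "\<zeta> \<in> borel_measurable (F a)" "\<And>\<omega>. \<omega> \<in> space M \<Longrightarrow> norm (\<zeta> \<omega>) \<le> B"
    and g: "g \<in> borel_measurable (F s)" "AE \<omega> in M. norm (g \<omega>) \<le> G"
  shows "has_bochner_integral M (\<lambda>\<omega>. g \<omega> \<bullet> (\<zeta> \<omega> *v (W b \<omega> - W a \<omega>))) 0"
proof -
  have "has_bochner_integral M (\<lambda>\<omega>. \<Sum>r\<in>UNIV. \<Sum>c\<in>UNIV. (g \<omega> $ r * \<zeta> \<omega> $ r $ c) * inc a b c \<omega>)
      (\<Sum>r\<in>(UNIV :: 'n set). \<Sum>c\<in>(UNIV :: 'm set). 0)"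
  proof (intro has_bochner_integral_sum martingale_inc)
    fix r c
    have gr: "(\<lambda>\<omega>. g \<omega> $ r) \<in> borel_measurable (F a)"
      using assms by (intro measurable_compose[OF _ borel_measurable_vec_nth] F_measurable_mono[OF g(1)]) auto
    then show 1: "(\<lambda>\<omega>. g \<omega> $ r * \<zeta> \<omega> $ r $ c) \<in> borel_measurable (F a)"
      by (intro borel_measurable_times borel_measurable_nth_nth \<zeta>)
    show "integrable M (\<lambda>\<omega>. g \<omega> $ r * \<zeta> \<omega> $ r $ c)"
    proof (rule bounded_integrable)
      show "(\<lambda>\<omega>. g \<omega> $ r * \<zeta> \<omega> $ r $ c) \<in> borel_measurable M"
        using assms by (intro F_measurable_M[OF 1]) auto
      show "AE \<omega> in M. \<bar>g \<omega> $ r * \<zeta> \<omega> $ r $ c\<bar> \<le> G * B"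
        using g(2) AE_space
      proof eventually_elim
        case (elim \<omega>)
        have "\<bar>g \<omega> $ r\<bar> \<le> G" using component_le_norm_cart[of "g \<omega>" r] elim by simp
        moreover have "\<bar>\<zeta> \<omega> $ r $ c\<bar> \<le> B" using norm_nth_nth_le[of "\<zeta> \<omega>" r c] \<zeta>(2) elim by force
        ultimately show ?case unfolding abs_mult by (intro mult_mono) auto
      qed
    qed
  qed (use assms in auto)
  moreover have "(\<Sum>r\<in>UNIV. \<Sum>c\<in>UNIV. (g \<omega> $ r * \<zeta> \<omega> $ r $ c) * inc a b c \<omega>) =
      g \<omega> \<bullet> (\<zeta> \<omega> *v (W b \<omega> - W a \<omega>))" for \<omega>
    by (simp add: inner_vec_def matrix_vector_mult_def sum_distrib_left mult.assoc)
  ultimately show ?thesis by simp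
qed

text \<open>Different components of the Brownian motion are uncorrelated, so only equal column
  indices survive in the coordinate expansion. What they leave is the Frobenius inner product, which
  is the inner product of the matrix type.\<close>

lemma isometry_simple_term:
  fixes \<zeta> \<zeta>' :: "'w \<Rightarrow> real ^ 'm ^ 'n" and g :: "'w \<Rightarrow> real"
  assumes "0 \<le> s" "s \<le> a" "a \<le> b" "b \<le> T" "s \<le> a'" "a' \<le> b'" "b' \<le> T"
    and \<zeta>: "\<zeta> \<in> borel_measurable (F a)" "\<And>\<omega>. \<omega> \<in> space M \<Longrightarrow> norm (\<zeta> \<omega>) \<le> B"
    and \<zeta>': "\<zeta>' \<in> borel_measurable (F a')" "\<And>\<omega>. \<omega> \<in> space M \<Longrightarrow> norm (\<zeta>' \<omega>) \<le> B'"
    and g: "g \<in> borel_measurable (F s)" "AE \<omega> in M. \<bar>g \<omega>\<bar> \<le> G"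
  shows "has_bochner_integral M
      (\<lambda>\<omega>. g \<omega> * ((\<zeta> \<omega> *v (W b \<omega> - W a \<omega>)) \<bullet> (\<zeta>' \<omega> *v (W b' \<omega> - W a' \<omega>))))
      (max 0 (min b b' - max a a') * (\<integral>\<omega>. g \<omega> * (\<zeta> \<omega> \<bullet> \<zeta>' \<omega>) \<partial>M))"
    and "integrable M (\<lambda>\<omega>. g \<omega> * (\<zeta> \<omega> \<bullet> \<zeta>' \<omega>))"
proof -
  let ?h = "\<lambda>r c c' \<omega>. g \<omega> * (\<zeta> \<omega> $ r $ c * \<zeta>' \<omega> $ r $ c')"
  let ?ov = "max 0 (min b b' - max a a')"
  have m: "?h r c c' \<in> borel_measurable (F (max a a'))" for r c c'
    using assms by (intro borel_measurable_times borel_measurable_nth_nth F_measurable_mono[OF g(1)]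
        F_measurable_mono[OF \<zeta>(1)] F_measurable_mono[OF \<zeta>'(1)]) auto
  have bd: "AE \<omega> in M. \<bar>?h r c c' \<omega>\<bar> \<le> G * (B * B')" for r c c'
    using g(2) AE_space
  proof eventually_elim
    case (elim \<omega>)
    have "\<bar>\<zeta> \<omega> $ r $ c\<bar> \<le> B" using norm_nth_nth_le[of "\<zeta> \<omega>" r c] \<zeta>(2) elim by force
    moreover have "\<bar>\<zeta>' \<omega> $ r $ c'\<bar> \<le> B'" using norm_nth_nth_le[of "\<zeta>' \<omega>" r c'] \<zeta>'(2) elim by force
    ultimately have "\<bar>\<zeta> \<omega> $ r $ c\<bar> * \<bar>\<zeta>' \<omega> $ r $ c'\<bar> \<le> B * B'" by (intro mult_mono) auto
    from mult_mono[OF elim(1) this] show ?case using order_trans[OF abs_ge_zero elim(1)]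
      by (simp add: abs_mult)
  qed
  have int: "integrable M (?h r c c')" for r c c'
    using assms by (intro bounded_integrable[OF _ bd] F_measurable_M[OF m]) auto
  have eq: "(\<Sum>r\<in>UNIV. \<Sum>c\<in>UNIV. ?h r c c \<omega>) = g \<omega> * (\<zeta> \<omega> \<bullet> \<zeta>' \<omega>)" for \<omega>
    by (simp add: inner_vec_def sum_distrib_left)
  have "integrable M (\<lambda>\<omega>. \<Sum>r\<in>UNIV. \<Sum>c\<in>UNIV. ?h r c c \<omega>)"
    by (intro Bochner_Integration.integrable_sum int)
  then show "integrable M (\<lambda>\<omega>. g \<omega> * (\<zeta> \<omega> \<bullet> \<zeta>' \<omega>))" by (simp only: eq)
  have "has_bochner_integral M
      (\<lambda>\<omega>. \<Sum>r\<in>UNIV. \<Sum>c\<in>UNIV. \<Sum>c'\<in>UNIV. ?h r c c' \<omega> * (inc a b c \<omega> * inc a' b' c' \<omega>))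
      (\<Sum>r\<in>(UNIV :: 'n set). \<Sum>c\<in>(UNIV :: 'm set). \<Sum>c'\<in>(UNIV :: 'm set).
        (if c = c' then ?ov else 0) * (\<integral>\<omega>. ?h r c c' \<omega> \<partial>M))"
    using assms by (intro has_bochner_integral_sum isometry_inc_overlap[OF _ _ _ _ _ _ m bd]) auto
  moreover have "(\<Sum>r\<in>UNIV. \<Sum>c\<in>UNIV. \<Sum>c'\<in>UNIV. ?h r c c' \<omega> * (inc a b c \<omega> * inc a' b' c' \<omega>)) =
      g \<omega> * ((\<zeta> \<omega> *v (W b \<omega> - W a \<omega>)) \<bullet> (\<zeta>' \<omega> *v (W b' \<omega> - W a' \<omega>)))" for \<omega>
    unfolding inner_mult_vec_expand sum_distrib_left by (intro sum.cong refl) (simp only: mult.assoc)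
  moreover have "(\<Sum>r\<in>(UNIV :: 'n set). \<Sum>c\<in>(UNIV :: 'm set). \<Sum>c'\<in>(UNIV :: 'm set).
        (if c = c' then ?ov else 0) * (\<integral>\<omega>. ?h r c c' \<omega> \<partial>M)) =
      (\<Sum>r\<in>(UNIV :: 'n set). \<Sum>c\<in>(UNIV :: 'm set). ?ov * (\<integral>\<omega>. ?h r c c \<omega> \<partial>M))"
  proof (intro sum.cong refl)
    fix r c
    have "(\<Sum>c'\<in>(UNIV :: 'm set). (if c = c' then ?ov else 0) * (\<integral>\<omega>. ?h r c c' \<omega> \<partial>M)) =
        (\<Sum>c'\<in>(UNIV :: 'm set). if c = c' then ?ov * (\<integral>\<omega>. ?h r c c' \<omega> \<partial>M) else 0)"
      by (intro sum.cong refl) simp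
    then show "(\<Sum>c'\<in>(UNIV :: 'm set). (if c = c' then ?ov else 0) * (\<integral>\<omega>. ?h r c c' \<omega> \<partial>M)) =
        ?ov * (\<integral>\<omega>. ?h r c c \<omega> \<partial>M)" by simp
  qed
  moreover have "\<dots> = ?ov * (\<integral>\<omega>. (\<Sum>r\<in>UNIV. \<Sum>c\<in>UNIV. ?h r c c \<omega>) \<partial>M)"
    by (simp only: sum_distrib_left Bochner_Integration.integral_sum[OF Bochner_Integration.integrable_sum[OF int]]
        Bochner_Integration.integral_sum[OF int])
  ultimately show "has_bochner_integral M
      (\<lambda>\<omega>. g \<omega> * ((\<zeta> \<omega> *v (W b \<omega> - W a \<omega>)) \<bullet> (\<zeta>' \<omega> *v (W b' \<omega> - W a' \<omega>))))
      (?ov * (\<integral>\<omega>. g \<omega> * (\<zeta> \<omega> \<bullet> \<zeta>' \<omega>) \<partial>M))"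
    unfolding eq by simp
qed

text \<open>The intervals of a simple integrand may overlap. The difference of two elementary integrands on
  unrelated partitions is therefore again simple, and no common refinement is needed.\<close>

definition simple_integral :: "'i set \<Rightarrow> ('i \<Rightarrow> real) \<Rightarrow> ('i \<Rightarrow> real) \<Rightarrow>
    ('i \<Rightarrow> 'w \<Rightarrow> real ^ 'm ^ 'n) \<Rightarrow> real \<Rightarrow> 'w \<Rightarrow> real ^ 'n" where
  "simple_integral I a b \<zeta> t \<omega> = (\<Sum>i\<in>I. \<zeta> i \<omega> *v (W (min t (b i)) \<omega> - W (min t (a i)) \<omega>))"

definition simple_process :: "'i set \<Rightarrow> ('i \<Rightarrow> real) \<Rightarrow> ('i \<Rightarrow> real) \<Rightarrow>
    ('i \<Rightarrow> 'w \<Rightarrow> real ^ 'm ^ 'n) \<Rightarrow> real \<Rightarrow> 'w \<Rightarrow> real ^ 'm ^ 'n" where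
  "simple_process I a b \<zeta> t \<omega> = (\<Sum>i\<in>I. indicator {a i<..b i} t *\<^sub>R \<zeta> i \<omega>)"

definition simple_data :: "'i set \<Rightarrow> ('i \<Rightarrow> real) \<Rightarrow> ('i \<Rightarrow> real) \<Rightarrow>
    ('i \<Rightarrow> 'w \<Rightarrow> real ^ 'm ^ 'n) \<Rightarrow> bool" where
  "simple_data I a b \<zeta> \<longleftrightarrow> finite I \<and> (\<forall>i\<in>I. 0 \<le> a i \<and> a i \<le> b i \<and> b i \<le> T \<and>
     \<zeta> i \<in> borel_measurable (F (a i)) \<and> (\<exists>B. \<forall>\<omega>\<in>space M. norm (\<zeta> i \<omega>) \<le> B))"

text \<open>Clamping the intervals to the window from s to u turns an increment of a simple integral
  into a sum of terms that start after s.\<close>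

lemma simple_integral_clamp:
  assumes "simple_data I a b \<zeta>" "s \<le> u"
  shows "simple_integral I a b \<zeta> u \<omega> - simple_integral I a b \<zeta> s \<omega> =
    (\<Sum>i\<in>I. (if a i \<le> u then \<zeta> i \<omega> else 0) *v (W (max s (min u (b i))) \<omega> - W (max s (min u (a i))) \<omega>))"
  unfolding simple_integral_def sum_subtractf[symmetric]
proof (rule sum.cong)
  fix i assume "i \<in> I"
  then have "a i \<le> b i" using assms by (simp add: simple_data_def)
  have cl: "W (min u x) \<omega> - W (min s x) \<omega> = W (max s (min u x)) \<omega> - W s \<omega>" for x
    using assms(2) by (simp add: min_def max_def)
  have "\<zeta> i \<omega> *v (W (min u (b i)) \<omega> - W (min u (a i)) \<omega>) - \<zeta> i \<omega> *v (W (min s (b i)) \<omega> - W (min s (a i)) \<omega>)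
      = \<zeta> i \<omega> *v ((W (min u (b i)) \<omega> - W (min s (b i)) \<omega>) - (W (min u (a i)) \<omega> - W (min s (a i)) \<omega>))"
    by (simp add: matrix_vector_mult_diff_distrib)
  also have "\<dots> = \<zeta> i \<omega> *v (W (max s (min u (b i))) \<omega> - W (max s (min u (a i))) \<omega>)"
    unfolding cl by simp
  finally show "\<zeta> i \<omega> *v (W (min u (b i)) \<omega> - W (min u (a i)) \<omega>) - \<zeta> i \<omega> *v (W (min s (b i)) \<omega> - W (min s (a i)) \<omega>)
      = (if a i \<le> u then \<zeta> i \<omega> else 0) *v (W (max s (min u (b i))) \<omega> - W (max s (min u (a i))) \<omega>)"
    using \<open>a i \<le> b i\<close> assms(2) by (cases "a i \<le> u") auto
qed simp

text \<open>If \<open>a i\<close> exceeds u, both clamped endpoints equal u, and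
  \<open>\<zeta> i\<close> need not be measurable at that time. The clamped interval is then empty,
  so the coefficient may be replaced by 0, which restores adaptedness.\<close>

lemma clamp_data:
  assumes "simple_data I a b \<zeta>" "0 \<le> s" "s \<le> u" "u \<le> T" "i \<in> I"
  shows "(\<lambda>\<omega>. if a i \<le> u then \<zeta> i \<omega> else 0) \<in> borel_measurable (F (max s (min u (a i))))"
    "\<exists>B. \<forall>\<omega>\<in>space M. norm (if a i \<le> u then \<zeta> i \<omega> else 0) \<le> B"
    "s \<le> max s (min u (a i))" "max s (min u (a i)) \<le> max s (min u (b i))" "max s (min u (b i)) \<le> T"
proof -
  have i: "0 \<le> a i" "a i \<le> b i" "b i \<le> T" "\<zeta> i \<in> borel_measurable (F (a i))"
    "\<exists>B. \<forall>\<omega>\<in>space M. norm (\<zeta> i \<omega>) \<le> B"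
    using assms by (auto simp: simple_data_def)
  show "(\<lambda>\<omega>. if a i \<le> u then \<zeta> i \<omega> else 0) \<in> borel_measurable (F (max s (min u (a i))))"
    using i assms by (cases "a i \<le> u") (auto intro!: F_measurable_mono[OF i(4)])
  show "\<exists>B. \<forall>\<omega>\<in>space M. norm (if a i \<le> u then \<zeta> i \<omega> else 0) \<le> B"
    using i(5) by (cases "a i \<le> u") auto
qed (use assms in \<open>auto simp: simple_data_def\<close>)

lemma simple_martingale:
  fixes g :: "'w \<Rightarrow> real ^ 'n" and \<zeta> :: "'i \<Rightarrow> 'w \<Rightarrow> real ^ 'm ^ 'n"
  assumes d: "simple_data I a b \<zeta>" and su: "0 \<le> s" "s \<le> u" "u \<le> T"
    and g: "g \<in> borel_measurable (F s)" "AE \<omega> in M. norm (g \<omega>) \<le> G"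
  shows "has_bochner_integral M
    (\<lambda>\<omega>. g \<omega> \<bullet> (simple_integral I a b \<zeta> u \<omega> - simple_integral I a b \<zeta> s \<omega>)) 0"
proof -
  have "has_bochner_integral M (\<lambda>\<omega>. g \<omega> \<bullet> ((if a i \<le> u then \<zeta> i \<omega> else 0) *v
      (W (max s (min u (b i))) \<omega> - W (max s (min u (a i))) \<omega>))) 0" if "i \<in> I" for i
  proof -
    note c = clamp_data[OF d su that]
    obtain B where "\<And>\<omega>. \<omega> \<in> space M \<Longrightarrow> norm (if a i \<le> u then \<zeta> i \<omega> else 0) \<le> B"
      using c(2) by blast
    from martingale_simple_term[OF su(1) c(3-5) c(1) this g] show ?thesis by simp
  qed
  then have "has_bochner_integral M (\<lambda>\<omega>. \<Sum>i\<in>I. g \<omega> \<bullet> ((if a i \<le> u then \<zeta> i \<omega> else 0) *v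
      (W (max s (min u (b i))) \<omega> - W (max s (min u (a i))) \<omega>))) (\<Sum>i\<in>I. 0)"
    by (intro has_bochner_integral_sum)
  then show ?thesis
    unfolding simple_integral_clamp[OF d su(2)] inner_sum_right by simp
qed

text \<open>Both sides expand into the same double sum over pairs of intervals, each pair weighted
  with the length of its overlap. The weight g, known at time s, precedes every clamped interval; it
  makes this a conditional form of the isometry.\<close>

lemma simple_isometry:
  fixes g :: "'w \<Rightarrow> real" and \<zeta> :: "'i \<Rightarrow> 'w \<Rightarrow> real ^ 'm ^ 'n"
  assumes d: "simple_data I a b \<zeta>" and su: "0 \<le> s" "s \<le> u" "u \<le> T"
    and g: "g \<in> borel_measurable (F s)" "AE \<omega> in M. \<bar>g \<omega>\<bar> \<le> G"
  shows "has_bochner_integral M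
    (\<lambda>\<omega>. g \<omega> * (norm (simple_integral I a b \<zeta> u \<omega> - simple_integral I a b \<zeta> s \<omega>))\<^sup>2)
    (\<integral>\<omega>. g \<omega> * (LINT t:{s<..u}|lborel. (norm (simple_process I a b \<zeta> t \<omega>))\<^sup>2) \<partial>M)"
proof -
  define p q where "p i = max s (min u (a i))" and "q i = max s (min u (b i))" for i
  define \<eta> where "\<eta> i \<omega> = (if a i \<le> u then \<zeta> i \<omega> else 0)" for i \<omega>
  define ov where "ov i j = max 0 (min (q i) (q j) - max (p i) (p j))" for i j
  let ?x = "\<lambda>i \<omega>. \<eta> i \<omega> *v (W (q i) \<omega> - W (p i) \<omega>)"
  have fin: "finite I" using d by (simp add: simple_data_def)
  have one: "has_bochner_integral M (\<lambda>\<omega>. g \<omega> * (?x i \<omega> \<bullet> ?x j \<omega>))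
      (ov i j * (\<integral>\<omega>. g \<omega> * (\<eta> i \<omega> \<bullet> \<eta> j \<omega>) \<partial>M))"
    and int: "integrable M (\<lambda>\<omega>. g \<omega> * (\<eta> i \<omega> \<bullet> \<eta> j \<omega>))" if "i \<in> I" "j \<in> I" for i j
  proof -
    note c = clamp_data[OF d su that(1), folded p_def q_def \<eta>_def[abs_def]]
      and c' = clamp_data[OF d su that(2), folded p_def q_def \<eta>_def[abs_def]]
    obtain B where B: "\<And>\<omega>. \<omega> \<in> space M \<Longrightarrow> norm (\<eta> i \<omega>) \<le> B"
      using c(2) unfolding \<eta>_def by blast
    obtain B' where B': "\<And>\<omega>. \<omega> \<in> space M \<Longrightarrow> norm (\<eta> j \<omega>) \<le> B'"
      using c'(2) unfolding \<eta>_def by blast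
    have m: "\<eta> i \<in> borel_measurable (F (p i))" "\<eta> j \<in> borel_measurable (F (p j))"
      using c(1) c'(1) by (simp_all add: \<eta>_def[abs_def])
    note iso = isometry_simple_term[OF su(1) c(3-5) c'(3-5) m(1) B m(2) B' g]
    show "has_bochner_integral M (\<lambda>\<omega>. g \<omega> * (?x i \<omega> \<bullet> ?x j \<omega>))
      (ov i j * (\<integral>\<omega>. g \<omega> * (\<eta> i \<omega> \<bullet> \<eta> j \<omega>) \<partial>M))"
      unfolding ov_def by (rule iso(1))
    show "integrable M (\<lambda>\<omega>. g \<omega> * (\<eta> i \<omega> \<bullet> \<eta> j \<omega>))" by (rule iso(2))
  qed
  have 1: "has_bochner_integral M (\<lambda>\<omega>. \<Sum>i\<in>I. \<Sum>j\<in>I. g \<omega> * (?x i \<omega> \<bullet> ?x j \<omega>))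
      (\<Sum>i\<in>I. \<Sum>j\<in>I. ov i j * (\<integral>\<omega>. g \<omega> * (\<eta> i \<omega> \<bullet> \<eta> j \<omega>) \<partial>M))"
    by (intro has_bochner_integral_sum one)
  have 2: "g \<omega> * (norm (simple_integral I a b \<zeta> u \<omega> - simple_integral I a b \<zeta> s \<omega>))\<^sup>2 =
      (\<Sum>i\<in>I. \<Sum>j\<in>I. g \<omega> * (?x i \<omega> \<bullet> ?x j \<omega>))" for \<omega>
    unfolding simple_integral_clamp[OF d su(2)] norm_sum_square sum_distrib_left p_def q_def \<eta>_def
    by (rule refl)
  have 3: "(LINT t:{s<..u}|lborel. (norm (simple_process I a b \<zeta> t \<omega>))\<^sup>2) =
      (\<Sum>i\<in>I. \<Sum>j\<in>I. ov i j * (\<eta> i \<omega> \<bullet> \<eta> j \<omega>))" for \<omega>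
  proof -
    have ind: "indicator {s<..u} t * (norm (simple_process I a b \<zeta> t \<omega>))\<^sup>2 =
        (\<Sum>i\<in>I. \<Sum>j\<in>I. (indicator {s<..u} t * (indicator {p i<..q i} t * indicator {p j<..q j} t)) * (\<eta> i \<omega> \<bullet> \<eta> j \<omega>))"
      for t
    proof (cases "t \<in> {s<..u}")
      case True
      have "simple_process I a b \<zeta> t \<omega> = (\<Sum>i\<in>I. indicator {p i<..q i} t *\<^sub>R \<eta> i \<omega>)"
        unfolding simple_process_def using True
        by (intro sum.cong) (auto simp: p_def q_def \<eta>_def split: split_indicator)
      then show ?thesis
        using True by (simp add: norm_sum_square mult.left_commute mult.assoc)
    qed simp
    have "has_bochner_integral lborel (\<lambda>t. \<Sum>i\<in>I. \<Sum>j\<in>I. (indicator {s<..u} t * (indicator {p i<..q i} t * indicator {p j<..q j} t)) * (\<eta> i \<omega> \<bullet> \<eta> j \<omega>))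
        (\<Sum>i\<in>I. \<Sum>j\<in>I. ov i j * (\<eta> i \<omega> \<bullet> \<eta> j \<omega>))"
      unfolding ov_def using su
      by (intro has_bochner_integral_sum has_bochner_integral_mult_left overlap_integral)
        (auto simp: p_def q_def)
    then show ?thesis
      unfolding set_lebesgue_integral_def real_scaleR_def ind
      by (rule has_bochner_integral_integral_eq)
  qed
  have "(\<integral>\<omega>. g \<omega> * (LINT t:{s<..u}|lborel. (norm (simple_process I a b \<zeta> t \<omega>))\<^sup>2) \<partial>M) =
      (\<integral>\<omega>. (\<Sum>i\<in>I. \<Sum>j\<in>I. ov i j * (g \<omega> * (\<eta> i \<omega> \<bullet> \<eta> j \<omega>))) \<partial>M)"
    unfolding 3 sum_distrib_left by (simp add: mult.left_commute)
  also have "\<dots> = (\<Sum>i\<in>I. \<Sum>j\<in>I. ov i j * (\<integral>\<omega>. g \<omega> * (\<eta> i \<omega> \<bullet> \<eta> j \<omega>) \<partial>M))"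
    by (simp add: int Bochner_Integration.integral_sum Bochner_Integration.integrable_sum)
  finally show ?thesis using 1 unfolding 2 by simp
qed

end

section \<open>Limits in mean square and Ito integrals\<close>

text \<open>Young's inequality with a free parameter. Later \<open>\<eta>\<close> tends to 0 along
  with the mean square distance, but slowly enough that the quotient of the two vanishes as
  well.\<close>

lemma abs_norm_square_diff_le:
  fixes a b :: "'a::real_normed_vector"
  assumes "\<eta> > 0"
  shows "\<bar>(norm a)\<^sup>2 - (norm b)\<^sup>2\<bar> \<le> (1 + 1 / \<eta>) * (norm (a - b))\<^sup>2 + \<eta> * (norm b)\<^sup>2"
proof -
  define x y where "x = norm (a - b)" and "y = norm b"
  have "\<bar>(norm a)\<^sup>2 - (norm b)\<^sup>2\<bar> = \<bar>norm a - norm b\<bar> * (norm a + norm b)"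
    by (simp add: power2_eq_square square_diff_square_factored abs_mult)
  also have "\<dots> \<le> x * (x + 2 * y)"
    using norm_triangle_ineq3[of a b] norm_triangle_ineq[of "a - b" b]
    by (intro mult_mono) (auto simp: x_def y_def)
  also have "\<dots> = x\<^sup>2 + 2 * (x / sqrt \<eta>) * (sqrt \<eta> * y)"
    using assms by (simp add: power2_eq_square algebra_simps)
  also have "\<dots> \<le> x\<^sup>2 + ((x / sqrt \<eta>)\<^sup>2 + (sqrt \<eta> * y)\<^sup>2)"
    by (intro add_left_mono sum_squares_bound)
  also have "\<dots> = (1 + 1 / \<eta>) * x\<^sup>2 + \<eta> * y\<^sup>2"
    using assms by (simp add: power_divide power_mult_distrib algebra_simps)
  finally show ?thesis by (simp add: x_def y_def)
qed

lemma square_integrable_nn: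
  fixes f :: "'q \<Rightarrow> 'b::euclidean_space"
  assumes "f \<in> borel_measurable N" "(\<integral>\<^sup>+x. ennreal ((norm (f x))\<^sup>2) \<partial>N) < \<infinity>"
  shows "integrable N (\<lambda>x. (norm (f x))\<^sup>2)"
  using assms by (intro integrableI_nonneg) auto

lemma norm_square_le_double:
  fixes a b :: "'a::real_normed_vector"
  shows "(norm a)\<^sup>2 \<le> 2 * (norm (a - b))\<^sup>2 + 2 * (norm b)\<^sup>2"
proof -
  have "(norm a)\<^sup>2 \<le> (norm (a - b) + norm b)\<^sup>2"
    using norm_triangle_ineq[of "a - b" b] by (intro power_mono) auto
  also have "\<dots> \<le> 2 * (norm (a - b))\<^sup>2 + 2 * (norm b)\<^sup>2"
    using sum_squares_bound[of "norm (a - b)" "norm b"] by (simp add: power2_sum)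
  finally show ?thesis .
qed

text \<open>The distances are \<open>ennreal\<close> values and may be infinite for finitely many k,
  so integrability and the real value of the distance hold only eventually.\<close>

lemma mean_square_rates:
  fixes f :: "'q \<Rightarrow> 'b::euclidean_space"
  assumes f [measurable]: "f \<in> borel_measurable N" and fk [measurable]: "\<And>k. fk k \<in> borel_measurable N"
    and fin: "(\<integral>\<^sup>+x. ennreal ((norm (f x))\<^sup>2) \<partial>N) < \<infinity>"
    and lim: "(\<lambda>k. \<integral>\<^sup>+x. ennreal ((norm (fk k x - f x))\<^sup>2) \<partial>N) \<longlonglongrightarrow> 0"
  obtains d \<eta> :: "nat \<Rightarrow> real" where
    "\<forall>\<^sub>F k in sequentially. integrable N (\<lambda>x. (norm (fk k x - f x))\<^sup>2) \<and>
       (\<integral>x. (norm (fk k x - f x))\<^sup>2 \<partial>N) = d k \<and> integrable N (\<lambda>x. (norm (fk k x))\<^sup>2)"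
    "d \<longlonglongrightarrow> 0" "\<eta> \<longlonglongrightarrow> 0" "\<And>k. \<eta> k > 0" "\<And>k. d k / \<eta> k \<le> sqrt (d k)" "\<And>k. 0 \<le> d k"
proof
  define d where "d k = (\<integral>x. (norm (fk k x - f x))\<^sup>2 \<partial>N)" for k
  \<comment> \<open>The square root of d balances the two error terms; the added null sequence keeps
    \<open>\<eta>\<close> positive where d is zero.\<close>
  define \<eta> where "\<eta> k = sqrt (d k) + inverse (real (Suc k))" for k
  show d0: "0 \<le> d k" for k by (simp add: d_def)
  have "d k = enn2real (\<integral>\<^sup>+x. ennreal ((norm (fk k x - f x))\<^sup>2) \<partial>N)" for k
    unfolding d_def by (rule integral_eq_nn_integral) auto
  then have "d = (\<lambda>k. enn2real (\<integral>\<^sup>+x. ennreal ((norm (fk k x - f x))\<^sup>2) \<partial>N))" by (rule ext)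
  moreover have "(\<lambda>k. enn2real (\<integral>\<^sup>+x. ennreal ((norm (fk k x - f x))\<^sup>2) \<partial>N)) \<longlonglongrightarrow> 0"
    by (rule tendsto_enn2real) (use lim in simp_all)
  ultimately show d: "d \<longlonglongrightarrow> 0" by (simp only:)
  have "\<eta> \<longlonglongrightarrow> sqrt 0 + 0"
    unfolding \<eta>_def by (intro tendsto_add tendsto_real_sqrt d LIMSEQ_inverse_real_of_nat)
  then show "\<eta> \<longlonglongrightarrow> 0" by simp
  show \<eta>: "\<eta> k > 0" for k
    unfolding \<eta>_def using d0[of k] by (intro add_nonneg_pos) auto
  show "d k / \<eta> k \<le> sqrt (d k)" for k
  proof -
    have "d k = sqrt (d k) * sqrt (d k)" using d0[of k] by simp
    also have "\<dots> \<le> sqrt (d k) * \<eta> k"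
      using d0[of k] by (intro mult_left_mono) (auto simp: \<eta>_def)
    finally show ?thesis using \<eta>[of k] by (simp add: pos_divide_le_eq)
  qed
  from order_tendstoD(2)[OF lim, of 1]
  have "\<forall>\<^sub>F k in sequentially. (\<integral>\<^sup>+x. ennreal ((norm (fk k x - f x))\<^sup>2) \<partial>N) < 1" by simp
  then show "\<forall>\<^sub>F k in sequentially. integrable N (\<lambda>x. (norm (fk k x - f x))\<^sup>2) \<and>
       (\<integral>x. (norm (fk k x - f x))\<^sup>2 \<partial>N) = d k \<and> integrable N (\<lambda>x. (norm (fk k x))\<^sup>2)"
  proof eventually_elim
    case (elim k)
    then have *: "integrable N (\<lambda>x. (norm (fk k x - f x))\<^sup>2)"
      by (intro square_integrable_nn) (auto intro: order_less_trans)
    have "integrable N (\<lambda>x. 2 * (norm (fk k x - f x))\<^sup>2 + 2 * (norm (f x))\<^sup>2)"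
      by (intro Bochner_Integration.integrable_add integrable_mult_right * square_integrable_nn f fin)
    then have "integrable N (\<lambda>x. (norm (fk k x))\<^sup>2)"
      by (rule Bochner_Integration.integrable_bound) (auto simp: norm_square_le_double)
    then show ?case using * by (simp add: d_def)
  qed
qed

lemma integral_norm_bound_AE:
  fixes h :: "'q \<Rightarrow> 'b::{banach, second_countable_topology}"
  assumes "integrable N h" "integrable N g" "AE x in N. norm (h x) \<le> g x"
  shows "norm (\<integral>x. h x \<partial>N) \<le> (\<integral>x. g x \<partial>N)"
  by (rule order_trans[OF integral_norm_bound])
    (intro integral_mono_AE integrable_norm assms)

text \<open>The measure is arbitrary because the lemma serves twice: on the product of outcomes and
  time for the integrands, and on the probability space for the stochastic integrals.\<close>

lemma weighted_square_tendsto: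
  fixes f :: "'q \<Rightarrow> 'b::euclidean_space"
  assumes f [measurable]: "f \<in> borel_measurable N" and fk [measurable]: "\<And>k. fk k \<in> borel_measurable N"
    and fin: "(\<integral>\<^sup>+x. ennreal ((norm (f x))\<^sup>2) \<partial>N) < \<infinity>"
    and lim: "(\<lambda>k. \<integral>\<^sup>+x. ennreal ((norm (fk k x - f x))\<^sup>2) \<partial>N) \<longlonglongrightarrow> 0"
    and w: "w \<in> borel_measurable N" "AE x in N. \<bar>w x\<bar> \<le> B" and "0 \<le> B"
  shows "(\<lambda>k. \<integral>x. w x * (norm (fk k x))\<^sup>2 \<partial>N) \<longlonglongrightarrow> (\<integral>x. w x * (norm (f x))\<^sup>2 \<partial>N)"
proof -
  obtain d \<eta> where ev: "\<forall>\<^sub>F k in sequentially. integrable N (\<lambda>x. (norm (fk k x - f x))\<^sup>2) \<and>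
       (\<integral>x. (norm (fk k x - f x))\<^sup>2 \<partial>N) = d k \<and> integrable N (\<lambda>x. (norm (fk k x))\<^sup>2)"
    and d: "d \<longlonglongrightarrow> 0" "\<eta> \<longlonglongrightarrow> 0" "\<And>k. \<eta> k > 0" "\<And>k. d k / \<eta> k \<le> sqrt (d k)" "\<And>k. 0 \<le> d k"
    by (rule mean_square_rates[OF f fk fin lim]) (rule that, assumption+)
  define A where "A = (\<integral>x. (norm (f x))\<^sup>2 \<partial>N)"
  have intf: "integrable N (\<lambda>x. (norm (f x))\<^sup>2)" by (rule square_integrable_nn[OF f fin])
  have "\<forall>\<^sub>F k in sequentially.
      norm ((\<integral>x. w x * (norm (fk k x))\<^sup>2 \<partial>N) - (\<integral>x. w x * (norm (f x))\<^sup>2 \<partial>N)) \<le> B * (d k + sqrt (d k) + \<eta> k * A)"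
    using ev
  proof eventually_elim
    case (elim k)
    then have i: "integrable N (\<lambda>x. (norm (fk k x - f x))\<^sup>2)" "integrable N (\<lambda>x. (norm (fk k x))\<^sup>2)"
      "(\<integral>x. (norm (fk k x - f x))\<^sup>2 \<partial>N) = d k" by auto
    have "(\<integral>x. w x * (norm (fk k x))\<^sup>2 \<partial>N) - (\<integral>x. w x * (norm (f x))\<^sup>2 \<partial>N) =
        (\<integral>x. w x * (norm (fk k x))\<^sup>2 - w x * (norm (f x))\<^sup>2 \<partial>N)"
      by (intro Bochner_Integration.integral_diff[symmetric] integrable_weighted[OF w] i intf)
    also have "norm \<dots> \<le> (\<integral>x. B * ((1 + 1 / \<eta> k) * (norm (fk k x - f x))\<^sup>2 + \<eta> k * (norm (f x))\<^sup>2) \<partial>N)"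
    proof (rule integral_norm_bound_AE)
      show "integrable N (\<lambda>x. w x * (norm (fk k x))\<^sup>2 - w x * (norm (f x))\<^sup>2)"
        by (intro Bochner_Integration.integrable_diff integrable_weighted[OF w] i intf)
      show "integrable N (\<lambda>x. B * ((1 + 1 / \<eta> k) * (norm (fk k x - f x))\<^sup>2 + \<eta> k * (norm (f x))\<^sup>2))"
        by (intro integrable_mult_right Bochner_Integration.integrable_add i intf)
      show "AE x in N. norm (w x * (norm (fk k x))\<^sup>2 - w x * (norm (f x))\<^sup>2) \<le>
          B * ((1 + 1 / \<eta> k) * (norm (fk k x - f x))\<^sup>2 + \<eta> k * (norm (f x))\<^sup>2)"
        using w(2)
      proof eventually_elim
        case (elim x)
        have "norm (w x * (norm (fk k x))\<^sup>2 - w x * (norm (f x))\<^sup>2) =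
            \<bar>w x\<bar> * \<bar>(norm (fk k x))\<^sup>2 - (norm (f x))\<^sup>2\<bar>"
          by (simp add: right_diff_distrib[symmetric] abs_mult)
        also have "\<dots> \<le> B * ((1 + 1 / \<eta> k) * (norm (fk k x - f x))\<^sup>2 + \<eta> k * (norm (f x))\<^sup>2)"
          using elim assms(7) by (intro mult_mono abs_norm_square_diff_le d) auto
        finally show ?case .
      qed
    qed
    also have "\<dots> = B * ((1 + 1 / \<eta> k) * d k + \<eta> k * A)"
      using i intf by (simp add: A_def)
    also have "\<dots> \<le> B * (d k + sqrt (d k) + \<eta> k * A)"
      using d(4)[of k] assms(7) by (intro mult_left_mono) (auto simp: distrib_right)
    finally show ?case .
  qed
  moreover have "(\<lambda>k. B * (d k + sqrt (d k) + \<eta> k * A)) \<longlonglongrightarrow> B * (0 + sqrt 0 + 0 * A)"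
    by (intro tendsto_intros d)
  then have "(\<lambda>k. B * (d k + sqrt (d k) + \<eta> k * A)) \<longlonglongrightarrow> 0" by simp
  ultimately have "(\<lambda>k. (\<integral>x. w x * (norm (fk k x))\<^sup>2 \<partial>N) - (\<integral>x. w x * (norm (f x))\<^sup>2 \<partial>N)) \<longlonglongrightarrow> 0"
    by (rule Lim_null_comparison)
  then show ?thesis by (simp add: LIM_zero_iff)
qed

lemma (in prob_space) weighted_inner_tendsto:
  fixes f b :: "'a \<Rightarrow> 'b::euclidean_space"
  assumes f [measurable]: "f \<in> borel_measurable M" and fk [measurable]: "\<And>k. fk k \<in> borel_measurable M"
    and fin: "(\<integral>\<^sup>+x. ennreal ((norm (f x))\<^sup>2) \<partial>M) < \<infinity>"
    and lim: "(\<lambda>k. \<integral>\<^sup>+x. ennreal ((norm (fk k x - f x))\<^sup>2) \<partial>M) \<longlonglongrightarrow> 0"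
    and b [measurable]: "b \<in> borel_measurable M" and B: "AE x in M. norm (b x) \<le> B" and "0 \<le> B"
  shows "(\<lambda>k. \<integral>x. b x \<bullet> fk k x \<partial>M) \<longlonglongrightarrow> (\<integral>x. b x \<bullet> f x \<partial>M)" "integrable M (\<lambda>x. b x \<bullet> f x)"
proof -
  obtain d \<eta> where ev: "\<forall>\<^sub>F k in sequentially. integrable M (\<lambda>x. (norm (fk k x - f x))\<^sup>2) \<and>
       (\<integral>x. (norm (fk k x - f x))\<^sup>2 \<partial>M) = d k \<and> integrable M (\<lambda>x. (norm (fk k x))\<^sup>2)"
    and d: "d \<longlonglongrightarrow> 0" "\<eta> \<longlonglongrightarrow> 0" "\<And>k. \<eta> k > 0" "\<And>k. d k / \<eta> k \<le> sqrt (d k)" "\<And>k. 0 \<le> d k"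
    by (rule mean_square_rates[OF f fk fin lim]) (rule that, assumption+)
  \<comment> \<open>A crude substitute for the Cauchy-Schwarz inequality for integrals. The constant
    h is integrable because the measure is a probability.\<close>
  have am: "norm z \<le> h + (norm z)\<^sup>2 / h" if "h > 0" for h and z :: 'b
  proof (cases "norm z \<le> h")
    case False
    then have "norm z * h \<le> norm z * norm z" by (intro mult_left_mono) auto
    then have "norm z \<le> (norm z)\<^sup>2 / h" using that by (simp add: pos_le_divide_eq power2_eq_square)
    then show ?thesis using that by simp
  qed (use that in \<open>simp add: add_increasing2\<close>)
  have bound: "AE x in M. norm (b x \<bullet> g x) \<le> B * (h + (norm (g x))\<^sup>2 / h)" if "h > 0" for h g
    using B
  proof eventually_elim
    case (elim x)
    have "norm (b x \<bullet> g x) \<le> norm (b x) * norm (g x)" by (simp add: Cauchy_Schwarz_ineq2)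
    also have "\<dots> \<le> B * (h + (norm (g x))\<^sup>2 / h)"
      using elim assms(7) by (intro mult_mono am that) auto
    finally show ?case .
  qed
  have int: "integrable M (\<lambda>x. b x \<bullet> g x)"
    if [measurable]: "g \<in> borel_measurable M" and "integrable M (\<lambda>x. (norm (g x))\<^sup>2)" for g
  proof (rule Bochner_Integration.integrable_bound)
    show "integrable M (\<lambda>x. B * (1 + (norm (g x))\<^sup>2 / 1))" using that by simp
    show "AE x in M. norm (b x \<bullet> g x) \<le> norm (B * (1 + (norm (g x))\<^sup>2 / 1))"
      using bound[OF zero_less_one, of g] by eventually_elim auto
  qed measurable
  have intf: "integrable M (\<lambda>x. (norm (f x))\<^sup>2)" by (rule square_integrable_nn[OF f fin])
  show "integrable M (\<lambda>x. b x \<bullet> f x)" by (rule int[OF f intf])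
  have "\<forall>\<^sub>F k in sequentially.
      norm ((\<integral>x. b x \<bullet> fk k x \<partial>M) - (\<integral>x. b x \<bullet> f x \<partial>M)) \<le> B * (\<eta> k + sqrt (d k))"
    using ev
  proof eventually_elim
    case (elim k)
    then have i: "integrable M (\<lambda>x. (norm (fk k x - f x))\<^sup>2)" "integrable M (\<lambda>x. (norm (fk k x))\<^sup>2)"
      "(\<integral>x. (norm (fk k x - f x))\<^sup>2 \<partial>M) = d k" by auto
    have "(\<integral>x. b x \<bullet> fk k x \<partial>M) - (\<integral>x. b x \<bullet> f x \<partial>M) = (\<integral>x. b x \<bullet> fk k x - b x \<bullet> f x \<partial>M)"
      by (intro Bochner_Integration.integral_diff[symmetric] int f fk i intf)
    also have "\<dots> = (\<integral>x. b x \<bullet> (fk k x - f x) \<partial>M)" by (simp add: inner_diff_right)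
    also have "norm \<dots> \<le> (\<integral>x. B * (\<eta> k + (norm (fk k x - f x))\<^sup>2 / \<eta> k) \<partial>M)"
      by (rule integral_norm_bound_AE)
        (use bound[OF d(3)[of k]] i in \<open>auto intro!: int borel_measurable_diff\<close>)
    also have "\<dots> = B * (\<eta> k + d k / \<eta> k)" using i by (simp add: prob_space)
    also have "\<dots> \<le> B * (\<eta> k + sqrt (d k))"
      using d(4)[of k] assms(7) by (intro mult_left_mono) auto
    finally show ?case .
  qed
  moreover have "(\<lambda>k. B * (\<eta> k + sqrt (d k))) \<longlonglongrightarrow> B * (0 + sqrt 0)"
    by (intro tendsto_intros d)
  then have "(\<lambda>k. B * (\<eta> k + sqrt (d k))) \<longlonglongrightarrow> 0" by simp
  ultimately have "(\<lambda>k. (\<integral>x. b x \<bullet> fk k x \<partial>M) - (\<integral>x. b x \<bullet> f x \<partial>M)) \<longlonglongrightarrow> 0"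
    by (rule Lim_null_comparison)
  then show "(\<lambda>k. \<integral>x. b x \<bullet> fk k x \<partial>M) \<longlonglongrightarrow> (\<integral>x. b x \<bullet> f x \<partial>M)" by (simp add: LIM_zero_iff)
qed

lemma mean_square_diff_tendsto:
  fixes f g :: "'q \<Rightarrow> 'b::euclidean_space"
  assumes [measurable]: "f \<in> borel_measurable N" "\<And>k. fk k \<in> borel_measurable N"
      "g \<in> borel_measurable N" "\<And>k. gk k \<in> borel_measurable N"
    and "(\<lambda>k. \<integral>\<^sup>+x. ennreal ((norm (fk k x - f x))\<^sup>2) \<partial>N) \<longlonglongrightarrow> 0"
    and "(\<lambda>k. \<integral>\<^sup>+x. ennreal ((norm (gk k x - g x))\<^sup>2) \<partial>N) \<longlonglongrightarrow> 0"
  shows "(\<lambda>k. \<integral>\<^sup>+x. ennreal ((norm ((fk k x - gk k x) - (f x - g x)))\<^sup>2) \<partial>N) \<longlonglongrightarrow> 0"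
proof (rule tendsto_sandwich[OF _ _ tendsto_const])
  let ?a = "\<lambda>k. \<integral>\<^sup>+x. ennreal ((norm (fk k x - f x))\<^sup>2) \<partial>N"
  let ?b = "\<lambda>k. \<integral>\<^sup>+x. ennreal ((norm (gk k x - g x))\<^sup>2) \<partial>N"
  have "(\<lambda>k. 2 * ?a k + 2 * ?b k) \<longlonglongrightarrow> 2 * 0 + 2 * 0"
    by (intro tendsto_add ennreal_tendsto_cmult assms) auto
  then show "(\<lambda>k. 2 * ?a k + 2 * ?b k) \<longlonglongrightarrow> 0" by simp
  show "\<forall>\<^sub>F k in sequentially. (\<integral>\<^sup>+x. ennreal ((norm ((fk k x - gk k x) - (f x - g x)))\<^sup>2) \<partial>N) \<le> 2 * ?a k + 2 * ?b k"
  proof (intro always_eventually allI)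
    fix k
    have "(\<integral>\<^sup>+x. ennreal ((norm ((fk k x - gk k x) - (f x - g x)))\<^sup>2) \<partial>N) \<le>
        (\<integral>\<^sup>+x. 2 * ennreal ((norm (fk k x - f x))\<^sup>2) + 2 * ennreal ((norm (gk k x - g x))\<^sup>2) \<partial>N)"
    proof (rule nn_integral_mono)
      fix x
      have eq: "(fk k x - gk k x) - (f x - g x) - (- (gk k x - g x)) = fk k x - f x" by simp
      have "(norm ((fk k x - gk k x) - (f x - g x)))\<^sup>2 \<le> 2 * (norm (fk k x - f x))\<^sup>2 + 2 * (norm (gk k x - g x))\<^sup>2"
        using norm_square_le_double[of "(fk k x - gk k x) - (f x - g x)" "- (gk k x - g x)"]
        unfolding eq norm_minus_cancel .
      from ennreal_leI[OF this]
      show "ennreal ((norm ((fk k x - gk k x) - (f x - g x)))\<^sup>2) \<le>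
          2 * ennreal ((norm (fk k x - f x))\<^sup>2) + 2 * ennreal ((norm (gk k x - g x))\<^sup>2)"
        by (simp add: ennreal_mult'')
    qed
    also have "\<dots> = 2 * ?a k + 2 * ?b k"
      by (subst nn_integral_add) (auto simp: nn_integral_cmult)
    finally show "(\<integral>\<^sup>+x. ennreal ((norm ((fk k x - gk k x) - (f x - g x)))\<^sup>2) \<partial>N) \<le> 2 * ?a k + 2 * ?b k" .
  qed
qed auto

lemma nn_square_diff_finite:
  fixes f g :: "'q \<Rightarrow> 'b::euclidean_space"
  assumes [measurable]: "f \<in> borel_measurable N" "g \<in> borel_measurable N"
    and "(\<integral>\<^sup>+x. ennreal ((norm (f x))\<^sup>2) \<partial>N) < \<infinity>" "(\<integral>\<^sup>+x. ennreal ((norm (g x))\<^sup>2) \<partial>N) < \<infinity>"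
  shows "(\<integral>\<^sup>+x. ennreal ((norm (f x - g x))\<^sup>2) \<partial>N) < \<infinity>"
proof -
  have "(\<integral>\<^sup>+x. ennreal ((norm (f x - g x))\<^sup>2) \<partial>N) \<le>
      (\<integral>\<^sup>+x. 2 * ennreal ((norm (f x))\<^sup>2) + 2 * ennreal ((norm (g x))\<^sup>2) \<partial>N)"
  proof (rule nn_integral_mono)
    fix x
    have "(norm (f x - g x))\<^sup>2 \<le> 2 * (norm (f x))\<^sup>2 + 2 * (norm (g x))\<^sup>2"
      using norm_square_le_double[of "f x - g x" "- g x"] by simp
    from ennreal_leI[OF this]
    show "ennreal ((norm (f x - g x))\<^sup>2) \<le> 2 * ennreal ((norm (f x))\<^sup>2) + 2 * ennreal ((norm (g x))\<^sup>2)"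
      by (simp add: ennreal_mult'')
  qed
  also have "\<dots> = 2 * (\<integral>\<^sup>+x. ennreal ((norm (f x))\<^sup>2) \<partial>N) + 2 * (\<integral>\<^sup>+x. ennreal ((norm (g x))\<^sup>2) \<partial>N)"
    by (subst nn_integral_add) (auto simp: nn_integral_cmult)
  also have "\<dots> < \<infinity>" using assms by (simp add: ennreal_mult_less_top)
  finally show ?thesis .
qed

lemma finite_measure_time_measure: "finite_measure (time_measure T)"
  by (rule finite_measureI)
    (cases "0 \<le> T", simp_all add: time_measure_def emeasure_restrict_space space_restrict_space)

lemma set_integral_time_measure:
  fixes h :: "real \<Rightarrow> real"
  assumes "0 \<le> s" "u \<le> T"
  shows "(\<integral>t. indicator {s<..u} t * h t \<partial>time_measure T) = (LINT t:{s<..u}|lborel. h t)"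
proof -
  have "(\<integral>t. indicator {s<..u} t * h t \<partial>time_measure T) =
      (\<integral>t. indicator {0..T} t *\<^sub>R (indicator {s<..u} t * h t) \<partial>lborel)"
    unfolding time_measure_def by (rule integral_restrict_space) simp
  also have "(\<lambda>t. indicator {0..T} t *\<^sub>R (indicator {s<..u} t * h t)) = (\<lambda>t. indicator {s<..u} t *\<^sub>R h t)"
    using assms by (auto simp: fun_eq_iff split: split_indicator)
  finally show ?thesis by (simp add: set_lebesgue_integral_def)
qed

section \<open>From elementary integrands to Ito integrals\<close>

context brownian_basis
begin

text \<open>Outcomes come first so that the inner integral in Tonelli's theorem runs over time, as
  in \<open>space_H2\<close> and \<open>has_ito_integral\<close>.\<close>

abbreviation Q :: "('w \<times> real) measure" where
  "Q \<equiv> M \<Otimes>\<^sub>M time_measure T"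

lemma pair_Q: "pair_sigma_finite M (time_measure T)"
  by (intro pair_sigma_finite.intro finite_measure.axioms(1) finite_measure_time_measure
      sigma_finite_measure_axioms)

lemma progressive_swap:
  assumes "progressive F T Z" "0 \<le> T"
  shows "(\<lambda>(\<omega>, t). Z t \<omega>) \<in> borel_measurable Q"
proof -
  have "(\<lambda>(s, \<omega>). Z s \<omega>) \<in> borel_measurable (restrict_space borel {0..T} \<Otimes>\<^sub>M F T)"
    using assms by (simp add: progressive_def)
  moreover have "(\<lambda>(\<omega>, t). (t, \<omega>)) \<in> measurable Q (restrict_space borel {0..T} \<Otimes>\<^sub>M F T)"
  proof -
    have "snd \<in> measurable Q (restrict_space borel {0..T})"
      using measurable_snd[of M "time_measure T"]
      by (simp add: time_measure_def cong: measurable_cong_sets restrict_space_sets_cong)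
    moreover have "(\<lambda>\<omega>. \<omega>) \<in> measurable M (F T)"
      using sets_F_subset[of T] sets.sets_into_space by (intro measurableI) (auto simp: Int_absorb2)
    then have "fst \<in> measurable Q (F T)" using measurable_compose[OF measurable_fst] by simp
    ultimately show ?thesis by (simp add: case_prod_beta')
  qed
  ultimately have "(\<lambda>x. (\<lambda>(s, \<omega>). Z s \<omega>) ((\<lambda>(\<omega>, t). (t, \<omega>)) x)) \<in> borel_measurable Q"
    by (rule measurable_compose[rotated])
  then show ?thesis by (simp add: case_prod_beta')
qed

lemma H2_finite:
  fixes Z :: "real \<Rightarrow> 'w \<Rightarrow> real ^ 'm ^ 'n"
  assumes "Z \<in> space_H2 M F T" "0 \<le> T"
  shows "(\<integral>\<^sup>+x. ennreal ((norm ((\<lambda>(\<omega>, t). Z t \<omega>) x))\<^sup>2) \<partial>Q) < \<infinity>"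
proof -
  interpret pair_sigma_finite M "time_measure T" by (rule pair_Q)
  have [measurable]: "(\<lambda>(\<omega>, t). Z t \<omega>) \<in> borel_measurable Q"
    using assms by (intro progressive_swap) (auto simp: space_H2_def)
  have "(\<integral>\<^sup>+x. ennreal ((norm ((\<lambda>(\<omega>, t). Z t \<omega>) x))\<^sup>2) \<partial>Q) =
      (\<integral>\<^sup>+\<omega>. \<integral>\<^sup>+t. ennreal ((norm (Z t \<omega>))\<^sup>2) \<partial>time_measure T \<partial>M)"
    by (subst M2.nn_integral_fst[symmetric]) auto
  then show ?thesis using assms by (simp add: space_H2_def)
qed

lemma simple_integral_measurable:
  assumes "simple_data I a b \<zeta>" "t \<in> {0..T}"
  shows "simple_integral I a b \<zeta> t \<in> borel_measurable M"
  unfolding simple_integral_def[abs_def]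
proof (intro borel_measurable_sum)
  fix i assume "i \<in> I"
  then have i: "0 \<le> a i" "a i \<le> b i" "b i \<le> T" "\<zeta> i \<in> borel_measurable (F (a i))"
    using assms by (auto simp: simple_data_def)
  have [measurable]: "\<zeta> i \<in> borel_measurable M" using i by (intro F_measurable_M[OF i(4)]) auto
  have [measurable]: "(\<lambda>\<omega>. W (min t (b i)) \<omega> - W (min t (a i)) \<omega>) \<in> borel_measurable M"
    using i assms by (intro borel_measurable_diff W_measurable) auto
  have "continuous_on UNIV (\<lambda>x :: (real ^ 'm ^ 'n) \<times> (real ^ 'm). fst x *v snd x)"
    unfolding matrix_vector_mult_def
    by (intro continuous_on_vec_lambda continuous_intros)
  from borel_measurable_continuous_on[OF this, of "\<lambda>\<omega>. (\<zeta> i \<omega>, W (min t (b i)) \<omega> - W (min t (a i)) \<omega>)" M]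
  show "(\<lambda>\<omega>. \<zeta> i \<omega> *v (W (min t (b i)) \<omega> - W (min t (a i)) \<omega>)) \<in> borel_measurable M"
    by simp
qed

lemma simple_process_measurable:
  assumes "simple_data I a b \<zeta>"
  shows "(\<lambda>(\<omega>, t). simple_process I a b \<zeta> t \<omega>) \<in> borel_measurable Q"
  unfolding simple_process_def case_prod_beta'
proof (intro borel_measurable_sum borel_measurable_scaleR)
  fix i assume "i \<in> I"
  then have i: "0 \<le> a i" "a i \<le> b i" "b i \<le> T" "\<zeta> i \<in> borel_measurable (F (a i))"
    using assms by (auto simp: simple_data_def)
  have "\<zeta> i \<in> borel_measurable M" using i by (intro F_measurable_M[OF i(4)]) auto
  then show "(\<lambda>x. \<zeta> i (fst x)) \<in> borel_measurable Q" by measurable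
  have "(indicator {a i<..b i} :: real \<Rightarrow> real) \<in> borel_measurable (time_measure T)"
    unfolding time_measure_def by (intro measurable_restrict_space1) measurable
  then show "(\<lambda>x. indicat_real {a i<..b i} (snd x)) \<in> borel_measurable Q" by measurable
qed

lemma elementary_difference:
  fixes \<zeta> \<zeta>' :: "nat \<Rightarrow> 'w \<Rightarrow> real ^ 'm ^ 'n"
  assumes "elementary_data M F T N \<tau> \<zeta>" "elementary_data M F T N' \<tau>' \<zeta>'"
  defines "I \<equiv> {..<N} <+> {..<N'}" and "a \<equiv> case_sum \<tau> \<tau>'"
    and "b \<equiv> case_sum (\<lambda>i. \<tau> (Suc i)) (\<lambda>i. \<tau>' (Suc i))"
    and "z \<equiv> case_sum \<zeta> (\<lambda>i \<omega>. - \<zeta>' i \<omega>)"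
  shows "simple_data I a b z"
    "simple_process I a b z t \<omega> = elementary_process N \<tau> \<zeta> t \<omega> - elementary_process N' \<tau>' \<zeta>' t \<omega>"
    "simple_integral I a b z t \<omega> = elementary_integral W N \<tau> \<zeta> t \<omega> - elementary_integral W N' \<tau>' \<zeta>' t \<omega>"
proof -
  have "\<tau> i \<in> {0..T}" "\<tau>' i \<in> {0..T}" "\<tau> i \<le> \<tau> (Suc i)" "\<tau>' i \<le> \<tau>' (Suc i)" for i
    using assms(1,2) by (auto simp: elementary_data_def image_subset_iff intro: monoD)
  moreover have "\<zeta> i \<in> borel_measurable (F (\<tau> i))" "\<exists>B. \<forall>\<omega>\<in>space M. norm (\<zeta> i \<omega>) \<le> B" if "i < N" for i
    using assms(1) that unfolding elementary_data_def by blast+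
  moreover have "\<zeta>' i \<in> borel_measurable (F (\<tau>' i))" "\<exists>B. \<forall>\<omega>\<in>space M. norm (\<zeta>' i \<omega>) \<le> B" if "i < N'" for i
    using assms(2) that unfolding elementary_data_def by blast+
  ultimately show "simple_data I a b z"
    unfolding simple_data_def I_def a_def b_def z_def by (auto intro!: borel_measurable_uminus)
  have "(- A) *v x = - (A *v x)" for A :: "real ^ 'm ^ 'n" and x
    by (simp add: matrix_vector_mult_def vec_eq_iff sum_negf)
  then show "simple_integral I a b z t \<omega> = elementary_integral W N \<tau> \<zeta> t \<omega> - elementary_integral W N' \<tau>' \<zeta>' t \<omega>"
    by (simp add: simple_integral_def elementary_integral_def I_def a_def b_def z_def sum.Plus sum_negf)
  show "simple_process I a b z t \<omega> = elementary_process N \<tau> \<zeta> t \<omega> - elementary_process N' \<tau>' \<zeta>' t \<omega>"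
    unfolding simple_process_def elementary_process_def I_def a_def b_def z_def
    by (simp only: sum.Plus[OF finite_lessThan finite_lessThan] o_def sum.case scaleR_minus_right sum_negf) simp
qed

text \<open>A weight in the outcome and a window in time together form one bounded weight on
  \<open>Q\<close>. In this shape the time integral of the squared norm is accessible to
  \<open>weighted_square_tendsto\<close>.\<close>

lemma window_integral_Q:
  fixes g :: "'w \<Rightarrow> real" and H :: "real \<Rightarrow> 'w \<Rightarrow> real ^ 'm ^ 'n"
  assumes "0 \<le> s" "u \<le> T" and H: "(\<lambda>(\<omega>, t). H t \<omega>) \<in> borel_measurable Q"
    and fin: "(\<integral>\<^sup>+x. ennreal ((norm ((\<lambda>(\<omega>, t). H t \<omega>) x))\<^sup>2) \<partial>Q) < \<infinity>"
    and g: "g \<in> borel_measurable M" "AE \<omega> in M. \<bar>g \<omega>\<bar> \<le> G"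
  shows "has_bochner_integral M (\<lambda>\<omega>. g \<omega> * (LINT t:{s<..u}|lborel. (norm (H t \<omega>))\<^sup>2))
      (\<integral>x. (g (fst x) * indicator {s<..u} (snd x)) * (norm ((\<lambda>(\<omega>, t). H t \<omega>) x))\<^sup>2 \<partial>Q)"
    and "(\<lambda>x. g (fst x) * indicator {s<..u} (snd x)) \<in> borel_measurable Q"
    and "AE x in Q. \<bar>g (fst x) * indicator {s<..u} (snd x)\<bar> \<le> \<bar>G\<bar>"
proof -
  interpret pair_sigma_finite M "time_measure T" by (rule pair_Q)
  have "(indicator {s<..u} :: real \<Rightarrow> real) \<in> borel_measurable (time_measure T)"
    unfolding time_measure_def by (intro measurable_restrict_space1) measurable
  then have i: "(\<lambda>x. indicat_real {s<..u} (snd x)) \<in> borel_measurable Q" by measurable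
  have g1: "(\<lambda>x. g (fst x)) \<in> borel_measurable Q" using g(1) by measurable
  show m: "(\<lambda>x. g (fst x) * indicator {s<..u} (snd x)) \<in> borel_measurable Q"
    by (intro borel_measurable_times i g1)
  have "AE x in Q. \<bar>g (fst x)\<bar> \<le> G"
  proof (rule AE_pair_measure)
    show "{x \<in> space Q. \<bar>g (fst x)\<bar> \<le> G} \<in> sets Q" using g1 by measurable
    show "AE x in M. AE y in time_measure T. \<bar>g (fst (x, y))\<bar> \<le> G"
      using g(2) by eventually_elim simp
  qed
  then show B: "AE x in Q. \<bar>g (fst x) * indicator {s<..u} (snd x)\<bar> \<le> \<bar>G\<bar>"
    by eventually_elim (auto simp: abs_mult split: split_indicator)
  have int: "integrable Q (\<lambda>x. (g (fst x) * indicator {s<..u} (snd x)) * (norm ((\<lambda>(\<omega>, t). H t \<omega>) x))\<^sup>2)"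
    by (intro integrable_weighted[OF m B] square_integrable_nn H fin)
  have "(\<integral>t. (g (fst (\<omega>, t)) * indicator {s<..u} (snd (\<omega>, t))) * (norm ((\<lambda>(\<omega>, t). H t \<omega>) (\<omega>, t)))\<^sup>2 \<partial>time_measure T) =
      g \<omega> * (LINT t:{s<..u}|lborel. (norm (H t \<omega>))\<^sup>2)" for \<omega>
    unfolding set_integral_time_measure[OF assms(1,2), symmetric] by (simp add: mult.assoc)
  then show "has_bochner_integral M (\<lambda>\<omega>. g \<omega> * (LINT t:{s<..u}|lborel. (norm (H t \<omega>))\<^sup>2))
      (\<integral>x. (g (fst x) * indicator {s<..u} (snd x)) * (norm ((\<lambda>(\<omega>, t). H t \<omega>) x))\<^sup>2 \<partial>Q)"
    using integrable_fst'[OF int] integral_fst'[OF int] by (simp add: has_bochner_integral_iff)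
qed

lemma simple_process_finite:
  fixes \<zeta> :: "'i \<Rightarrow> 'w \<Rightarrow> real ^ 'm ^ 'n"
  assumes "simple_data I a b \<zeta>"
  shows "(\<integral>\<^sup>+x. ennreal ((norm ((\<lambda>(\<omega>, t). simple_process I a b \<zeta> t \<omega>) x))\<^sup>2) \<partial>Q) < \<infinity>"
proof -
  interpret time: finite_measure "time_measure T" by (rule finite_measure_time_measure)
  obtain B where B: "\<And>i \<omega>. i \<in> I \<Longrightarrow> \<omega> \<in> space M \<Longrightarrow> norm (\<zeta> i \<omega>) \<le> B i"
    using assms unfolding simple_data_def by metis
  have bd: "norm (simple_process I a b \<zeta> t \<omega>) \<le> (\<Sum>i\<in>I. \<bar>B i\<bar>)" if "\<omega> \<in> space M" for t \<omega>
    unfolding simple_process_def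
  proof (rule order_trans[OF norm_sum], rule sum_mono)
    fix i assume "i \<in> I"
    then show "norm (indicat_real {a i<..b i} t *\<^sub>R \<zeta> i \<omega>) \<le> \<bar>B i\<bar>"
      using B[OF _ that, of i] by (auto split: split_indicator)
  qed
  have "(\<integral>\<^sup>+x. ennreal ((norm ((\<lambda>(\<omega>, t). simple_process I a b \<zeta> t \<omega>) x))\<^sup>2) \<partial>Q) \<le>
      (\<integral>\<^sup>+x. ennreal ((\<Sum>i\<in>I. \<bar>B i\<bar>)\<^sup>2) \<partial>Q)"
    by (intro nn_integral_mono ennreal_leI)
      (auto simp: space_pair_measure intro!: power_mono bd)
  also have "\<dots> = ennreal ((\<Sum>i\<in>I. \<bar>B i\<bar>)\<^sup>2) * (emeasure M (space M) * emeasure (time_measure T) (space (time_measure T)))"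
    by (simp add: space_pair_measure time.emeasure_pair_measure_Times)
  also have "\<dots> < \<infinity>"
    using time.emeasure_finite by (simp add: ennreal_mult_eq_top_iff less_top[symmetric] emeasure_space_1)
  finally show ?thesis .
qed

text \<open>The two approximating sequences live on unrelated partitions, but their differences are
  simple integrands. Passing to the limit in these differences gives both properties for J - J' at
  once, without a separate linearity result for the Ito integral.\<close>

theorem ito_difference:
  fixes Z Z' :: "real \<Rightarrow> 'w \<Rightarrow> real ^ 'm ^ 'n" and J J' :: "real \<Rightarrow> 'w \<Rightarrow> real ^ 'n"
  assumes Z: "Z \<in> space_H2 M F T" "Z' \<in> space_H2 M F T"
    and J: "has_ito_integral M F T W Z J" "has_ito_integral M F T W Z' J'"
    and su: "0 \<le> s" "s \<le> u" "u \<le> T"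
  defines "dJ \<equiv> \<lambda>\<omega>. (J u \<omega> - J' u \<omega>) - (J s \<omega> - J' s \<omega>)"
  shows "\<And>g G. g \<in> borel_measurable (F s) \<Longrightarrow> AE \<omega> in M. norm (g \<omega>) \<le> G \<Longrightarrow> 0 \<le> G \<Longrightarrow>
      has_bochner_integral M (\<lambda>\<omega>. g \<omega> \<bullet> dJ \<omega>) 0"
    and "\<And>g G. g \<in> borel_measurable (F s) \<Longrightarrow> AE \<omega> in M. \<bar>g \<omega>\<bar> \<le> G \<Longrightarrow> 0 \<le> G \<Longrightarrow>
      integrable M (\<lambda>\<omega>. g \<omega> * (norm (dJ \<omega>))\<^sup>2) \<and>
      has_bochner_integral M (\<lambda>\<omega>. g \<omega> * (LINT t:{s<..u}|lborel. (norm (Z t \<omega> - Z' t \<omega>))\<^sup>2))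
        (\<integral>\<omega>. g \<omega> * (norm (dJ \<omega>))\<^sup>2 \<partial>M)"
proof -
  interpret pair_sigma_finite M "time_measure T" by (rule pair_Q)
  obtain N \<tau> \<zeta> where e: "\<And>k. elementary_data M F T (N k) (\<tau> k) (\<zeta> k)"
    "(\<lambda>k. \<integral>\<^sup>+\<omega>. (\<integral>\<^sup>+t. ennreal
            ((norm (elementary_process (N k) (\<tau> k) (\<zeta> k) t \<omega> - Z t \<omega>))\<^sup>2) \<partial>time_measure T) \<partial>M)
          \<longlonglongrightarrow> 0"
    "\<And>t. t\<in>{0..T} \<Longrightarrow> (\<lambda>k. \<integral>\<^sup>+\<omega>. ennreal
              ((norm (elementary_integral W (N k) (\<tau> k) (\<zeta> k) t \<omega> - J t \<omega>))\<^sup>2) \<partial>M) \<longlonglongrightarrow> 0"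
    using J(1) unfolding has_ito_integral_def by blast
  obtain N' \<tau>' \<zeta>' where e': "\<And>k. elementary_data M F T (N' k) (\<tau>' k) (\<zeta>' k)"
    "(\<lambda>k. \<integral>\<^sup>+\<omega>. (\<integral>\<^sup>+t. ennreal
            ((norm (elementary_process (N' k) (\<tau>' k) (\<zeta>' k) t \<omega> - Z' t \<omega>))\<^sup>2) \<partial>time_measure T) \<partial>M)
          \<longlonglongrightarrow> 0"
    "\<And>t. t\<in>{0..T} \<Longrightarrow> (\<lambda>k. \<integral>\<^sup>+\<omega>. ennreal
              ((norm (elementary_integral W (N' k) (\<tau>' k) (\<zeta>' k) t \<omega> - J' t \<omega>))\<^sup>2) \<partial>M) \<longlonglongrightarrow> 0"
    using J(2) unfolding has_ito_integral_def by blast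
  define I a b z where "I k = {..<N k} <+> {..<N' k}" and "a k = case_sum (\<tau> k) (\<tau>' k)"
    and "b k = case_sum (\<lambda>i. \<tau> k (Suc i)) (\<lambda>i. \<tau>' k (Suc i))"
    and "z k = case_sum (\<zeta> k) (\<lambda>i \<omega>. - \<zeta>' k i \<omega>)" for k
  have sd: "simple_data (I k) (a k) (b k) (z k)" for k
    unfolding I_def a_def b_def z_def by (rule elementary_difference(1)[OF e(1) e'(1)])
  have sp: "simple_process (I k) (a k) (b k) (z k) t \<omega> = elementary_process (N k) (\<tau> k) (\<zeta> k) t \<omega> -
      elementary_process (N' k) (\<tau>' k) (\<zeta>' k) t \<omega>" for k t \<omega>
    unfolding I_def a_def b_def z_def by (rule elementary_difference(2)[OF e(1) e'(1)])
  have si: "simple_integral (I k) (a k) (b k) (z k) t \<omega> = elementary_integral W (N k) (\<tau> k) (\<zeta> k) t \<omega> -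
      elementary_integral W (N' k) (\<tau>' k) (\<zeta>' k) t \<omega>" for k t \<omega>
    unfolding I_def a_def b_def z_def by (rule elementary_difference(3)[OF e(1) e'(1)])
  have T: "0 \<le> T" and st: "s \<in> {0..T}" "u \<in> {0..T}" using su by auto
  \<comment> \<open>Measurability of an elementary process and its integral is read off from their
    difference with the elementary process that has no intervals.\<close>
  have z0: "elementary_data M F T 0 (\<lambda>_. 0) (\<lambda>_ _. 0 :: real ^ 'm ^ 'n)"
    using T by (simp add: elementary_data_def mono_def)
  have el: "(\<lambda>(\<omega>, t). elementary_process n \<sigma> x t \<omega>) \<in> borel_measurable Q"
    "\<And>t. t \<in> {0..T} \<Longrightarrow> elementary_integral W n \<sigma> x t \<in> borel_measurable M"
    if "elementary_data M F T n \<sigma> x" for n \<sigma> and x :: "nat \<Rightarrow> 'w \<Rightarrow> real ^ 'm ^ 'n"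
  proof -
    note d0 = elementary_difference[OF that z0]
    show "(\<lambda>(\<omega>, t). elementary_process n \<sigma> x t \<omega>) \<in> borel_measurable Q"
      using simple_process_measurable[OF d0(1)] unfolding d0(2) by (simp add: elementary_process_def)
    show "\<And>t. t \<in> {0..T} \<Longrightarrow> elementary_integral W n \<sigma> x t \<in> borel_measurable M"
      using simple_integral_measurable[OF d0(1)] unfolding d0(3)[abs_def]
      by (simp add: elementary_integral_def[abs_def])
  qed
  have Jm: "J t \<in> borel_measurable M" "J' t \<in> borel_measurable M" if "t \<in> {0..T}" for t
  proof -
    have "J t \<in> borel_measurable (F t)" "J' t \<in> borel_measurable (F t)"
      using J that unfolding has_ito_integral_def adapted_def by blast+
    then show "J t \<in> borel_measurable M" "J' t \<in> borel_measurable M"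
      using that F_measurable_M[of _ t borel] by simp_all
  qed
  have Zm: "(\<lambda>(\<omega>, t). Z t \<omega>) \<in> borel_measurable Q" "(\<lambda>(\<omega>, t). Z' t \<omega>) \<in> borel_measurable Q"
    using Z T by (auto intro!: progressive_swap simp: space_H2_def)
  have iter: "(\<integral>\<^sup>+x. ennreal ((norm ((\<lambda>(\<omega>, t). H t \<omega>) x - (\<lambda>(\<omega>, t). H' t \<omega>) x))\<^sup>2) \<partial>Q) =
      (\<integral>\<^sup>+\<omega>. \<integral>\<^sup>+t. ennreal ((norm (H t \<omega> - H' t \<omega>))\<^sup>2) \<partial>time_measure T \<partial>M)"
    if [measurable]: "(\<lambda>(\<omega>, t). H t \<omega>) \<in> borel_measurable Q" "(\<lambda>(\<omega>, t). H' t \<omega>) \<in> borel_measurable Q"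
    for H H' :: "real \<Rightarrow> 'w \<Rightarrow> real ^ 'm ^ 'n"
    by (subst M2.nn_integral_fst[symmetric]) auto
  let ?D = "\<lambda>\<omega> t. Z t \<omega> - Z' t \<omega>"
  have process_lim: "(\<lambda>k. \<integral>\<^sup>+x. ennreal ((norm ((\<lambda>(\<omega>, t). simple_process (I k) (a k) (b k) (z k) t \<omega>) x -
      (\<lambda>(\<omega>, t). Z t \<omega> - Z' t \<omega>) x))\<^sup>2) \<partial>Q) \<longlonglongrightarrow> 0"
  proof -
    have "(\<lambda>k. \<integral>\<^sup>+x. ennreal ((norm (((\<lambda>(\<omega>, t). elementary_process (N k) (\<tau> k) (\<zeta> k) t \<omega>) x -
        (\<lambda>(\<omega>, t). elementary_process (N' k) (\<tau>' k) (\<zeta>' k) t \<omega>) x) -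
        ((\<lambda>(\<omega>, t). Z t \<omega>) x - (\<lambda>(\<omega>, t). Z' t \<omega>) x)))\<^sup>2) \<partial>Q) \<longlonglongrightarrow> 0"
      by (rule mean_square_diff_tendsto[OF Zm(1) el(1)[OF e(1)] Zm(2) el(1)[OF e'(1)]])
        (unfold iter[OF el(1)[OF e(1)] Zm(1)] iter[OF el(1)[OF e'(1)] Zm(2)], (rule e(2) e'(2))+)
    then show ?thesis unfolding case_prod_beta' sp .
  qed
  have D_m: "(\<lambda>(\<omega>, t). Z t \<omega> - Z' t \<omega>) \<in> borel_measurable Q"
    using borel_measurable_diff[OF Zm] by (simp add: case_prod_beta')
  have D_fin: "(\<integral>\<^sup>+x. ennreal ((norm ((\<lambda>(\<omega>, t). Z t \<omega> - Z' t \<omega>) x))\<^sup>2) \<partial>Q) < \<infinity>"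
    using nn_square_diff_finite[OF Zm H2_finite[OF Z(1) T] H2_finite[OF Z(2) T]]
    by (simp add: case_prod_beta')
  define dI where "dI k \<omega> = simple_integral (I k) (a k) (b k) (z k) u \<omega> - simple_integral (I k) (a k) (b k) (z k) s \<omega>" for k \<omega>
  have dI_m: "dI k \<in> borel_measurable M" for k
    unfolding dI_def[abs_def] by (intro borel_measurable_diff simple_integral_measurable sd st)
  have dJ_m: "dJ \<in> borel_measurable M" unfolding dJ_def by (intro borel_measurable_diff Jm st)
  have integral_lim: "(\<lambda>k. \<integral>\<^sup>+\<omega>. ennreal ((norm (dI k \<omega> - dJ \<omega>))\<^sup>2) \<partial>M) \<longlonglongrightarrow> 0"
  proof -
    have "(\<lambda>k. \<integral>\<^sup>+\<omega>. ennreal ((norm ((elementary_integral W (N k) (\<tau> k) (\<zeta> k) t \<omega> -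
        elementary_integral W (N' k) (\<tau>' k) (\<zeta>' k) t \<omega>) - (J t \<omega> - J' t \<omega>)))\<^sup>2) \<partial>M) \<longlonglongrightarrow> 0"
      if "t \<in> {0..T}" for t
      by (rule mean_square_diff_tendsto[OF Jm(1)[OF that] el(2)[OF e(1) that] Jm(2)[OF that]
            el(2)[OF e'(1) that] e(3)[OF that] e'(3)[OF that]])
    then have l: "(\<lambda>k. \<integral>\<^sup>+\<omega>. ennreal ((norm (simple_integral (I k) (a k) (b k) (z k) t \<omega> - (J t \<omega> - J' t \<omega>)))\<^sup>2) \<partial>M) \<longlonglongrightarrow> 0"
      if "t \<in> {0..T}" for t
      using that by (simp add: si)
    show ?thesis unfolding dI_def dJ_def
      by (rule mean_square_diff_tendsto[OF _ _ _ _ l[OF st(2)] l[OF st(1)]])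
        (intro borel_measurable_diff Jm simple_integral_measurable sd st)+
  qed
  have dI_fin: "(\<integral>\<^sup>+\<omega>. ennreal ((norm (dI k \<omega>))\<^sup>2) \<partial>M) < \<infinity>" for k
  proof -
    have "integrable M (\<lambda>\<omega>. 1 * (norm (dI k \<omega>))\<^sup>2)"
      using simple_isometry[OF sd su, of "\<lambda>_. 1" 1] unfolding dI_def[symmetric]
      by (simp add: has_bochner_integral_iff)
    then show ?thesis by (simp add: integrable_iff_bounded)
  qed
  \<comment> \<open>\<open>has_ito_integral\<close> does not state that J is square integrable; this
    follows from one approximation at finite distance.\<close>
  have dJ_fin: "(\<integral>\<^sup>+\<omega>. ennreal ((norm (dJ \<omega>))\<^sup>2) \<partial>M) < \<infinity>"
  proof -
    from order_tendstoD(2)[OF integral_lim, of 1]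
    obtain k where k: "(\<integral>\<^sup>+\<omega>. ennreal ((norm (dI k \<omega> - dJ \<omega>))\<^sup>2) \<partial>M) < 1"
      by (auto simp: eventually_sequentially)
    have "(\<integral>\<^sup>+\<omega>. ennreal ((norm (dI k \<omega> - (dI k \<omega> - dJ \<omega>)))\<^sup>2) \<partial>M) < \<infinity>"
      by (rule nn_square_diff_finite)
        (use dI_m dJ_m dI_fin order_less_trans[OF k] in \<open>auto intro!: borel_measurable_diff\<close>)
    then show ?thesis by simp
  qed
  show "has_bochner_integral M (\<lambda>\<omega>. g \<omega> \<bullet> dJ \<omega>) 0"
    if g: "g \<in> borel_measurable (F s)" "AE \<omega> in M. norm (g \<omega>) \<le> G" "0 \<le> G" for g G
  proof -
    have gM: "g \<in> borel_measurable M" using su by (intro F_measurable_M[OF g(1)]) auto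
    note lim = weighted_inner_tendsto[OF dJ_m dI_m dJ_fin integral_lim gM g(2,3)]
    have "(\<integral>\<omega>. g \<omega> \<bullet> dI k \<omega> \<partial>M) = 0" for k
      using simple_martingale[OF sd su g(1,2)] unfolding dI_def
      by (rule has_bochner_integral_integral_eq)
    then have "(\<integral>\<omega>. g \<omega> \<bullet> dJ \<omega> \<partial>M) = 0" using lim(1) by (simp add: LIMSEQ_const_iff)
    then show ?thesis using lim(2) by (simp add: has_bochner_integral_iff)
  qed
  show "integrable M (\<lambda>\<omega>. g \<omega> * (norm (dJ \<omega>))\<^sup>2) \<and>
      has_bochner_integral M (\<lambda>\<omega>. g \<omega> * (LINT t:{s<..u}|lborel. (norm (Z t \<omega> - Z' t \<omega>))\<^sup>2))
        (\<integral>\<omega>. g \<omega> * (norm (dJ \<omega>))\<^sup>2 \<partial>M)"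
    if g: "g \<in> borel_measurable (F s)" "AE \<omega> in M. \<bar>g \<omega>\<bar> \<le> G" "0 \<le> G" for g G
  proof
    have gM: "g \<in> borel_measurable M" using su by (intro F_measurable_M[OF g(1)]) auto
    show "integrable M (\<lambda>\<omega>. g \<omega> * (norm (dJ \<omega>))\<^sup>2)"
      by (intro integrable_weighted[OF gM g(2)] square_integrable_nn dJ_m dJ_fin)
    let ?w = "\<lambda>x. g (fst x) * indicator {s<..u} (snd x)"
    note win = window_integral_Q[OF su(1,3) D_m D_fin gM g(2)]
    have "(\<lambda>k. \<integral>x. ?w x * (norm ((\<lambda>(\<omega>, t). simple_process (I k) (a k) (b k) (z k) t \<omega>) x))\<^sup>2 \<partial>Q) \<longlonglongrightarrow>
        (\<integral>x. ?w x * (norm ((\<lambda>(\<omega>, t). Z t \<omega> - Z' t \<omega>) x))\<^sup>2 \<partial>Q)"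
      by (rule weighted_square_tendsto[OF D_m simple_process_measurable[OF sd] D_fin process_lim win(2,3)]) simp
    \<comment> \<open>One real sequence is read in two ways, on \<open>Q\<close> through the
      integrands and on M through the integrals; uniqueness of its limit yields the
      isometry.\<close>
    moreover have "(\<integral>x. ?w x * (norm ((\<lambda>(\<omega>, t). simple_process (I k) (a k) (b k) (z k) t \<omega>) x))\<^sup>2 \<partial>Q) =
        (\<integral>\<omega>. g \<omega> * (norm (dI k \<omega>))\<^sup>2 \<partial>M)" for k
      using has_bochner_integral_integral_eq[OF simple_isometry[OF sd su g(1,2)], of k]
        has_bochner_integral_integral_eq[OF window_integral_Q(1)[OF su(1,3)
          simple_process_measurable[OF sd] simple_process_finite[OF sd] gM g(2)], of k]
      unfolding dI_def by simp
    moreover have "(\<lambda>k. \<integral>\<omega>. g \<omega> * (norm (dI k \<omega>))\<^sup>2 \<partial>M) \<longlonglongrightarrow> (\<integral>\<omega>. g \<omega> * (norm (dJ \<omega>))\<^sup>2 \<partial>M)"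
      by (rule weighted_square_tendsto[OF dJ_m dI_m dJ_fin integral_lim gM g(2,3)])
    ultimately have "(\<integral>x. ?w x * (norm ((\<lambda>(\<omega>, t). Z t \<omega> - Z' t \<omega>) x))\<^sup>2 \<partial>Q) = (\<integral>\<omega>. g \<omega> * (norm (dJ \<omega>))\<^sup>2 \<partial>M)"
      by (simp add: LIMSEQ_unique)
    then show "has_bochner_integral M (\<lambda>\<omega>. g \<omega> * (LINT t:{s<..u}|lborel. (norm (Z t \<omega> - Z' t \<omega>))\<^sup>2))
        (\<integral>\<omega>. g \<omega> * (norm (dJ \<omega>))\<^sup>2 \<partial>M)"
      using win(1) by simp
  qed
qed

end

section \<open>The discrete energy estimate along a path\<close>

text \<open>Two solutions at one fixed outcome, as purely deterministic data: j,
  \<open>\<delta>\<close> and zd stand for the differences of the Ito integrals, of the drifts and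
  of the Z components. No expectation enters until the estimate along a path is complete.\<close>

locale reflected_pair =
  fixes T R0 C Cd Kfy Kfz :: real and \<phi> :: "real ^ 'n \<Rightarrow> real"
    and y y' k k' j \<delta> :: "real \<Rightarrow> real ^ 'n" and zd :: "real \<Rightarrow> real ^ 'm ^ 'n"
  assumes T_pos: "0 < T"
    and sphere: "exterior_sphere_constant \<phi> R0" and smooth: "smoothness_cond \<phi>"
    and y_cont: "continuous_on {0..T} y" "continuous_on {0..T} y'"
    and y_in: "\<And>t. t \<in> {0..T} \<Longrightarrow> y t \<in> closure (sublevel \<phi>)"
      "\<And>t. t \<in> {0..T} \<Longrightarrow> y' t \<in> closure (sublevel \<phi>)"
    and k_rc: "\<And>t. t \<in> {0..<T} \<Longrightarrow> continuous (at_right t) k"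
      "\<And>t. t \<in> {0..<T} \<Longrightarrow> continuous (at_right t) k'"
    and k_fin: "var_on k 0 T < \<infinity>" "var_on k' 0 T < \<infinity>"
    and k_eq: "\<And>t. t \<in> {0..T} \<Longrightarrow> k t = (LINT s:{0<..t}|variation_measure T k. normal_field \<phi> (y s))"
      "\<And>t. t \<in> {0..T} \<Longrightarrow> k' t = (LINT s:{0<..t}|variation_measure T k'. normal_field \<phi> (y' s))"
    and j_cont: "continuous_on {0..T} j"
    and Kf_nonneg: "0 \<le> Kfy" "0 \<le> Kfz"
    and \<delta>_int: "set_integrable lborel {0..T} \<delta>"
    and \<delta>_lip: "\<And>t. t \<in> {0..T} \<Longrightarrow> norm (\<delta> t) \<le> Kfy * norm (y t - y' t) + Kfz * norm (zd t)"
    and \<delta>_bound: "\<And>t. t \<in> {0..T} \<Longrightarrow> norm (\<delta> t) \<le> Cd"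
    and zd_int: "set_integrable lborel {0..T} (\<lambda>t. (norm (zd t))\<^sup>2)"
    and eq: "\<And>s u. 0 \<le> s \<Longrightarrow> s \<le> u \<Longrightarrow> u \<le> T \<Longrightarrow> (y u - y' u) - (y s - y' s) =
      ((k u - k s) - (k' u - k' s)) + (j u - j s) - (LINT r:{s<..u}|lborel. \<delta> r)"
    and x_bound: "\<And>t. t \<in> {0..T} \<Longrightarrow> norm (y t - y' t) \<le> C"
    and terminal: "y T = y' T"
begin

definition x :: "real \<Rightarrow> real ^ 'n" where "x t = y t - y' t"

definition vv :: "real \<Rightarrow> real \<Rightarrow> real" where
  "vv s u = enn2real (var_on k s u) + enn2real (var_on k' s u)"

definition S :: "real \<Rightarrow> real \<Rightarrow> real" where
  "S s u = (LINT r:{s<..u}|lborel. (norm (zd r))\<^sup>2)"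

text \<open>The first summand comes from the Lipschitz bound in y, the second from Young's
  inequality for the term in z, tuned so that half of the squared norm of zd is spent.\<close>

definition \<alpha> :: real where "\<alpha> = 2 * Kfy + 2 * Kfz\<^sup>2"

lemma R0_pos: "0 < R0"
  using sphere by (simp add: exterior_sphere_constant_def)

lemma \<alpha>_nonneg: "0 \<le> \<alpha>"
  using Kf_nonneg by (simp add: \<alpha>_def)

lemma C_nonneg: "0 \<le> C"
  using order_trans[OF norm_ge_zero x_bound[of 0]] T_pos by simp

lemma Cd_nonneg: "0 \<le> Cd"
  using order_trans[OF norm_ge_zero \<delta>_bound[of 0]] T_pos by simp

lemma vv_nonneg: "0 \<le> vv s u"
  by (simp add: vv_def)

lemma vv_fin:
  assumes "0 \<le> s" "u \<le> T"
  shows "var_on k s u < \<infinity>" "var_on k' s u < \<infinity>"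
  using var_on_mono[OF assms, of k] var_on_mono[OF assms, of k'] k_fin by order+

lemma vv_add:
  assumes "0 \<le> a" "a \<le> b" "b \<le> c" "c \<le> T"
  shows "vv a c = vv a b + vv b c"
  using var_on_add[of a b c k] var_on_add[of a b c k'] assms vv_fin[of a b] vv_fin[of b c]
  by (simp add: vv_def enn2real_plus)

lemma norm_increment_le_vv:
  assumes "0 \<le> s" "s \<le> u" "u \<le> T"
  shows "norm (k u - k s) + norm (k' u - k' s) \<le> vv s u"
  unfolding vv_def using assms by (intro add_mono norm_diff_le_var_on vv_fin)

lemma set_integrable_sub:
  fixes h :: "real \<Rightarrow> 'c::{banach, second_countable_topology}"
  assumes "set_integrable lborel {0..T} h" "0 \<le> s" "u \<le> T"
  shows "set_integrable lborel {s<..u} h"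
  by (rule set_integrable_subset[OF assms(1)]) (use assms in auto)

lemma drift_norm_le:
  assumes "0 \<le> s" "s \<le> u" "u \<le> T"
  shows "norm (LINT r:{s<..u}|lborel. \<delta> r) \<le> Cd * (u - s)"
proof -
  have "norm (LINT r:{s<..u}|lborel. \<delta> r) \<le> (LINT r:{s<..u}|lborel. norm (\<delta> r))"
    by (rule set_integral_norm_bound) (rule set_integrable_sub[OF \<delta>_int assms(1,3)])
  also have "\<dots> \<le> (LINT r:{s<..u}|lborel. Cd)"
    using assms
    by (intro set_integral_mono set_integrable_norm set_integrable_sub[OF \<delta>_int] \<delta>_bound)
      (auto simp: set_integrable_def)
  also have "\<dots> = Cd * (u - s)" using assms by (simp add: set_lebesgue_integral_def)
  finally show ?thesis .
qed

lemma drift_inner_le: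
  assumes "0 \<le> s" "s \<le> u" "u \<le> T" and osc: "\<And>r. r \<in> {s..u} \<Longrightarrow> norm (x r - x s) \<le> e"
  shows "2 * (x s \<bullet> (LINT r:{s<..u}|lborel. \<delta> r)) \<le>
    (\<alpha> * (norm (x s))\<^sup>2 + 2 * Kfy * C * e) * (u - s) + S s u / 2"
proof -
  have e: "0 \<le> e" using osc[of s] assms by simp
  let ?c = "\<alpha> * (norm (x s))\<^sup>2 + 2 * Kfy * C * e"
  have int0: "set_integrable lborel {s<..u} (\<lambda>r. x s \<bullet> \<delta> r)"
    using set_integrable_sub[OF \<delta>_int assms(1,3)]
    by (simp add: set_integrable_def flip: inner_scaleR_right)
  then have int: "set_integrable lborel {s<..u} (\<lambda>r. 2 * (x s \<bullet> \<delta> r))"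
    by (intro set_integrable_mult_right) simp
  have z: "set_integrable lborel {s<..u} (\<lambda>r. (norm (zd r))\<^sup>2 / 2)"
    using set_integrable_sub[OF zd_int assms(1,3)] by (intro set_integrable_divide) simp_all
  have c: "set_integrable lborel {s<..u} (\<lambda>r. ?c)" using assms by (simp add: set_integrable_def)
  have "(LINT r:{s<..u}|lborel. x s \<bullet> \<delta> r) = x s \<bullet> (LINT r:{s<..u}|lborel. \<delta> r)"
    using set_integrable_sub[OF \<delta>_int assms(1,3)]
    by (simp add: set_lebesgue_integral_def set_integrable_def flip: inner_scaleR_right)
  then have "2 * (x s \<bullet> (LINT r:{s<..u}|lborel. \<delta> r)) = (LINT r:{s<..u}|lborel. 2 * (x s \<bullet> \<delta> r))"
    by simp
  also have "\<dots> \<le> (LINT r:{s<..u}|lborel. ?c + (norm (zd r))\<^sup>2 / 2)"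
  proof (rule set_integral_mono[OF int set_integral_add(1)[OF c z]])
    fix r assume r: "r \<in> {s<..u}"
    then have rT: "r \<in> {0..T}" "r \<in> {s..u}" using assms by auto
    have xs: "norm (x s) \<le> C" using x_bound[of s] assms by (simp add: x_def)
    have xr: "norm (x r) \<le> norm (x s) + e"
      using norm_triangle_ineq[of "x s" "x r - x s"] osc[OF rT(2)] by simp
    have "2 * (x s \<bullet> \<delta> r) \<le> 2 * (norm (x s) * norm (\<delta> r))"
      using norm_cauchy_schwarz[of "x s" "\<delta> r"] by simp
    also have "\<dots> \<le> 2 * (norm (x s) * (Kfy * (norm (x s) + e) + Kfz * norm (zd r)))"
      using \<delta>_lip[OF rT(1)] mult_left_mono[OF xr Kf_nonneg(1)]
      by (intro mult_left_mono) (auto simp: x_def)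
    \<comment> \<open>The factor \<open>sqrt 2\<close> is distributed so that the cross term splits
      into \<open>2 * Kfz\<^sup>2\<close> times the square of x and exactly half the square of
      zd.\<close>
    also have "\<dots> = 2 * Kfy * (norm (x s))\<^sup>2 + 2 * Kfy * (norm (x s) * e) +
        2 * (sqrt 2 * Kfz * norm (x s)) * (norm (zd r) / sqrt 2)"
      by (simp add: power2_eq_square algebra_simps)
    also have "\<dots> \<le> 2 * Kfy * (norm (x s))\<^sup>2 + 2 * Kfy * (C * e) +
        ((sqrt 2 * Kfz * norm (x s))\<^sup>2 + (norm (zd r) / sqrt 2)\<^sup>2)"
      using Kf_nonneg e xs by (intro add_mono order_refl mult_left_mono mult_right_mono sum_squares_bound) auto
    also have "\<dots> = ?c + (norm (zd r))\<^sup>2 / 2"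
      by (simp add: \<alpha>_def power_mult_distrib power_divide algebra_simps)
    finally show "2 * (x s \<bullet> \<delta> r) \<le> ?c + (norm (zd r))\<^sup>2 / 2" .
  qed
  also have "\<dots> = ?c * (u - s) + S s u / 2"
    unfolding set_integral_add(2)[OF c z] S_def using assms(1-3)
    by (simp add: set_lebesgue_integral_def)
  finally show ?thesis .
qed

text \<open>The sphere condition is applied once for each solution. For k' the roles of y and y' are
  exchanged, so x s enters with the opposite sign, which matches the sign of k' in the difference.
  Twice the constant 1 / (2 R0) gives 1 / R0.\<close>

lemma reflection_inner_ge:
  assumes "0 \<le> s" "s \<le> u" "u \<le> T" and osc: "\<And>r. r \<in> {s..u} \<Longrightarrow> norm (x r - x s) \<le> e"
  shows "- ((norm (x s))\<^sup>2 / R0 + 2 * (C / R0 + 1) * e) * vv s u \<le> 2 * (x s \<bullet> ((k u - k s) - (k' u - k' s)))"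
proof -
  let ?c = "- ((norm (x s))\<^sup>2 / (2 * R0) + (C / R0 + 1) * e)"
  have xs: "norm (x s) \<le> C" using x_bound[of s] assms by (simp add: x_def)
  have "?c * enn2real (var_on k s u) \<le> x s \<bullet> (k u - k s)"
  proof (rule inner_increment_ge[OF assms(1-3) k_rc(1) k_fin(1) normal_field_measurable[OF smooth]
        normal_field_norm_le y_cont(1) k_eq(1)])
    fix r assume "r \<in> {s<..u}"
    then have "r \<in> {0..T}" "r \<in> {s..u}" using assms by auto
    then show "?c \<le> x s \<bullet> normal_field \<phi> (y r)"
      using osc[of r] x_bound[of r]
      by (intro exterior_sphere_inner_ge[OF sphere y_in(1) y_in(2) _ _ xs]) (auto simp: x_def)
  qed
  moreover have "?c * enn2real (var_on k' s u) \<le> (- x s) \<bullet> (k' u - k' s)"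
  proof (rule inner_increment_ge[OF assms(1-3) k_rc(2) k_fin(2) normal_field_measurable[OF smooth]
        normal_field_norm_le y_cont(2) k_eq(2)])
    fix r assume "r \<in> {s<..u}"
    then have r: "r \<in> {0..T}" "r \<in> {s..u}" using assms by auto
    have "(y' r - y r) - (- x s) = - (x r - x s)" by (simp add: x_def)
    then have "norm ((y' r - y r) - (- x s)) \<le> e"
      using osc[OF r(2)] by (simp only: norm_minus_cancel)
    moreover have "norm (y' r - y r) \<le> C" using x_bound[OF r(1)] by (simp add: norm_minus_commute)
    ultimately show "?c \<le> (- x s) \<bullet> normal_field \<phi> (y' r)"
      using exterior_sphere_inner_ge[OF sphere y_in(2)[OF r(1)] y_in(1)[OF r(1)], of "- x s" e C] xs by simp
  qed
  ultimately have "2 * (?c * vv s u) \<le> 2 * (x s \<bullet> ((k u - k s) - (k' u - k' s)))"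
    by (simp add: vv_def inner_diff_right distrib_left)
  moreover have "- ((norm (x s))\<^sup>2 / R0 + 2 * (C / R0 + 1) * e) = 2 * ?c"
    using R0_pos by (simp add: field_simps)
  ultimately show ?thesis by (simp only: mult.assoc)
qed

text \<open>In the expansion of the square the increment of j is kept exactly, the squared increment
  of reflection minus drift is dropped as nonnegative, and only the cross term of the two is
  estimated, by e' times a variation.\<close>

lemma square_increment_ge:
  assumes "0 \<le> s" "s \<le> u" "u \<le> T" and osc: "\<And>r. r \<in> {s..u} \<Longrightarrow> norm (x r - x s) \<le> e"
    and e': "norm (j u - j s) \<le> e'"
  shows "2 * (x s \<bullet> (j u - j s)) + (norm (j u - j s))\<^sup>2 - S s u / 2
      - ((norm (x s))\<^sup>2 / R0 + 2 * (C / R0 + 1) * e) * vv s u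
      - (\<alpha> * (norm (x s))\<^sup>2 + 2 * Kfy * C * e) * (u - s)
      - 2 * e' * (vv s u + Cd * (u - s)) \<le> (norm (x u))\<^sup>2 - (norm (x s))\<^sup>2"
proof -
  define A Fi Jd where "A = (k u - k s) - (k' u - k' s)" and "Fi = (LINT r:{s<..u}|lborel. \<delta> r)"
    and "Jd = j u - j s"
  have xu: "x u = x s + (A + Jd - Fi)"
    using eq[OF assms(1-3)] by (simp add: x_def A_def Fi_def Jd_def algebra_simps)
  have "(norm (x u))\<^sup>2 - (norm (x s))\<^sup>2 = 2 * (x s \<bullet> (A + Jd - Fi)) + (norm (Jd + (A - Fi)))\<^sup>2"
    unfolding xu by (simp add: power2_norm_eq_inner inner_add_left inner_add_right inner_diff_left
        inner_diff_right inner_commute algebra_simps)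
  moreover have "(norm (Jd + (A - Fi)))\<^sup>2 \<ge> (norm Jd)\<^sup>2 - 2 * e' * (vv s u + Cd * (u - s))"
  proof -
    have "norm (A - Fi) \<le> vv s u + Cd * (u - s)"
      using norm_triangle_ineq4[of A Fi] norm_triangle_ineq4[of "k u - k s" "k' u - k' s"]
        norm_increment_le_vv[OF assms(1-3)] drift_norm_le[OF assms(1-3)]
      by (simp add: A_def Fi_def)
    then have "norm Jd * norm (A - Fi) \<le> e' * (vv s u + Cd * (u - s))"
      using e' order_trans[OF norm_ge_zero e'] by (intro mult_mono) (auto simp: Jd_def)
    moreover have "- (norm Jd * norm (A - Fi)) \<le> Jd \<bullet> (A - Fi)"
      using Cauchy_Schwarz_ineq2[of Jd "A - Fi"] by (simp add: abs_le_iff)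
    moreover have "(norm (Jd + (A - Fi)))\<^sup>2 = (norm Jd)\<^sup>2 + 2 * (Jd \<bullet> (A - Fi)) + (norm (A - Fi))\<^sup>2"
      by (simp add: power2_norm_eq_inner inner_add_left inner_add_right inner_commute)
    ultimately show ?thesis using zero_le_power2[of "norm (A - Fi)"] by linarith
  qed
  moreover have "- ((norm (x s))\<^sup>2 / R0 + 2 * (C / R0 + 1) * e) * vv s u \<le> 2 * (x s \<bullet> A)"
    unfolding A_def by (rule reflection_inner_ge[OF assms(1-4)])
  moreover have "2 * (x s \<bullet> Fi) \<le> (\<alpha> * (norm (x s))\<^sup>2 + 2 * Kfy * C * e) * (u - s) + S s u / 2"
    unfolding Fi_def by (rule drift_inner_le[OF assms(1-4)])
  moreover have "2 * (x s \<bullet> (A + Jd - Fi)) = 2 * (x s \<bullet> A) + 2 * (x s \<bullet> Jd) - 2 * (x s \<bullet> Fi)"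
    by (simp add: inner_add_right inner_diff_right)
  ultimately show ?thesis unfolding Jd_def by linarith
qed

text \<open>\<open>c1\<close> and \<open>c2\<close> collect all coefficients of e times the time
  step and of e times the variation. In both, one part stems from \<open>square_increment_ge\<close>
  and one from exchanging the endpoints of the cell in the weighted step.\<close>

definition c1 :: real where "c1 = 2 * C * \<alpha> + 2 * Kfy * C"

definition c2 :: real where "c2 = 4 * C / R0 + 2"

lemma c_nonneg: "0 \<le> c1" "0 \<le> c2"
  using C_nonneg \<alpha>_nonneg Kf_nonneg R0_pos by (simp_all add: c1_def c2_def)

text \<open>The weight grows by at least the factor 1 + \<open>\<alpha>\<close> (u - s) + m / R0,
  which absorbs the two negative multiples of the square of x s. Since m may be smaller than the
  variation on the cell, the deficit \<open>vv s u - m\<close> remains as an error.\<close>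

lemma weighted_increment_ge:
  assumes "0 \<le> s" "s \<le> u" "u \<le> T" and osc: "\<And>r. r \<in> {s..u} \<Longrightarrow> norm (x r - x s) \<le> e"
    and e': "norm (j u - j s) \<le> e'" and m: "0 \<le> m" "m \<le> vv s u"
    and g: "0 \<le> g" "g * (1 + (\<alpha> * (u - s) + m / R0)) \<le> g'"
  shows "g * (2 * (x s \<bullet> (j u - j s)) + (norm (j u - j s))\<^sup>2 - S s u / 2)
      - g * (C\<^sup>2 / R0 * (vv s u - m) + e * (c1 * (u - s) + c2 * vv s u) + 2 * e' * (vv s u + Cd * (u - s)))
      \<le> g' * (norm (x u))\<^sup>2 - g * (norm (x s))\<^sup>2"
proof -
  let ?w = "vv s u" and ?h = "u - s" and ?p = "(norm (x s))\<^sup>2"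
  have e: "0 \<le> e" using osc[of s] assms(2) by simp
  have xs: "norm (x s) \<le> C" "norm (x u) \<le> C" using x_bound[of s] x_bound[of u] assms by (auto simp: x_def)
  have p: "?p \<le> C\<^sup>2" using xs by (intro power_mono) auto
  have "norm (x s) \<le> norm (x u) + e"
    using norm_triangle_ineq[of "x u" "x s - x u"] osc[of u] assms(2) by (simp add: norm_minus_commute)
  \<comment> \<open>The growth of the weight multiplies the square of x at the right endpoint, while
    the terms to be absorbed carry the left one; the exchange costs 2 C e.\<close>
  have "?p - (norm (x u))\<^sup>2 = (norm (x s) - norm (x u)) * (norm (x s) + norm (x u))"
    by (simp add: power2_eq_square algebra_simps)
  also have "\<dots> \<le> e * (norm (x s) + norm (x u))"
    using \<open>norm (x s) \<le> norm (x u) + e\<close> by (intro mult_right_mono) auto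
  also have "\<dots> \<le> e * (2 * C)" using xs e by (intro mult_left_mono) auto
  finally have px: "?p - 2 * C * e \<le> (norm (x u))\<^sup>2" by (simp add: ac_simps)
  have q: "0 \<le> \<alpha> * ?h + m / R0" using \<alpha>_nonneg assms R0_pos by simp
  have "g * (\<alpha> * ?h + m / R0) * (?p - 2 * C * e) \<le> g * (\<alpha> * ?h + m / R0) * (norm (x u))\<^sup>2"
    using px g q by (intro mult_left_mono) auto
  also have "\<dots> \<le> (g' - g) * (norm (x u))\<^sup>2"
    using g by (intro mult_right_mono) (auto simp: algebra_simps)
  finally have 1: "g * (\<alpha> * ?h + m / R0) * (?p - 2 * C * e) \<le> (g' - g) * (norm (x u))\<^sup>2" .
  note 2 = mult_left_mono[OF square_increment_ge[OF assms(1-3) osc e'] g(1)]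
  have 3: "C\<^sup>2 / R0 * (?w - m) \<ge> ?p / R0 * (?w - m)"
    using p m R0_pos by (intro mult_right_mono divide_right_mono) auto
  have 4: "(\<alpha> * ?h + m / R0) * (2 * C * e) \<le> (\<alpha> * ?h + ?w / R0) * (2 * C * e)"
    using m R0_pos C_nonneg e by (intro mult_right_mono add_left_mono divide_right_mono) auto
  have 5: "(?p / R0 + 2 * (C / R0 + 1) * e) * ?w + (\<alpha> * ?p + 2 * Kfy * C * e) * ?h - (\<alpha> * ?h + m / R0) * (?p - 2 * C * e)
      \<le> C\<^sup>2 / R0 * (?w - m) + e * (c1 * ?h + c2 * ?w)"
  proof -
    have "(?p / R0 + 2 * (C / R0 + 1) * e) * ?w + (\<alpha> * ?p + 2 * Kfy * C * e) * ?h - (\<alpha> * ?h + m / R0) * (?p - 2 * C * e)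
      = ?p / R0 * (?w - m) + (\<alpha> * ?h + m / R0) * (2 * C * e) + 2 * (C / R0 + 1) * e * ?w + 2 * Kfy * C * e * ?h"
      by (simp add: algebra_simps diff_divide_distrib)
    also have "\<dots> \<le> C\<^sup>2 / R0 * (?w - m) + (\<alpha> * ?h + ?w / R0) * (2 * C * e) + 2 * (C / R0 + 1) * e * ?w + 2 * Kfy * C * e * ?h"
      using 3 4 by linarith
    also have "\<dots> = C\<^sup>2 / R0 * (?w - m) + e * (c1 * ?h + c2 * ?w)"
      by (simp add: c1_def c2_def algebra_simps)
    finally show ?thesis .
  qed
  note 6 = mult_left_mono[OF 5 g(1)]
  have "g' * (norm (x u))\<^sup>2 - g * ?p = (g' - g) * (norm (x u))\<^sup>2 + g * ((norm (x u))\<^sup>2 - ?p)"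
    by (simp add: algebra_simps)
  with 1 2 6 show ?thesis by (simp add: algebra_simps)
qed

section \<open>Summation over a grid from a starting time to the horizon\<close>

context
  fixes t0 assumes t0: "0 \<le> t0" "t0 < T"
begin

abbreviation tg :: "nat \<Rightarrow> nat \<Rightarrow> real" where "tg n i \<equiv> grid t0 T n i"

definition L :: "nat \<Rightarrow> nat \<Rightarrow> real" where
  "L n i = (\<Sum>l<i. norm (k (tg n (Suc l)) - k (tg n l)) + norm (k' (tg n (Suc l)) - k' (tg n l)))"

definition G :: "nat \<Rightarrow> real \<Rightarrow> nat \<Rightarrow> real" where
  "G n N i = exp (\<alpha> * (tg n i - t0) + min (L n i) N / R0)"

text \<open>D is a discrete energy balance. It exceeds zero by at most the errors of discretisation and by h,
  the error that comes from truncating the weight at N.\<close>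

definition D :: "nat \<Rightarrow> real \<Rightarrow> real" where
  "D n N = (\<Sum>i<Suc n. G n N i * (2 * (x (tg n i) \<bullet> (j (tg n (Suc i)) - j (tg n i))) +
      (norm (j (tg n (Suc i)) - j (tg n i)))\<^sup>2 - S (tg n i) (tg n (Suc i)) / 2)) + (norm (x t0))\<^sup>2"

text \<open>A bound for all weights \<open>G n N i\<close> that depends neither on the grid nor on
  the path nor on \<open>t0\<close>.\<close>

definition Gm :: "real \<Rightarrow> real" where
  "Gm N = exp (\<alpha> * T + N / R0)"

lemma tg_props:
  assumes "i < Suc n"
  shows "0 \<le> tg n i" "tg n i \<le> tg n (Suc i)" "tg n (Suc i) \<le> T" "t0 \<le> tg n i"
  using grid_in[of t0 T i n] grid_in[of t0 T "Suc i" n] grid_mono[of t0 T i "Suc i" n] t0 assms by auto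

lemma L_Suc: "L n (Suc i) = L n i + (norm (k (tg n (Suc i)) - k (tg n i)) + norm (k' (tg n (Suc i)) - k' (tg n i)))"
  by (simp add: L_def)

lemma sum_vv: "i \<le> Suc n \<Longrightarrow> (\<Sum>l<i. vv (tg n l) (tg n (Suc l))) = vv t0 (tg n i)"
proof (induction i)
  case (Suc i)
  then show ?case using tg_props[of i n] t0 vv_add[of t0 "tg n i" "tg n (Suc i)"] by simp
qed (simp add: vv_def)

lemma L_le: "L n (Suc n) \<le> vv t0 T"
proof -
  have "L n (Suc n) \<le> (\<Sum>l<Suc n. vv (tg n l) (tg n (Suc l)))"
    unfolding L_def by (intro sum_mono norm_increment_le_vv tg_props) auto
  also have "\<dots> = vv t0 T" using sum_vv[of "Suc n" n] by simp
  finally show ?thesis .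
qed

lemma G_le:
  assumes "i < Suc n"
  shows "G n N i \<le> Gm N"
proof -
  have "\<alpha> * (tg n i - t0) \<le> \<alpha> * T"
    using tg_props[OF assms] t0 \<alpha>_nonneg by (intro mult_left_mono) auto
  then show ?thesis
    unfolding G_def Gm_def using R0_pos by (auto intro!: add_mono divide_right_mono)
qed

text \<open>The weighted squares telescope. The value at T vanishes because the terminal values
  agree, and the weight at t0 is 1, so the squared norm of x t0 is left. The parts m add up to the
  truncated discrete variation.\<close>

lemma grid_energy:
  assumes "0 \<le> N"
    and osc: "\<And>i r. i < Suc n \<Longrightarrow> r \<in> {tg n i..tg n (Suc i)} \<Longrightarrow> norm (x r - x (tg n i)) \<le> e"
    and e': "\<And>i. i < Suc n \<Longrightarrow> norm (j (tg n (Suc i)) - j (tg n i)) \<le> e'"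
  shows "D n N \<le> Gm N * (C\<^sup>2 / R0 * (vv t0 T - min (L n (Suc n)) N) +
    e * (c1 * T + c2 * vv t0 T) + 2 * e' * (vv t0 T + Cd * T))"
proof -
  have e0: "0 \<le> e" using osc[of 0 t0] grid_mono[of t0 T 0 1 n] t0 by simp
  have e'0: "0 \<le> e'" using order_trans[OF norm_ge_zero e'[of 0]] by simp
  \<comment> \<open>The increment of the truncated discrete variation. Truncation is monotone and
    does not enlarge increments, hence m lies between 0 and the variation on the cell.\<close>
  define m where "m i = min (L n (Suc i)) N - min (L n i) N" for i
  define E where "E i = C\<^sup>2 / R0 * (vv (tg n i) (tg n (Suc i)) - m i) +
      e * (c1 * (tg n (Suc i) - tg n i) + c2 * vv (tg n i) (tg n (Suc i))) +
      2 * e' * (vv (tg n i) (tg n (Suc i)) + Cd * (tg n (Suc i) - tg n i))" for i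
  define P where "P i = 2 * (x (tg n i) \<bullet> (j (tg n (Suc i)) - j (tg n i))) +
      (norm (j (tg n (Suc i)) - j (tg n i)))\<^sup>2 - S (tg n i) (tg n (Suc i)) / 2" for i
  have m: "0 \<le> m i" "m i \<le> vv (tg n i) (tg n (Suc i))" if "i < Suc n" for i
  proof -
    have *: "0 \<le> min (l + q) N - min l N \<and> min (l + q) N - min l N \<le> w" if "0 \<le> q" "q \<le> w" for l q w :: real
      using that by (auto simp: min_def)
    have "0 \<le> norm (k (tg n (Suc i)) - k (tg n i)) + norm (k' (tg n (Suc i)) - k' (tg n i))" by simp
    from *[OF this norm_increment_le_vv[OF tg_props(1-3)[OF that]], of "L n i"]
    show "0 \<le> m i" "m i \<le> vv (tg n i) (tg n (Suc i))" unfolding m_def L_Suc by blast+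
  qed
  have E0: "0 \<le> E i" if "i < Suc n" for i
    unfolding E_def using m[OF that] tg_props[OF that] e0 e'0 c_nonneg R0_pos vv_nonneg Cd_nonneg
    by (intro add_nonneg_nonneg mult_nonneg_nonneg) auto
  have step: "G n N i * P i - G n N i * E i \<le>
      G n N (Suc i) * (norm (x (tg n (Suc i))))\<^sup>2 - G n N i * (norm (x (tg n i)))\<^sup>2" if "i < Suc n" for i
    unfolding P_def E_def
  proof (rule weighted_increment_ge[OF tg_props(1-3)[OF that] osc[OF that] e'[OF that] m[OF that]])
    show "0 \<le> G n N i" by (simp add: G_def)
    have "G n N (Suc i) = G n N i * exp (\<alpha> * (tg n (Suc i) - tg n i) + m i / R0)"
      unfolding G_def m_def exp_add[symmetric] by (simp add: diff_divide_distrib algebra_simps)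
    then show "G n N i * (1 + (\<alpha> * (tg n (Suc i) - tg n i) + m i / R0)) \<le> G n N (Suc i)"
      using exp_ge_add_one_self[of "\<alpha> * (tg n (Suc i) - tg n i) + m i / R0"]
      by (simp add: G_def)
  qed
  have "(\<Sum>i<Suc n. G n N i * P i) - (\<Sum>i<Suc n. G n N i * E i) \<le>
      (\<Sum>i<Suc n. G n N (Suc i) * (norm (x (tg n (Suc i))))\<^sup>2 - G n N i * (norm (x (tg n i)))\<^sup>2)"
    unfolding sum_subtractf[symmetric] by (intro sum_mono step) auto
  also have "\<dots> = G n N (Suc n) * (norm (x (tg n (Suc n))))\<^sup>2 - G n N 0 * (norm (x (tg n 0)))\<^sup>2"
    by (rule sum_lessThan_telescope)
  also have "\<dots> = - (norm (x t0))\<^sup>2"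
    using assms(1) terminal by (simp add: G_def L_def x_def)
  finally have "D n N \<le> (\<Sum>i<Suc n. G n N i * E i)"
    unfolding D_def P_def by simp
  also have "\<dots> \<le> (\<Sum>i<Suc n. Gm N * E i)"
    by (intro sum_mono mult_right_mono G_le E0) auto
  also have "\<dots> = Gm N * (\<Sum>i<Suc n. E i)" by (simp only: sum_distrib_left)
  also have "(\<Sum>i<Suc n. E i) = C\<^sup>2 / R0 * (vv t0 T - min (L n (Suc n)) N) +
    e * (c1 * (T - t0) + c2 * vv t0 T) + 2 * e' * (vv t0 T + Cd * (T - t0))"
  proof -
    have v: "(\<Sum>i<Suc n. vv (tg n i) (tg n (Suc i))) = vv t0 T" using sum_vv[of "Suc n" n] by simp
    have h: "(\<Sum>i<Suc n. tg n (Suc i) - tg n i) = T - t0"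
      using sum_lessThan_telescope[of "tg n" "Suc n"] by simp
    have mm: "(\<Sum>i<Suc n. m i) = min (L n (Suc n)) N"
      using sum_lessThan_telescope[of "\<lambda>i. min (L n i) N" "Suc n"] assms(1) by (simp add: m_def L_def)
    show ?thesis
      unfolding E_def by (simp only: sum.distrib sum_subtractf[symmetric] sum_distrib_left[symmetric] v h
          sum_subtractf[of "\<lambda>i. vv (tg n i) (tg n (Suc i))" m] mm)
  qed
  also have "Gm N * (C\<^sup>2 / R0 * (vv t0 T - min (L n (Suc n)) N) +
    e * (c1 * (T - t0) + c2 * vv t0 T) + 2 * e' * (vv t0 T + Cd * (T - t0))) \<le>
    Gm N * (C\<^sup>2 / R0 * (vv t0 T - min (L n (Suc n)) N) +
    e * (c1 * T + c2 * vv t0 T) + 2 * e' * (vv t0 T + Cd * T))"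
    using t0 c_nonneg Cd_nonneg e0 e'0
    by (intro mult_left_mono add_mono order_refl) (auto simp: Gm_def)
  finally show ?thesis .
qed

text \<open>The cost of truncation: where the discrete variation exceeds N the weight has stopped
  growing. Taking the variation from 0 makes the term the same for every t0.\<close>

definition h :: "real \<Rightarrow> real" where
  "h N = Gm N * (C\<^sup>2 / R0) * max (vv 0 T - N) 0"

lemma vv_t0_le: "vv t0 T \<le> vv 0 T"
  using vv_add[of 0 t0 T] t0 vv_nonneg[of 0 t0] by simp

lemma grid_energy':
  assumes "0 \<le> N"
    and "\<And>i r. i < Suc n \<Longrightarrow> r \<in> {tg n i..tg n (Suc i)} \<Longrightarrow> norm (x r - x (tg n i)) \<le> e"
    and "\<And>i. i < Suc n \<Longrightarrow> norm (j (tg n (Suc i)) - j (tg n i)) \<le> e'"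
  shows "D n N - h N \<le> Gm N * (C\<^sup>2 / R0 * (vv t0 T - L n (Suc n)) +
    e * (c1 * T + c2 * vv 0 T) + 2 * e' * (vv 0 T + Cd * T))"
proof -
  have e0: "0 \<le> e" using assms(2)[of 0 t0] grid_mono[of t0 T 0 1 n] t0 by simp
  have e'0: "0 \<le> e'" using order_trans[OF norm_ge_zero assms(3)[of 0]] by simp
  have q: "0 \<le> C\<^sup>2 / R0" using R0_pos by simp
  \<comment> \<open>Here the deficit is separated into a part that vanishes as the grid is refined
    and a part that depends on N alone.\<close>
  have "vv t0 T - min (L n (Suc n)) N \<le> (vv t0 T - L n (Suc n)) + max (vv 0 T - N) 0"
    using L_le[of n] vv_t0_le by (auto simp: min_def max_def)
  note 1 = mult_left_mono[OF this q]
  have 2: "e * (c1 * T + c2 * vv t0 T) \<le> e * (c1 * T + c2 * vv 0 T)"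
    using e0 c_nonneg vv_t0_le by (intro mult_left_mono add_left_mono) auto
  have 3: "2 * e' * (vv t0 T + Cd * T) \<le> 2 * e' * (vv 0 T + Cd * T)"
    using e'0 vv_t0_le by (intro mult_left_mono add_right_mono) auto
  have "Gm N * (C\<^sup>2 / R0 * (vv t0 T - min (L n (Suc n)) N) +
      e * (c1 * T + c2 * vv t0 T) + 2 * e' * (vv t0 T + Cd * T)) \<le>
    Gm N * (C\<^sup>2 / R0 * ((vv t0 T - L n (Suc n)) + max (vv 0 T - N) 0) +
      e * (c1 * T + c2 * vv 0 T) + 2 * e' * (vv 0 T + Cd * T))"
    by (intro mult_left_mono add_mono[OF add_mono[OF 1 2] 3]) (simp add: Gm_def)
  also have "\<dots> = Gm N * (C\<^sup>2 / R0 * (vv t0 T - L n (Suc n)) +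
    e * (c1 * T + c2 * vv 0 T) + 2 * e' * (vv 0 T + Cd * T)) + h N"
    by (simp add: h_def algebra_simps)
  finally show ?thesis using grid_energy[OF assms] by linarith
qed

lemma increments_small:
  fixes f :: "real \<Rightarrow> real ^ 'n"
  assumes "continuous_on {0..T} f" "0 < r"
  shows "\<forall>\<^sub>F n in sequentially. \<forall>i<Suc n. \<forall>s\<in>{tg n i..tg n (Suc i)}. norm (f s - f (tg n i)) \<le> r"
proof -
  have "uniformly_continuous_on {0..T} f"
    using assms(1) by (rule compact_uniformly_continuous) simp
  then obtain d where d: "d > 0" "\<And>s s'. s \<in> {0..T} \<Longrightarrow> s' \<in> {0..T} \<Longrightarrow> dist s' s < d \<Longrightarrow> dist (f s') (f s) < r"
    unfolding uniformly_continuous_on_def using assms(2) by metis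
  have "(\<lambda>n. (T - t0) / real (Suc n)) \<longlonglongrightarrow> 0"
    by (intro LIMSEQ_Suc[of "\<lambda>n. (T - t0) / real n"] lim_const_over_n)
  from order_tendstoD(2)[OF this d(1)] show ?thesis
  proof eventually_elim
    case (elim n)
    show ?case
    proof (intro allI impI ballI)
      fix i s assume i: "i < Suc n" and s: "s \<in> {tg n i..tg n (Suc i)}"
      then have "dist s (tg n i) < d"
        using elim grid_diff[of t0 T n i] by (auto simp: dist_real_def)
      then have "dist (f s) (f (tg n i)) < r"
        using s tg_props[OF i] by (intro d(2)) auto
      then show "norm (f s - f (tg n i)) \<le> r" by (simp add: dist_norm)
    qed
  qed
qed

lemma L_tendsto: "(\<lambda>n. L n (Suc n)) \<longlonglongrightarrow> vv t0 T"
  unfolding L_def vv_def sum.distrib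
  using t0 by (intro tendsto_add grid_sum_tendsto_var_on vv_fin k_rc) auto

text \<open>Oscillations of x and increments of j on the cells vanish by uniform continuity, and the
  discrete variation converges. The estimate bounds D from above only, hence the positive
  part.\<close>

lemma energy_tendsto:
  assumes "0 \<le> N"
  shows "(\<lambda>n. max (D n N - h N) 0) \<longlonglongrightarrow> 0"
proof (rule order_tendstoI)
  fix a :: real assume "a < 0"
  then show "\<forall>\<^sub>F n in sequentially. a < max (D n N - h N) 0" by (simp add: less_max_iff_disj)
next
  fix a :: real assume a: "0 < a"
  define M where "M = Gm N * (c1 * T + c2 * vv 0 T) + 2 * Gm N * (vv 0 T + Cd * T)"
  have "0 \<le> M" unfolding M_def Gm_def using c_nonneg vv_nonneg Cd_nonneg T_pos
    by (intro add_nonneg_nonneg mult_nonneg_nonneg) auto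
  \<comment> \<open>M gathers everything that multiplies the oscillation bound r; dividing by M + 1
    avoids the case M = 0.\<close>
  define r where "r = a / (2 * (M + 1))"
  have r: "0 < r" "r * M < a / 2"
    using a \<open>0 \<le> M\<close> by (auto simp: r_def field_simps intro: add_strict_increasing)
  have x_cont: "continuous_on {0..T} x" unfolding x_def by (intro continuous_intros y_cont)
  have "(\<lambda>n. Gm N * (C\<^sup>2 / R0 * (vv t0 T - L n (Suc n)))) \<longlonglongrightarrow> Gm N * (C\<^sup>2 / R0 * (vv t0 T - vv t0 T))"
    by (intro tendsto_intros L_tendsto)
  then have "(\<lambda>n. Gm N * (C\<^sup>2 / R0 * (vv t0 T - L n (Suc n)))) \<longlonglongrightarrow> 0" by simp
  then have "\<forall>\<^sub>F n in sequentially. Gm N * (C\<^sup>2 / R0 * (vv t0 T - L n (Suc n))) < a / 2"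
    using a by (intro order_tendstoD(2)) auto
  with increments_small[OF x_cont r(1)] increments_small[OF j_cont r(1)]
  show "\<forall>\<^sub>F n in sequentially. max (D n N - h N) 0 < a"
  proof eventually_elim
    case (elim n)
    have "D n N - h N \<le> Gm N * (C\<^sup>2 / R0 * (vv t0 T - L n (Suc n)) +
        r * (c1 * T + c2 * vv 0 T) + 2 * r * (vv 0 T + Cd * T))"
      using elim(1,2) tg_props by (intro grid_energy' assms) auto
    also have "\<dots> = Gm N * (C\<^sup>2 / R0 * (vv t0 T - L n (Suc n))) + r * M"
      by (simp add: M_def algebra_simps)
    also have "\<dots> < a" using elim(3) r(2) by linarith
    finally show ?case using a by simp
  qed
qed

text \<open>The same estimate with crude oscillations, uniformly in the grid. No bound on j is
  assumed, so its increments are bounded through the equation by those of x, of the reflection terms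
  and of the drift. This makes the bound quadratic in the total variation.\<close>

lemma energy_bound:
  assumes "0 \<le> N"
  shows "max (D n N - h N) 0 \<le> Gm N * (C\<^sup>2 / R0 * vv 0 T + 2 * C * (c1 * T + c2 * vv 0 T) +
    2 * (2 * C + vv 0 T + Cd * T) * (vv 0 T + Cd * T))"
proof -
  have x2: "norm (x r - x (tg n i)) \<le> 2 * C" if "i < Suc n" "r \<in> {tg n i..tg n (Suc i)}" for i r
    using norm_triangle_ineq4[of "x r" "x (tg n i)"] x_bound[of r] x_bound[of "tg n i"] that tg_props[OF that(1)]
    by (auto simp: x_def)
  have jb: "norm (j (tg n (Suc i)) - j (tg n i)) \<le> 2 * C + vv 0 T + Cd * T" if "i < Suc n" for i
  proof -
    let ?s = "tg n i" and ?u = "tg n (Suc i)"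
    note p = tg_props(1-3)[OF that]
    let ?Fi = "LINT r:{?s<..?u}|lborel. \<delta> r"
    have "j ?u - j ?s = (x ?u - x ?s) - ((k ?u - k ?s) - (k' ?u - k' ?s)) + ?Fi"
      using eq[OF p] by (simp add: x_def algebra_simps)
    also have "norm \<dots> \<le> norm (x ?u - x ?s) + (norm (k ?u - k ?s) + norm (k' ?u - k' ?s)) + norm ?Fi"
      by (intro norm_triangle_le add_mono norm_triangle_le_diff order_refl norm_triangle_ineq4)
    also have "\<dots> \<le> 2 * C + vv ?s ?u + Cd * (?u - ?s)"
      using x2[OF that, of ?u] p by (intro add_mono norm_increment_le_vv drift_norm_le) auto
    also have "\<dots> \<le> 2 * C + vv 0 T + Cd * T"
    proof (intro add_mono order_refl mult_left_mono Cd_nonneg)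
      show "vv ?s ?u \<le> vv 0 T"
        using vv_add[of 0 ?s T] vv_add[of ?s ?u T] p vv_nonneg[of 0 ?s] vv_nonneg[of ?u T] by simp
    qed (use p in auto)
    finally show ?thesis .
  qed
  have L0: "0 \<le> L n (Suc n)" unfolding L_def by (intro sum_nonneg) auto
  have "D n N - h N \<le> Gm N * (C\<^sup>2 / R0 * (vv t0 T - L n (Suc n)) +
    (2 * C) * (c1 * T + c2 * vv 0 T) + 2 * (2 * C + vv 0 T + Cd * T) * (vv 0 T + Cd * T))"
    by (rule grid_energy'[OF assms x2 jb])
  also have "\<dots> \<le> Gm N * (C\<^sup>2 / R0 * vv 0 T + 2 * C * (c1 * T + c2 * vv 0 T) +
    2 * (2 * C + vv 0 T + Cd * T) * (vv 0 T + Cd * T))"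
    using L0 vv_t0_le R0_pos
    by (intro mult_left_mono add_mono order_refl divide_right_mono) (auto simp: Gm_def)
  finally have 1: "D n N - h N \<le> \<dots>" .
  have "0 \<le> Gm N * (C\<^sup>2 / R0 * vv 0 T + 2 * C * (c1 * T + c2 * vv 0 T) +
    2 * (2 * C + vv 0 T + Cd * T) * (vv 0 T + Cd * T))"
    using C_nonneg c_nonneg vv_nonneg Cd_nonneg T_pos R0_pos
    by (intro mult_nonneg_nonneg add_nonneg_nonneg) (auto simp: Gm_def)
  with 1 show ?thesis by simp
qed

end

end

section \<open>Paths of two solutions\<close>

text \<open>Progressive measurability of f is given for fixed y and z only. A countable range of the
  inserted function keeps measurability, and continuity in the second argument carries it to the
  limit of simple functions.\<close>

lemma caratheodory_measurable:
  fixes g :: "'s \<Rightarrow> 'a::{metric_space, second_countable_topology} \<Rightarrow> 'b::metric_space"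
  assumes "\<And>p. (\<lambda>s. g s p) \<in> borel_measurable N"
    and cont: "\<And>s. s \<in> space N \<Longrightarrow> continuous_on UNIV (g s)" and u: "u \<in> borel_measurable N"
  shows "(\<lambda>s. g s (u s)) \<in> borel_measurable N"
proof -
  obtain U where U: "\<And>i. simple_function N (U i)" "\<And>s. s \<in> space N \<Longrightarrow> (\<lambda>i. U i s) \<longlonglongrightarrow> u s"
    using borel_measurable_implies_sequence_metric[OF u] by blast
  show ?thesis
  proof (rule borel_measurable_LIMSEQ_metric)
    fix i
    have "U i \<in> measurable N (count_space (U i ` space N))"
    proof (rule measurable_count_space_eq2[THEN iffD2])
      show "finite (U i ` space N)" using U(1)[of i] by (simp add: simple_function_def)
      show "U i \<in> space N \<rightarrow> U i ` space N \<and> (\<forall>a\<in>U i ` space N. U i -` {a} \<inter> space N \<in> sets N)"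
        using U(1)[of i] by (auto simp: simple_function_def)
    qed
    moreover have "countable (U i ` space N)"
      using U(1)[of i] by (simp add: simple_function_def countable_finite)
    ultimately show "(\<lambda>s. g s (U i s)) \<in> borel_measurable N"
      by (rule measurable_compose_countable'[OF assms(1)])
  next
    fix s assume s: "s \<in> space N"
    have "isCont (g s) (u s)" using cont[OF s] by (simp add: continuous_on_eq_continuous_at)
    then show "(\<lambda>i. g s (U i s)) \<longlonglongrightarrow> g s (u s)" using U(2)[OF s] by (rule isCont_tendsto_compose)
  qed
qed

lemma set_integral_Icc_eq_Ioc:
  fixes h :: "real \<Rightarrow> 'c::{banach, second_countable_topology}"
  assumes "set_integrable lborel {a..b} h"
  shows "(LINT t:{a..b}|lborel. h t) = (LINT t:{a<..b}|lborel. h t)"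
proof -
  have "set_integrable lborel {a<..b} h"
    by (rule set_integrable_subset[OF assms]) auto
  moreover have "AE t in lborel. indicator {a..b} t *\<^sub>R h t = indicator {a<..b} t *\<^sub>R h t"
    using AE_lborel_singleton[of a] by eventually_elim (auto split: split_indicator)
  ultimately show ?thesis
    using assms unfolding set_lebesgue_integral_def set_integrable_def by (intro integral_cong_AE) auto
qed

text \<open>R1 bounds the closed domain, and y0 is a point outside the compact set beyond which f
  vanishes. Together they make the driver bounded along solutions.\<close>

locale reflected_data = brownian_basis M T W
  for M :: "'w measure" and T :: real and W :: "real \<Rightarrow> 'w \<Rightarrow> real ^ 'm" +
  fixes \<phi> :: "real ^ 'n \<Rightarrow> real" and R0 :: real and \<xi> :: "'w \<Rightarrow> real ^ 'n"
    and f :: "real \<Rightarrow> 'w \<Rightarrow> real ^ 'n \<Rightarrow> real ^ 'm ^ 'n \<Rightarrow> real ^ 'n"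
    and Kfy Kfz R1 :: real and y0 :: "real ^ 'n"
  assumes T_pos: "0 < T"
    and smooth: "smoothness_cond \<phi>" and sphere: "exterior_sphere_constant \<phi> R0"
    and closure_bound: "\<And>y. y \<in> closure (sublevel \<phi>) \<Longrightarrow> norm y \<le> R1"
    and f_prog: "\<And>y z. progressive F T (\<lambda>t \<omega>. f t \<omega> y z)"
    and Kf: "0 \<le> Kfy" "0 \<le> Kfz"
    and f_lip: "\<And>t \<omega> y y' z z'. t \<in> {0..T} \<Longrightarrow> \<omega> \<in> space M \<Longrightarrow>
      norm (f t \<omega> y z - f t \<omega> y' z') \<le> Kfy * norm (y - y') + Kfz * norm (z - z')"
    and f_zero: "\<And>t \<omega> z. t \<in> {0..T} \<Longrightarrow> \<omega> \<in> space M \<Longrightarrow> f t \<omega> y0 z = 0"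
begin

text \<open>Membership in the class with exponent 2, with the Ito integral J and the exponent p as
  explicit parameters instead of existential witnesses.\<close>

definition sol where
  "sol Y Z K J p \<longleftrightarrow> Y \<in> space_S2 M F T \<and> Z \<in> space_H2 M F T \<and> K \<in> space_K1 M F T \<and>
     has_ito_integral M F T W Z J \<and>
     (AE \<omega> in M. \<forall>t\<in>{0..T}.
       Y t \<omega> = \<xi> \<omega> + (LINT s:{t..T}|lborel. f s \<omega> (Y s \<omega>) (Z s \<omega>))
         - (K T \<omega> - K t \<omega>) - (J T \<omega> - J t \<omega>)) \<and>
     (AE \<omega> in M. \<forall>t\<in>{0..T}. Y t \<omega> \<in> closure (sublevel \<phi>)) \<and>
     (AE \<omega> in M. \<forall>t\<in>{0..T}.
        K t \<omega> = (LINT s:{0<..t}|variation_measure T (\<lambda>s. K s \<omega>). normal_field \<phi> (Y s \<omega>))) \<and>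
     1 < p \<and> (\<integral>\<^sup>+\<omega>. ennreal (exp (2 * p / R0 * enn2real (variation (\<lambda>s. K s \<omega>) T))) \<partial>M) < \<infinity>"

text \<open>Since f vanishes at y0 for every z, its Lipschitz constant in y alone bounds it, uniformly in z.\<close>

definition Cf :: real where "Cf = Kfy * (R1 + norm y0)"

lemma f_bound:
  assumes "t \<in> {0..T}" "\<omega> \<in> space M" "y \<in> closure (sublevel \<phi>)"
  shows "norm (f t \<omega> y z) \<le> Cf"
proof -
  have "norm (f t \<omega> y z) = norm (f t \<omega> y z - f t \<omega> y0 z)" using f_zero[OF assms(1,2)] by simp
  also have "\<dots> \<le> Kfy * norm (y - y0)" using f_lip[OF assms(1,2), of y z y0 z] by simp
  also have "\<dots> \<le> Cf"
    unfolding Cf_def using norm_triangle_ineq4[of y y0] closure_bound[OF assms(3)] Kf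
    by (intro mult_left_mono) auto
  finally show ?thesis .
qed

lemma section_measurable:
  fixes H :: "real \<Rightarrow> 'w \<Rightarrow> 'b::topological_space"
  assumes "progressive F T H" "\<omega> \<in> space M"
  shows "(\<lambda>t. H t \<omega>) \<in> borel_measurable (restrict_space borel {0..T})"
proof -
  have "(\<lambda>(s, \<omega>). H s \<omega>) \<in> borel_measurable (restrict_space borel {0..T} \<Otimes>\<^sub>M F T)"
    using assms(1) T_pos by (simp add: progressive_def)
  moreover have "(\<lambda>t. (t, \<omega>)) \<in> measurable (restrict_space borel {0..T}) (restrict_space borel {0..T} \<Otimes>\<^sub>M F T)"
    using assms(2) by simp
  ultimately have "(\<lambda>t. (\<lambda>(s, \<omega>). H s \<omega>) (t, \<omega>)) \<in> borel_measurable (restrict_space borel {0..T})"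
    by (rule measurable_compose[rotated])
  then show ?thesis by simp
qed

text \<open>A non-integrable function has integral 0 by convention, so integrability must be known
  before the drift integral can be split at intermediate times.\<close>

lemma drift_integrable:
  fixes Z :: "real \<Rightarrow> 'w \<Rightarrow> real ^ 'm ^ 'n"
  assumes \<omega>: "\<omega> \<in> space M" and Y: "continuous_on {0..T} (\<lambda>t. Y t \<omega>)"
    and Y_in: "\<And>t. t \<in> {0..T} \<Longrightarrow> Y t \<omega> \<in> closure (sublevel \<phi>)" and Z: "progressive F T Z"
  shows "set_integrable lborel {0..T} (\<lambda>t. f t \<omega> (Y t \<omega>) (Z t \<omega>))"
proof -
  let ?N = "restrict_space borel {0..T} :: real measure"
  have "(\<lambda>t. (\<lambda>t p. f t \<omega> (fst p) (snd p)) t (Y t \<omega>, Z t \<omega>)) \<in> borel_measurable ?N"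
  proof (rule caratheodory_measurable[where g = "\<lambda>t p. f t \<omega> (fst p) (snd p)" and u = "\<lambda>t. (Y t \<omega>, Z t \<omega>)"])
    show "(\<lambda>t. f t \<omega> (fst p) (snd p)) \<in> borel_measurable ?N" for p
      by (rule section_measurable[OF f_prog \<omega>])
    show "(\<lambda>t. (Y t \<omega>, Z t \<omega>)) \<in> borel_measurable ?N"
      by (intro borel_measurable_Pair section_measurable[OF Z \<omega>] borel_measurable_continuous_on_restrict Y)
    fix t assume "t \<in> space ?N"
    then have t: "t \<in> {0..T}" by (simp add: space_restrict_space)
    have "dist (f t \<omega> (fst p) (snd p)) (f t \<omega> (fst q) (snd q)) \<le> (Kfy + Kfz) * dist p q"
      for p q :: "(real ^ 'n) \<times> (real ^ 'm ^ 'n)"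
    proof -
      have "dist (f t \<omega> (fst p) (snd p)) (f t \<omega> (fst q) (snd q)) \<le>
          Kfy * dist (fst p) (fst q) + Kfz * dist (snd p) (snd q)"
        using f_lip[OF t \<omega>] by (simp add: dist_norm)
      also have "\<dots> \<le> Kfy * dist p q + Kfz * dist p q"
        using Kf by (intro add_mono mult_left_mono dist_fst_le dist_snd_le)
      finally show ?thesis by (simp add: distrib_right)
    qed
    then have "(Kfy + Kfz)-lipschitz_on UNIV (\<lambda>p. f t \<omega> (fst p) (snd p))"
      using Kf by (intro lipschitz_onI) auto
    then show "continuous_on UNIV (\<lambda>p. f t \<omega> (fst p) (snd p))"
      by (rule lipschitz_on_continuous_on)
  qed
  then have "(\<lambda>t. indicator {0..T} t *\<^sub>R f t \<omega> (Y t \<omega>) (Z t \<omega>)) \<in> borel_measurable borel"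
    by (simp add: borel_measurable_restrict_space_iff)
  then have m: "(\<lambda>t. indicator {0..T} t *\<^sub>R f t \<omega> (Y t \<omega>) (Z t \<omega>)) \<in> borel_measurable lborel"
    by simp
  have "integrable lborel (indicator {0..T} :: real \<Rightarrow> real)"
    by (rule integrable_real_indicator) (use T_pos in auto)
  then have "integrable lborel (\<lambda>t. indicator {0..T} t *\<^sub>R Cf)" by simp
  then show ?thesis
    unfolding set_integrable_def
  proof (rule Bochner_Integration.integrable_bound[OF _ m], intro AE_I2)
    fix t
    show "norm (indicator {0..T} t *\<^sub>R f t \<omega> (Y t \<omega>) (Z t \<omega>)) \<le> norm (indicat_real {0..T} t *\<^sub>R Cf)"
    proof (cases "t \<in> {0..T}")
      case True
      from f_bound[OF True \<omega> Y_in[OF True], of "Z t \<omega>"] True show ?thesis by simp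
    qed simp
  qed
qed

text \<open>Subtracting the backward equation at two times removes \<open>\<xi>\<close> and the
  values at T. What remains is an equation for increments, the form needed on grid cells; at T
  itself the drift is integrated over a single point.\<close>

lemma sol_path:
  assumes "sol Y Z K J p"
  shows "AE \<omega> in M. \<omega> \<in> space M \<and> continuous_on {0..T} (\<lambda>t. Y t \<omega>) \<and>
    (\<forall>t\<in>{0..T}. Y t \<omega> \<in> closure (sublevel \<phi>)) \<and>
    (\<forall>t\<in>{0..<T}. continuous (at_right t) (\<lambda>s. K s \<omega>)) \<and>
    K 0 \<omega> = 0 \<and> var_on (\<lambda>s. K s \<omega>) 0 T < \<infinity> \<and>
    (\<forall>t\<in>{0..T}. K t \<omega> = (LINT s:{0<..t}|variation_measure T (\<lambda>s. K s \<omega>). normal_field \<phi> (Y s \<omega>))) \<and>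
    continuous_on {0..T} (\<lambda>t. J t \<omega>) \<and>
    set_integrable lborel {0..T} (\<lambda>t. f t \<omega> (Y t \<omega>) (Z t \<omega>)) \<and>
    Y T \<omega> = \<xi> \<omega> \<and>
    (\<forall>s u. 0 \<le> s \<longrightarrow> s \<le> u \<longrightarrow> u \<le> T \<longrightarrow> Y u \<omega> - Y s \<omega> =
      (K u \<omega> - K s \<omega>) + (J u \<omega> - J s \<omega>) - (LINT r:{s<..u}|lborel. f r \<omega> (Y r \<omega>) (Z r \<omega>)))"
proof -
  have Yc: "AE \<omega> in M. continuous_on {0..T} (\<lambda>t. Y t \<omega>)" using assms by (simp add: sol_def space_S2_def)
  have Zp: "progressive F T Z" using assms by (simp add: sol_def space_H2_def)
  have Kp: "AE \<omega> in M. K 0 \<omega> = 0 \<and> (\<forall>t\<in>{0..<T}. continuous (at_right t) (\<lambda>s. K s \<omega>)) \<and>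
      variation (\<lambda>s. K s \<omega>) T < \<infinity>"
    using assms by (simp add: sol_def space_K1_def)
  have Jc: "AE \<omega> in M. continuous_on {0..T} (\<lambda>t. J t \<omega>)"
    using assms by (simp add: sol_def has_ito_integral_def)
  have e: "AE \<omega> in M. \<forall>t\<in>{0..T}.
       Y t \<omega> = \<xi> \<omega> + (LINT s:{t..T}|lborel. f s \<omega> (Y s \<omega>) (Z s \<omega>))
         - (K T \<omega> - K t \<omega>) - (J T \<omega> - J t \<omega>)"
    and Yin: "AE \<omega> in M. \<forall>t\<in>{0..T}. Y t \<omega> \<in> closure (sublevel \<phi>)"
    and Ke: "AE \<omega> in M. \<forall>t\<in>{0..T}.
        K t \<omega> = (LINT s:{0<..t}|variation_measure T (\<lambda>s. K s \<omega>). normal_field \<phi> (Y s \<omega>))"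
    using assms unfolding sol_def by blast+
  show ?thesis
    using AE_space Yc Kp Jc e Yin Ke
  proof eventually_elim
    case (elim \<omega>)
    let ?f = "\<lambda>t. f t \<omega> (Y t \<omega>) (Z t \<omega>)"
    have int: "set_integrable lborel {0..T} ?f"
      by (rule drift_integrable[where Y = Y and Z = Z]) (use elim(1,2,6) Zp in blast)+
    have sub: "set_integrable lborel A ?f" if "A \<subseteq> {0..T}" "A \<in> sets borel" for A
      by (rule set_integrable_subset[OF int]) (use that in auto)
    have fin: "(LINT r:{s..T}|lborel. ?f r) = (LINT r:{s<..u}|lborel. ?f r) + (LINT r:{u..T}|lborel. ?f r)"
      if "0 \<le> s" "s \<le> u" "u \<le> T" for s u
    proof -
      have "(LINT r:{s..T}|lborel. ?f r) = (LINT r:{s<..T}|lborel. ?f r)"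
        by (rule set_integral_Icc_eq_Ioc[OF sub]) (use that in auto)
      also have "{s<..T} = {s<..u} \<union> {u<..T}" using that by auto
      also have "(LINT r:{s<..u} \<union> {u<..T}|lborel. ?f r) =
          (LINT r:{s<..u}|lborel. ?f r) + (LINT r:{u<..T}|lborel. ?f r)"
        by (rule set_integral_Un[OF _ sub sub]) (use that in auto)
      also have "(LINT r:{u<..T}|lborel. ?f r) = (LINT r:{u..T}|lborel. ?f r)"
        by (rule set_integral_Icc_eq_Ioc[OF sub, symmetric]) (use that in auto)
      finally show ?thesis .
    qed
    have "(LINT r:{T..T}|lborel. ?f r) = 0"
      using set_integral_Icc_eq_Ioc[OF sub[of "{T..T}"]] T_pos by (simp add: set_lebesgue_integral_def)
    then have YT: "Y T \<omega> = \<xi> \<omega>"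
      using elim(5) T_pos by (metis (no_types, lifting) add.right_neutral atLeastAtMost_iff diff_self
          diff_zero less_eq_real_def order_refl)
    have "Y u \<omega> - Y s \<omega> = (K u \<omega> - K s \<omega>) + (J u \<omega> - J s \<omega>) - (LINT r:{s<..u}|lborel. ?f r)"
      if su: "0 \<le> s" "s \<le> u" "u \<le> T" for s u
    proof -
      have "u \<in> {0..T}" "s \<in> {0..T}" using su by auto
      note yu = elim(5)[rule_format, OF this(1)] and ys = elim(5)[rule_format, OF this(2)]
      show ?thesis unfolding yu ys fin[OF su] by (simp add: algebra_simps)
    qed
    then show ?case using elim int YT by (auto simp: variation_eq_var_on)
  qed
qed

lemma H2_path:
  fixes Z Z' :: "real \<Rightarrow> 'w \<Rightarrow> real ^ 'm ^ 'n"
  assumes "Z \<in> space_H2 M F T" "Z' \<in> space_H2 M F T"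
  shows "AE \<omega> in M. set_integrable lborel {0..T} (\<lambda>t. (norm (Z t \<omega> - Z' t \<omega>))\<^sup>2)"
proof -
  interpret pair_sigma_finite M "time_measure T" by (rule pair_Q)
  have m: "(\<lambda>(\<omega>, t). Z t \<omega>) \<in> borel_measurable Q" "(\<lambda>(\<omega>, t). Z' t \<omega>) \<in> borel_measurable Q"
    using assms T_pos by (auto intro!: progressive_swap simp: space_H2_def)
  have "(\<integral>\<^sup>+x. ennreal ((norm ((\<lambda>(\<omega>, t). Z t \<omega>) x - (\<lambda>(\<omega>, t). Z' t \<omega>) x))\<^sup>2) \<partial>Q) < \<infinity>"
    using T_pos by (intro nn_square_diff_finite m H2_finite assms) auto
  then have "integrable Q (\<lambda>x. (norm ((\<lambda>(\<omega>, t). Z t \<omega>) x - (\<lambda>(\<omega>, t). Z' t \<omega>) x))\<^sup>2)"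
    by (intro square_integrable_nn borel_measurable_diff m)
  from AE_integrable_fst'[OF this] show ?thesis
  proof eventually_elim
    case (elim \<omega>)
    then show ?case
      by (simp add: time_measure_def set_integrable_def integrable_restrict_space)
  qed
qed

lemma pair_path:
  assumes "sol Y Z K J p" "sol Y' Z' K' J' p'"
  shows "AE \<omega> in M. reflected_pair T R0 (2 * R1) (2 * Cf) Kfy Kfz \<phi> (\<lambda>t. Y t \<omega>) (\<lambda>t. Y' t \<omega>)
    (\<lambda>t. K t \<omega>) (\<lambda>t. K' t \<omega>) (\<lambda>t. J t \<omega> - J' t \<omega>)
    (\<lambda>t. f t \<omega> (Y t \<omega>) (Z t \<omega>) - f t \<omega> (Y' t \<omega>) (Z' t \<omega>)) (\<lambda>t. Z t \<omega> - Z' t \<omega>)"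
proof -
  have Z: "Z \<in> space_H2 M F T" "Z' \<in> space_H2 M F T" using assms by (auto simp: sol_def)
  show ?thesis
    using sol_path[OF assms(1)] sol_path[OF assms(2)] H2_path[OF Z]
  proof eventually_elim
    case (elim \<omega>)
    let ?f = "\<lambda>t. f t \<omega> (Y t \<omega>) (Z t \<omega>)" and ?f' = "\<lambda>t. f t \<omega> (Y' t \<omega>) (Z' t \<omega>)"
    have int: "set_integrable lborel {0..T} ?f" "set_integrable lborel {0..T} ?f'" using elim by auto
    have \<omega>: "\<omega> \<in> space M" using elim by simp
    have Yin: "Y t \<omega> \<in> closure (sublevel \<phi>)" "Y' t \<omega> \<in> closure (sublevel \<phi>)" if "t \<in> {0..T}" for t
      using elim that by auto
    show ?case
    proof
      show "set_integrable lborel {0..T} (\<lambda>t. ?f t - ?f' t)" using int by (rule set_integral_diff(1))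
      show "norm (Y t \<omega> - Y' t \<omega>) \<le> 2 * R1" if "t \<in> {0..T}" for t
        using norm_triangle_ineq4[of "Y t \<omega>" "Y' t \<omega>"] closure_bound[OF Yin(1)[OF that]]
          closure_bound[OF Yin(2)[OF that]] by simp
      show "norm (?f t - ?f' t) \<le> 2 * Cf" if "t \<in> {0..T}" for t
        using norm_triangle_ineq4[of "?f t" "?f' t"] f_bound[OF that \<omega> Yin(1)[OF that], of "Z t \<omega>"]
          f_bound[OF that \<omega> Yin(2)[OF that], of "Z' t \<omega>"] by simp
      show "norm (?f t - ?f' t) \<le> Kfy * norm (Y t \<omega> - Y' t \<omega>) + Kfz * norm (Z t \<omega> - Z' t \<omega>)"
        if "t \<in> {0..T}" for t using f_lip[OF that \<omega>] .
      show "continuous_on {0..T} (\<lambda>t. J t \<omega> - J' t \<omega>)" using elim by (intro continuous_intros) auto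
      show "(Y u \<omega> - Y' u \<omega>) - (Y s \<omega> - Y' s \<omega>) = ((K u \<omega> - K s \<omega>) - (K' u \<omega> - K' s \<omega>)) +
          ((J u \<omega> - J' u \<omega>) - (J s \<omega> - J' s \<omega>)) - (LINT r:{s<..u}|lborel. ?f r - ?f' r)"
        if su: "0 \<le> s" "s \<le> u" "u \<le> T" for s u
      proof -
        have "set_integrable lborel {s<..u} ?f" "set_integrable lborel {s<..u} ?f'"
          using su by (auto intro: set_integrable_subset[OF int(1)] set_integrable_subset[OF int(2)])
        then have "(LINT r:{s<..u}|lborel. ?f r - ?f' r) =
            (LINT r:{s<..u}|lborel. ?f r) - (LINT r:{s<..u}|lborel. ?f' r)"
          by (rule set_integral_diff(2))
        moreover have "(Y u \<omega> - Y' u \<omega>) - (Y s \<omega> - Y' s \<omega>) = (Y u \<omega> - Y s \<omega>) - (Y' u \<omega> - Y' s \<omega>)"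
          by simp
        moreover have "Y u \<omega> - Y s \<omega> =
            (K u \<omega> - K s \<omega>) + (J u \<omega> - J s \<omega>) - (LINT r:{s<..u}|lborel. ?f r)"
          "Y' u \<omega> - Y' s \<omega> = (K' u \<omega> - K' s \<omega>) + (J' u \<omega> - J' s \<omega>) - (LINT r:{s<..u}|lborel. ?f' r)"
          using elim su by auto
        ultimately show ?thesis by (simp only:) simp
      qed
    qed (use elim T_pos smooth sphere Kf in auto)
  qed
qed

end

section \<open>The energy inequality in expectation\<close>

context reflected_data
begin

text \<open>A measurable version of the variation: the sums converge almost surely, and lim has an
  unspecified value where they do not.\<close>

definition path_var :: "(real \<Rightarrow> 'w \<Rightarrow> real ^ 'n) \<Rightarrow> 'w \<Rightarrow> real" where
  "path_var K \<omega> = lim (\<lambda>n. \<Sum>i<Suc n. norm (K (grid 0 T n (Suc i)) \<omega> - K (grid 0 T n i) \<omega>))"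

lemma adapted_measurable:
  assumes "adapted F T X" "t \<in> {0..T}"
  shows "X t \<in> borel_measurable M" "X t \<in> borel_measurable (F t)"
proof -
  show "X t \<in> borel_measurable (F t)" using assms by (simp add: adapted_def)
  from F_measurable_M[OF this] show "X t \<in> borel_measurable M" using assms(2) by (simp del: space_F)
qed

lemma sol_adapted:
  assumes "sol Y Z K J p"
  shows "adapted F T Y" "adapted F T K" "adapted F T J" "Z \<in> space_H2 M F T" "has_ito_integral M F T W Z J"
  using assms by (simp_all add: sol_def space_S2_def space_K1_def has_ito_integral_def)

lemma path_var_measurable:
  assumes "sol Y Z K J p"
  shows "path_var K \<in> borel_measurable M"
  unfolding path_var_def[abs_def]
proof (rule borel_measurable_lim_metric)
  fix n
  show "(\<lambda>\<omega>. \<Sum>i<Suc n. norm (K (grid 0 T n (Suc i)) \<omega> - K (grid 0 T n i) \<omega>)) \<in> borel_measurable M"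
  proof (intro borel_measurable_sum)
    fix i assume "i \<in> {..<Suc n}"
    then have "grid 0 T n i \<in> {0..T}" "grid 0 T n (Suc i) \<in> {0..T}"
      using T_pos by (intro grid_in; simp)+
    from this[THEN adapted_measurable(1)[OF sol_adapted(2)[OF assms]]]
    show "(\<lambda>\<omega>. norm (K (grid 0 T n (Suc i)) \<omega> - K (grid 0 T n i) \<omega>)) \<in> borel_measurable M"
      by measurable
  qed
qed

lemma path_var_eq:
  assumes "sol Y Z K J p"
  shows "AE \<omega> in M. path_var K \<omega> = enn2real (var_on (\<lambda>t. K t \<omega>) 0 T)"
  using sol_path[OF assms]
proof eventually_elim
  case (elim \<omega>)
  have "(\<lambda>n. \<Sum>i<Suc n. norm (K (grid 0 T n (Suc i)) \<omega> - K (grid 0 T n i) \<omega>)) \<longlonglongrightarrow>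
      enn2real (var_on (\<lambda>t. K t \<omega>) 0 T)"
    by (rule grid_sum_tendsto_var_on) (use elim T_pos in auto)
  then show ?case unfolding path_var_def by (rule limI)
qed

lemma exp_path_var_integrable:
  assumes "sol Y Z K J p"
  shows "integrable M (\<lambda>\<omega>. exp (2 * p / R0 * path_var K \<omega>))"
proof (rule integrableI_nonneg)
  show "(\<lambda>\<omega>. exp (2 * p / R0 * path_var K \<omega>)) \<in> borel_measurable M"
    using path_var_measurable[OF assms] by measurable
  have "(\<integral>\<^sup>+\<omega>. ennreal (exp (2 * p / R0 * path_var K \<omega>)) \<partial>M) =
      (\<integral>\<^sup>+\<omega>. ennreal (exp (2 * p / R0 * enn2real (variation (\<lambda>s. K s \<omega>) T))) \<partial>M)"
    by (rule nn_integral_cong_AE)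
      (use path_var_eq[OF assms] in \<open>eventually_elim, simp add: variation_eq_var_on\<close>)
  then show "(\<integral>\<^sup>+\<omega>. ennreal (exp (2 * p / R0 * path_var K \<omega>)) \<partial>M) < \<infinity>"
    using assms by (simp add: sol_def)
qed auto

end

section \<open>Two solutions and the integrability of their total variation\<close>

locale two_solutions = reflected_data M T W \<phi> R0 \<xi> f Kfy Kfz R1 y0
  for M :: "'w measure" and T :: real and W :: "real \<Rightarrow> 'w \<Rightarrow> real ^ 'm"
    and \<phi> :: "real ^ 'n \<Rightarrow> real" and R0 :: real and \<xi> :: "'w \<Rightarrow> real ^ 'n"
    and f :: "real \<Rightarrow> 'w \<Rightarrow> real ^ 'n \<Rightarrow> real ^ 'm ^ 'n \<Rightarrow> real ^ 'n"
    and Kfy Kfz R1 :: real and y0 :: "real ^ 'n" +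
  fixes Y Y' :: "real \<Rightarrow> 'w \<Rightarrow> real ^ 'n" and Z Z' :: "real \<Rightarrow> 'w \<Rightarrow> real ^ 'm ^ 'n"
    and K K' J J' :: "real \<Rightarrow> 'w \<Rightarrow> real ^ 'n" and p p' :: real
  assumes sol: "sol Y Z K J p" and sol': "sol Y' Z' K' J' p'"
begin

abbreviation path_pair :: "'w \<Rightarrow> bool" where
  "path_pair \<omega> \<equiv> reflected_pair T R0 (2 * R1) (2 * Cf) Kfy Kfz \<phi> (\<lambda>t. Y t \<omega>) (\<lambda>t. Y' t \<omega>)
    (\<lambda>t. K t \<omega>) (\<lambda>t. K' t \<omega>) (\<lambda>t. J t \<omega> - J' t \<omega>)
    (\<lambda>t. f t \<omega> (Y t \<omega>) (Z t \<omega>) - f t \<omega> (Y' t \<omega>) (Z' t \<omega>)) (\<lambda>t. Z t \<omega> - Z' t \<omega>)"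

lemma AE_path_pair: "AE \<omega> in M. path_pair \<omega>"
  by (rule pair_path[OF sol sol'])

definition V :: "'w \<Rightarrow> real" where "V \<omega> = path_var K \<omega> + path_var K' \<omega>"

definition X :: "real \<Rightarrow> 'w \<Rightarrow> real ^ 'n" where "X t \<omega> = Y t \<omega> - Y' t \<omega>"

definition dJ :: "real \<Rightarrow> real \<Rightarrow> 'w \<Rightarrow> real ^ 'n" where
  "dJ s u \<omega> = (J u \<omega> - J' u \<omega>) - (J s \<omega> - J' s \<omega>)"

definition E2 :: "real \<Rightarrow> real \<Rightarrow> 'w \<Rightarrow> real" where
  "E2 s u \<omega> = (LINT r:{s<..u}|lborel. (norm (Z r \<omega> - Z' r \<omega>))\<^sup>2)"

definition \<alpha> :: real where "\<alpha> = 2 * Kfy + 2 * Kfz\<^sup>2"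

lemma R0_pos: "0 < R0"
  using sphere by (simp add: exterior_sphere_constant_def)

lemma \<alpha>_nonneg: "0 \<le> \<alpha>"
  using Kf by (simp add: \<alpha>_def)

lemma V_measurable [measurable]: "V \<in> borel_measurable M"
  unfolding V_def[abs_def] by (intro borel_measurable_add path_var_measurable[OF sol] path_var_measurable[OF sol'])

lemma V_eq: "AE \<omega> in M. V \<omega> = enn2real (var_on (\<lambda>t. K t \<omega>) 0 T) + enn2real (var_on (\<lambda>t. K' t \<omega>) 0 T)"
  using path_var_eq[OF sol] path_var_eq[OF sol'] by eventually_elim (simp add: V_def)

lemma V_nonneg: "AE \<omega> in M. 0 \<le> V \<omega>"
  using V_eq by eventually_elim simp

text \<open>The exponent 2 of the class is used here: by the inequality 2 a b <= a * a + b * b each of the two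
  variations contributes half of the exponent of the weight.\<close>

lemma exp_V_integrable: "\<exists>q>1. integrable M (\<lambda>\<omega>. exp (q / R0 * V \<omega>))"
proof -
  define q where "q = min p p'"
  have q: "1 < q" "q \<le> p" "q \<le> p'" using sol sol' by (auto simp: q_def sol_def)
  have "integrable M (\<lambda>\<omega>. exp (q / R0 * V \<omega>))"
  proof (rule Bochner_Integration.integrable_bound)
    show "integrable M (\<lambda>\<omega>. exp (2 * p / R0 * path_var K \<omega>) + exp (2 * p' / R0 * path_var K' \<omega>))"
      by (intro Bochner_Integration.integrable_add exp_path_var_integrable[OF sol] exp_path_var_integrable[OF sol'])
    show "(\<lambda>\<omega>. exp (q / R0 * V \<omega>)) \<in> borel_measurable M" by measurable
    show "AE \<omega> in M. norm (exp (q / R0 * V \<omega>)) \<le>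
        norm (exp (2 * p / R0 * path_var K \<omega>) + exp (2 * p' / R0 * path_var K' \<omega>))"
      using path_var_eq[OF sol] path_var_eq[OF sol']
    proof eventually_elim
      case (elim \<omega>)
      define a b where "a = path_var K \<omega>" and "b = path_var K' \<omega>"
      have ab: "0 \<le> a" "0 \<le> b" using elim by (auto simp: a_def b_def)
      have "exp (q / R0 * V \<omega>) = exp (q / R0 * a) * exp (q / R0 * b)"
        by (simp add: V_def a_def b_def distrib_left exp_add)
      also have "\<dots> \<le> (exp (q / R0 * a))\<^sup>2 + (exp (q / R0 * b))\<^sup>2"
        using sum_squares_bound[of "exp (q / R0 * a)" "exp (q / R0 * b)"]
          mult_pos_pos[OF exp_gt_zero exp_gt_zero, of "q / R0 * a" "q / R0 * b"] by linarith
      also have "\<dots> = exp (2 * q / R0 * a) + exp (2 * q / R0 * b)"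
        by (simp add: exp_double[symmetric] mult.assoc)
      also have "\<dots> \<le> exp (2 * p / R0 * a) + exp (2 * p' / R0 * b)"
        using ab q R0_pos by (auto intro!: add_mono mult_right_mono divide_right_mono)
      finally show ?case by (simp add: a_def b_def)
    qed
  qed
  then show ?thesis using q by blast
qed

text \<open>The margin q - 1 pays for the factor V, since t <= exp(t) holds for t = (q - 1) V / R0.
  The square of V is dominated through the quadratic Taylor bound of the exponential.\<close>

lemma V_exp_integrable: "integrable M (\<lambda>\<omega>. exp (V \<omega> / R0) * V \<omega>)"
  and V_sq_integrable: "integrable M (\<lambda>\<omega>. (V \<omega>)\<^sup>2)" and V_integrable: "integrable M V"
proof -
  obtain q where q: "1 < q" and int: "integrable M (\<lambda>\<omega>. exp (q / R0 * V \<omega>))"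
    using exp_V_integrable by blast
  show "integrable M (\<lambda>\<omega>. exp (V \<omega> / R0) * V \<omega>)"
  proof (rule Bochner_Integration.integrable_bound)
    show "integrable M (\<lambda>\<omega>. R0 / (q - 1) * exp (q / R0 * V \<omega>))" using int by simp
    show "AE \<omega> in M. norm (exp (V \<omega> / R0) * V \<omega>) \<le> norm (R0 / (q - 1) * exp (q / R0 * V \<omega>))"
      using V_nonneg
    proof eventually_elim
      case (elim \<omega>)
      have "(q - 1) / R0 * V \<omega> \<le> exp ((q - 1) / R0 * V \<omega>)"
        using exp_ge_add_one_self[of "(q - 1) / R0 * V \<omega>"] by linarith
      then have "V \<omega> \<le> R0 / (q - 1) * exp ((q - 1) / R0 * V \<omega>)"
        using q R0_pos by (simp add: field_simps)
      from mult_left_mono[OF this, of "exp (V \<omega> / R0)"]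
      have "exp (V \<omega> / R0) * V \<omega> \<le> R0 / (q - 1) * (exp (V \<omega> / R0) * exp ((q - 1) / R0 * V \<omega>))"
        by (simp add: mult.left_commute)
      also have "exp (V \<omega> / R0) * exp ((q - 1) / R0 * V \<omega>) = exp (q / R0 * V \<omega>)"
        unfolding exp_add[symmetric] by (simp add: diff_divide_distrib left_diff_distrib)
      finally show ?case using elim q R0_pos by simp
    qed
  qed measurable
  show sq: "integrable M (\<lambda>\<omega>. (V \<omega>)\<^sup>2)"
  proof (rule Bochner_Integration.integrable_bound)
    show "integrable M (\<lambda>\<omega>. 2 * (R0 / q)\<^sup>2 * exp (q / R0 * V \<omega>))" using int by simp
    show "AE \<omega> in M. norm ((V \<omega>)\<^sup>2) \<le> norm (2 * (R0 / q)\<^sup>2 * exp (q / R0 * V \<omega>))"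
      using V_nonneg
    proof eventually_elim
      case (elim \<omega>)
      have "(q / R0 * V \<omega>)\<^sup>2 / 2 \<le> exp (q / R0 * V \<omega>)"
      proof -
        have "0 \<le> q / R0 * V \<omega>" using elim q R0_pos by simp
        from exp_lower_Taylor_quadratic[OF this] this show ?thesis by linarith
      qed
      then have "2 * (R0 / q)\<^sup>2 * ((q / R0 * V \<omega>)\<^sup>2 / 2) \<le> 2 * (R0 / q)\<^sup>2 * exp (q / R0 * V \<omega>)"
        by (intro mult_left_mono) auto
      moreover have "2 * (R0 / q)\<^sup>2 * ((q / R0 * V \<omega>)\<^sup>2 / 2) = (V \<omega>)\<^sup>2"
        using q R0_pos by (simp add: power_mult_distrib power_divide)
      ultimately show ?case by simp
    qed
  qed measurable
  show "integrable M V" by (rule square_integrable_imp_integrable[OF V_measurable sq])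
qed

lemma X_measurable:
  assumes "t \<in> {0..T}"
  shows "X t \<in> borel_measurable (F t)"
  unfolding X_def[abs_def]
  by (intro borel_measurable_diff adapted_measurable(2)[OF sol_adapted(1)[OF sol] assms]
      adapted_measurable(2)[OF sol_adapted(1)[OF sol'] assms])

lemma X_bound: "AE \<omega> in M. \<forall>t\<in>{0..T}. norm (X t \<omega>) \<le> 2 * R1"
  using AE_path_pair by eventually_elim (auto simp: X_def dest: reflected_pair.x_bound)

lemma R1_nonneg: "0 \<le> 2 * R1"
proof -
  have "AE \<omega> in M. 0 \<le> 2 * R1"
    using X_bound
  proof eventually_elim
    case (elim \<omega>)
    then have "norm (X 0 \<omega>) \<le> 2 * R1" using T_pos by auto
    then show ?case by (rule order_trans[OF norm_ge_zero])
  qed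
  then show ?thesis by simp
qed

lemma ito_martingale:
  assumes "0 \<le> s" "s \<le> u" "u \<le> T" "g \<in> borel_measurable (F s)" "AE \<omega> in M. norm (g \<omega>) \<le> G" "0 \<le> G"
  shows "has_bochner_integral M (\<lambda>\<omega>. g \<omega> \<bullet> dJ s u \<omega>) 0"
  unfolding dJ_def
  by (rule ito_difference(1)[OF sol_adapted(4)[OF sol] sol_adapted(4)[OF sol'] sol_adapted(5)[OF sol]
        sol_adapted(5)[OF sol'] assms])

lemma ito_isometry:
  assumes "0 \<le> s" "s \<le> u" "u \<le> T" "g \<in> borel_measurable (F s)" "AE \<omega> in M. \<bar>g \<omega>\<bar> \<le> G" "0 \<le> G"
  shows "integrable M (\<lambda>\<omega>. g \<omega> * (norm (dJ s u \<omega>))\<^sup>2)" "integrable M (\<lambda>\<omega>. g \<omega> * E2 s u \<omega>)"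
    "(\<integral>\<omega>. g \<omega> * (norm (dJ s u \<omega>))\<^sup>2 \<partial>M) = (\<integral>\<omega>. g \<omega> * E2 s u \<omega> \<partial>M)"
  using ito_difference(2)[OF sol_adapted(4)[OF sol] sol_adapted(4)[OF sol'] sol_adapted(5)[OF sol]
        sol_adapted(5)[OF sol'] assms]
  unfolding dJ_def[abs_def] E2_def[abs_def] by (simp_all add: has_bochner_integral_iff)

lemma E2_nonneg: "0 \<le> E2 s u \<omega>"
  unfolding E2_def set_lebesgue_integral_def by (rule integral_nonneg_AE) auto

lemma E2_integrable:
  assumes "0 \<le> s" "s \<le> u" "u \<le> T"
  shows "integrable M (E2 s u)"
  using ito_isometry(2)[OF assms, of "\<lambda>_. 1" 1] by simp

lemma E2_add:
  assumes "0 \<le> a" "a \<le> b" "b \<le> c" "c \<le> T"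
  shows "AE \<omega> in M. E2 a c \<omega> = E2 a b \<omega> + E2 b c \<omega>"
  using AE_path_pair
proof eventually_elim
  case (elim \<omega>)
  note int = reflected_pair.zd_int[OF elim]
  have "set_integrable lborel {a<..b} (\<lambda>t. (norm (Z t \<omega> - Z' t \<omega>))\<^sup>2)"
    "set_integrable lborel {b<..c} (\<lambda>t. (norm (Z t \<omega> - Z' t \<omega>))\<^sup>2)"
    by (rule set_integrable_subset[OF int]; use assms in auto)+
  from set_integral_Un[OF _ this] have "(LINT t:{a<..b} \<union> {b<..c}|lborel. (norm (Z t \<omega> - Z' t \<omega>))\<^sup>2) =
      E2 a b \<omega> + E2 b c \<omega>" by (force simp: E2_def)
  moreover have "{a<..b} \<union> {b<..c} = {a<..c}" using assms by auto
  ultimately show ?case by (simp add: E2_def)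
qed

section \<open>The expected energy from a fixed starting time\<close>

context
  fixes t0 assumes t0: "0 \<le> t0" "t0 < T"
begin

text \<open>The weight uses the discrete variation along the grid, which is adapted by construction, instead
  of the variation itself.\<close>

definition LL :: "nat \<Rightarrow> nat \<Rightarrow> 'w \<Rightarrow> real" where
  "LL n i \<omega> = (\<Sum>l<i. norm (K (grid t0 T n (Suc l)) \<omega> - K (grid t0 T n l) \<omega>) +
     norm (K' (grid t0 T n (Suc l)) \<omega> - K' (grid t0 T n l) \<omega>))"

text \<open>\<open>GG\<close>, \<open>DD\<close> and \<open>hh\<close> are G, D and h of
  \<open>reflected_pair\<close> read as random variables, defined at every outcome, so that
  measurability and integrability can be stated. The identification holds on the almost sure set of
  good paths.\<close>

definition GG :: "nat \<Rightarrow> real \<Rightarrow> nat \<Rightarrow> 'w \<Rightarrow> real" where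
  "GG n N i \<omega> = exp (\<alpha> * (grid t0 T n i - t0) + min (LL n i \<omega>) N / R0)"

definition DD :: "nat \<Rightarrow> real \<Rightarrow> 'w \<Rightarrow> real" where
  "DD n N \<omega> = (\<Sum>i<Suc n. GG n N i \<omega> *
      (2 * (X (grid t0 T n i) \<omega> \<bullet> dJ (grid t0 T n i) (grid t0 T n (Suc i)) \<omega>) +
       (norm (dJ (grid t0 T n i) (grid t0 T n (Suc i)) \<omega>))\<^sup>2 -
       E2 (grid t0 T n i) (grid t0 T n (Suc i)) \<omega> / 2)) + (norm (X t0 \<omega>))\<^sup>2"

definition hh :: "real \<Rightarrow> 'w \<Rightarrow> real" where
  "hh N \<omega> = exp (\<alpha> * T + N / R0) * ((2 * R1)\<^sup>2 / R0) * max (V \<omega> - N) 0"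

lemma grid_props:
  assumes "i < Suc n"
  shows "0 \<le> grid t0 T n i" "grid t0 T n i \<le> grid t0 T n (Suc i)" "grid t0 T n (Suc i) \<le> T"
    "t0 \<le> grid t0 T n i" "grid t0 T n i \<le> T"
  using grid_in[of t0 T i n] grid_in[of t0 T "Suc i" n] grid_mono[of t0 T i "Suc i" n] t0 assms by auto

lemma LL_measurable:
  assumes "i \<le> Suc n"
  shows "LL n i \<in> borel_measurable (F (grid t0 T n i))"
  unfolding LL_def[abs_def]
proof (intro borel_measurable_sum)
  fix l assume "l \<in> {..<i}"
  then have l: "l < Suc n" "grid t0 T n (Suc l) \<le> grid t0 T n i" "grid t0 T n l \<le> grid t0 T n i"
    using assms t0 by (auto intro!: grid_mono)
  have iT: "grid t0 T n i \<le> T" using grid_in[of t0 T i n] t0 assms by simp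
  have m: "k r \<in> borel_measurable (F (grid t0 T n i))"
    if "adapted F T k" "0 \<le> r" "r \<le> grid t0 T n i" for k :: "real \<Rightarrow> 'w \<Rightarrow> real ^ 'n" and r
    by (rule F_measurable_mono[OF adapted_measurable(2)[OF that(1)] that(3) iT]) (use that iT in auto)
  note p = grid_props[OF l(1)]
  have [measurable]: "K (grid t0 T n (Suc l)) \<in> borel_measurable (F (grid t0 T n i))"
    "K' (grid t0 T n (Suc l)) \<in> borel_measurable (F (grid t0 T n i))"
    "K (grid t0 T n l) \<in> borel_measurable (F (grid t0 T n i))"
    "K' (grid t0 T n l) \<in> borel_measurable (F (grid t0 T n i))"
    by (rule m; use sol_adapted(2)[OF sol] sol_adapted(2)[OF sol'] l p in auto)+
  show "(\<lambda>\<omega>. norm (K (grid t0 T n (Suc l)) \<omega> - K (grid t0 T n l) \<omega>) +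
     norm (K' (grid t0 T n (Suc l)) \<omega> - K' (grid t0 T n l) \<omega>)) \<in> borel_measurable (F (grid t0 T n i))"
    by measurable
qed

lemma GG_measurable:
  assumes "i \<le> Suc n"
  shows "GG n N i \<in> borel_measurable (F (grid t0 T n i))"
proof -
  note [measurable] = LL_measurable[OF assms]
  show ?thesis unfolding GG_def[abs_def] by measurable
qed

lemma LL_nonneg: "0 \<le> LL n i \<omega>"
  unfolding LL_def by (intro sum_nonneg) auto

text \<open>The upper bound admits the weight in the martingale property and the isometry; the lower
  bound 1 lets the weight be dropped from the energy of Z - Z'.\<close>

lemma GG_bounds:
  assumes "i < Suc n" "0 \<le> N"
  shows "1 \<le> GG n N i \<omega>" "GG n N i \<omega> \<le> exp (\<alpha> * T + N / R0)"
proof -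
  note p = grid_props[OF assms(1)]
  have "0 \<le> \<alpha> * (grid t0 T n i - t0)" using p \<alpha>_nonneg by simp
  moreover have "0 \<le> min (LL n i \<omega>) N / R0" using LL_nonneg[of n i \<omega>] assms R0_pos by simp
  ultimately show "1 \<le> GG n N i \<omega>" unfolding GG_def by simp
  have "\<alpha> * (grid t0 T n i - t0) \<le> \<alpha> * T" using p t0 \<alpha>_nonneg by (intro mult_left_mono) auto
  then show "GG n N i \<omega> \<le> exp (\<alpha> * T + N / R0)"
    unfolding GG_def using R0_pos by (auto intro!: add_mono divide_right_mono)
qed

text \<open>The cross terms T1 have mean zero, and T2 and T3 have equal means by the isometry. Thus
  T2 - T3 / 2 leaves half of the weighted energy, which is at least half of the unweighted
  one.\<close>

lemma DD_expectation:
  assumes N: "0 \<le> N"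
  shows "integrable M (DD n N)" "integrable M (\<lambda>\<omega>. (norm (X t0 \<omega>))\<^sup>2)"
    "(\<integral>\<omega>. E2 t0 T \<omega> \<partial>M) / 2 + (\<integral>\<omega>. (norm (X t0 \<omega>))\<^sup>2 \<partial>M) \<le> (\<integral>\<omega>. DD n N \<omega> \<partial>M)"
proof -
  let ?t = "grid t0 T n"
  define B where "B = exp (\<alpha> * T + N / R0)"
  have B: "0 \<le> B" by (simp add: B_def)
  define T1 T2 T3 where "T1 i \<omega> = GG n N i \<omega> *\<^sub>R X (?t i) \<omega> \<bullet> dJ (?t i) (?t (Suc i)) \<omega>"
    and "T2 i \<omega> = GG n N i \<omega> * (norm (dJ (?t i) (?t (Suc i)) \<omega>))\<^sup>2"
    and "T3 i \<omega> = GG n N i \<omega> * E2 (?t i) (?t (Suc i)) \<omega>" for i \<omega>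
  have t: "has_bochner_integral M (T1 i) 0" "integrable M (T2 i)" "integrable M (T3 i)"
    "(\<integral>\<omega>. T2 i \<omega> \<partial>M) = (\<integral>\<omega>. T3 i \<omega> \<partial>M)" "(\<integral>\<omega>. E2 (?t i) (?t (Suc i)) \<omega> \<partial>M) \<le> (\<integral>\<omega>. T3 i \<omega> \<partial>M)"
    if i: "i < Suc n" for i
  proof -
    note p = grid_props[OF i]
    have G: "GG n N i \<in> borel_measurable (F (?t i))" using i by (intro GG_measurable) auto
    have Gb: "AE \<omega> in M. \<bar>GG n N i \<omega>\<bar> \<le> B"
    proof (rule AE_I2)
      fix \<omega>
      show "\<bar>GG n N i \<omega>\<bar> \<le> B"
        using GG_bounds[OF i N, of \<omega>] unfolding B_def by linarith
    qed
    show "has_bochner_integral M (T1 i) 0"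
      unfolding T1_def
    proof (rule ito_martingale[OF p(1-3)])
      show "(\<lambda>\<omega>. GG n N i \<omega> *\<^sub>R X (?t i) \<omega>) \<in> borel_measurable (F (?t i))"
        by (intro borel_measurable_scaleR G X_measurable) (use p in auto)
      show "AE \<omega> in M. norm (GG n N i \<omega> *\<^sub>R X (?t i) \<omega>) \<le> B * (2 * R1)"
        using Gb X_bound
      proof eventually_elim
        case (elim \<omega>)
        then show ?case using B p by (auto intro!: mult_mono)
      qed
      show "0 \<le> B * (2 * R1)" using B R1_nonneg by (rule mult_nonneg_nonneg)
    qed
    note iso = ito_isometry[OF p(1-3) G Gb B]
    show "integrable M (T2 i)" "integrable M (T3 i)" "(\<integral>\<omega>. T2 i \<omega> \<partial>M) = (\<integral>\<omega>. T3 i \<omega> \<partial>M)"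
      using iso unfolding T2_def[abs_def] T3_def[abs_def] by simp_all
    show "(\<integral>\<omega>. E2 (?t i) (?t (Suc i)) \<omega> \<partial>M) \<le> (\<integral>\<omega>. T3 i \<omega> \<partial>M)"
    proof (rule integral_mono[OF E2_integrable[OF p(1-3)] \<open>integrable M (T3 i)\<close>])
      fix \<omega>
      show "E2 (?t i) (?t (Suc i)) \<omega> \<le> T3 i \<omega>"
        using mult_right_mono[OF GG_bounds(1)[OF i N] E2_nonneg] by (simp add: T3_def)
    qed
  qed
  show Xint: "integrable M (\<lambda>\<omega>. (norm (X t0 \<omega>))\<^sup>2)"
  proof (rule integrable_const_bound[of _ "(2 * R1)\<^sup>2"])
    have [measurable]: "X t0 \<in> borel_measurable M"
      using F_measurable_M[OF X_measurable[of t0]] t0 by auto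
    show "(\<lambda>\<omega>. (norm (X t0 \<omega>))\<^sup>2) \<in> borel_measurable M" by measurable
    show "AE \<omega> in M. norm ((norm (X t0 \<omega>))\<^sup>2) \<le> (2 * R1)\<^sup>2"
      using X_bound
    proof eventually_elim
      case (elim \<omega>)
      then have "norm (X t0 \<omega>) \<le> 2 * R1" using t0 by auto
      then have "(norm (X t0 \<omega>))\<^sup>2 \<le> (2 * R1)\<^sup>2" by (intro power_mono) auto
      then show ?case by simp
    qed
  qed
  have T1int: "integrable M (T1 i)" "(\<integral>\<omega>. T1 i \<omega> \<partial>M) = 0" if "i < Suc n" for i
    using t(1)[OF that] by (simp_all add: has_bochner_integral_iff)
  have D: "DD n N = (\<lambda>\<omega>. (\<Sum>i<Suc n. 2 * T1 i \<omega> + T2 i \<omega> - T3 i \<omega> / 2) + (norm (X t0 \<omega>))\<^sup>2)"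
    by (simp add: fun_eq_iff DD_def T1_def T2_def T3_def algebra_simps del: sum.lessThan_Suc)
  have sint: "integrable M (\<lambda>\<omega>. \<Sum>i<Suc n. 2 * T1 i \<omega> + T2 i \<omega> - T3 i \<omega> / 2)"
    using t T1int by (intro Bochner_Integration.integrable_sum Bochner_Integration.integrable_diff
        Bochner_Integration.integrable_add integrable_mult_right integrable_divide) auto
  show "integrable M (DD n N)"
    unfolding D by (intro Bochner_Integration.integrable_add sint Xint)
  \<comment> \<open>Additivity over the cells relies on square integrable paths of Z - Z', hence
    only almost surely.\<close>
  have "AE \<omega> in M. E2 t0 (?t m) \<omega> = (\<Sum>i<m. E2 (?t i) (?t (Suc i)) \<omega>)" if "m \<le> Suc n" for m
    using that
  proof (induction m)
    case 0
    show ?case by (simp add: E2_def set_lebesgue_integral_def)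
  next
    case (Suc m)
    then have m: "m < Suc n" by simp
    note p = grid_props[OF m]
    have "AE \<omega> in M. E2 t0 (?t m) \<omega> = (\<Sum>i<m. E2 (?t i) (?t (Suc i)) \<omega>)" using Suc by simp
    with E2_add[OF t0(1) p(4) p(2) p(3)] show ?case by eventually_elim simp
  qed
  from this[of "Suc n"] have "AE \<omega> in M. E2 t0 T \<omega> = (\<Sum>i<Suc n. E2 (?t i) (?t (Suc i)) \<omega>)" by simp
  then have "(\<integral>\<omega>. E2 t0 T \<omega> \<partial>M) = (\<integral>\<omega>. (\<Sum>i<Suc n. E2 (?t i) (?t (Suc i)) \<omega>) \<partial>M)"
    using t0 by (intro integral_cong_AE borel_measurable_integrable Bochner_Integration.integrable_sum
        E2_integrable grid_props) auto
  also have "\<dots> = (\<Sum>i<Suc n. (\<integral>\<omega>. E2 (?t i) (?t (Suc i)) \<omega> \<partial>M))"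
    by (intro Bochner_Integration.integral_sum E2_integrable grid_props) auto
  also have "\<dots> \<le> (\<Sum>i<Suc n. (\<integral>\<omega>. T3 i \<omega> \<partial>M))"
    by (intro sum_mono t) auto
  finally have E: "(\<integral>\<omega>. E2 t0 T \<omega> \<partial>M) \<le> (\<Sum>i<Suc n. (\<integral>\<omega>. T3 i \<omega> \<partial>M))" .
  have "(\<integral>\<omega>. DD n N \<omega> \<partial>M) = (\<integral>\<omega>. (\<Sum>i<Suc n. 2 * T1 i \<omega> + T2 i \<omega> - T3 i \<omega> / 2) \<partial>M) + (\<integral>\<omega>. (norm (X t0 \<omega>))\<^sup>2 \<partial>M)"
    unfolding D by (rule Bochner_Integration.integral_add[OF sint Xint])
  also have "(\<integral>\<omega>. (\<Sum>i<Suc n. 2 * T1 i \<omega> + T2 i \<omega> - T3 i \<omega> / 2) \<partial>M) =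
      (\<Sum>i<Suc n. (\<integral>\<omega>. 2 * T1 i \<omega> + T2 i \<omega> - T3 i \<omega> / 2 \<partial>M))"
    using t T1int by (intro Bochner_Integration.integral_sum Bochner_Integration.integrable_diff
        Bochner_Integration.integrable_add integrable_mult_right integrable_divide) auto
  also have "\<dots> = (\<Sum>i<Suc n. (\<integral>\<omega>. T3 i \<omega> \<partial>M) / 2)"
  proof (rule sum.cong[OF refl])
    fix i assume "i \<in> {..<Suc n}"
    then have i: "i < Suc n" by simp
    have "(\<integral>\<omega>. 2 * T1 i \<omega> + T2 i \<omega> - T3 i \<omega> / 2 \<partial>M) =
        2 * (\<integral>\<omega>. T1 i \<omega> \<partial>M) + (\<integral>\<omega>. T2 i \<omega> \<partial>M) - (\<integral>\<omega>. T3 i \<omega> \<partial>M) / 2"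
      using t[OF i] T1int[OF i] by simp
    then show "(\<integral>\<omega>. 2 * T1 i \<omega> + T2 i \<omega> - T3 i \<omega> / 2 \<partial>M) = (\<integral>\<omega>. T3 i \<omega> \<partial>M) / 2"
      using t(4)[OF i] T1int(2)[OF i] by simp
  qed
  finally show "(\<integral>\<omega>. E2 t0 T \<omega> \<partial>M) / 2 + (\<integral>\<omega>. (norm (X t0 \<omega>))\<^sup>2 \<partial>M) \<le> (\<integral>\<omega>. DD n N \<omega> \<partial>M)"
    using E by (simp add: sum_divide_distrib[symmetric] del: sum.lessThan_Suc)
qed

lemma hh_integrable: "integrable M (hh N)"
proof -
  have "integrable M (\<lambda>\<omega>. max (V \<omega> - N) 0)"
    by (intro integrable_max Bochner_Integration.integrable_diff V_integrable) auto
  then show ?thesis unfolding hh_def[abs_def] by (rule integrable_mult_right)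
qed

text \<open>\<open>b1\<close> and \<open>b2\<close> are \<open>c1\<close> and \<open>c2\<close> for
  C = 2 R1. They are restated so that the dominating function \<open>dom\<close> makes sense at
  every outcome.\<close>

definition b1 :: real where "b1 = 2 * (2 * R1) * \<alpha> + 2 * Kfy * (2 * R1)"

definition b2 :: real where "b2 = 4 * (2 * R1) / R0 + 2"

definition dom :: "real \<Rightarrow> 'w \<Rightarrow> real" where
  "dom N \<omega> = exp (\<alpha> * T + N / R0) * ((2 * R1)\<^sup>2 / R0 * V \<omega> + 2 * (2 * R1) * (b1 * T + b2 * V \<omega>) +
     2 * (2 * (2 * R1) + V \<omega> + 2 * Cf * T) * (V \<omega> + 2 * Cf * T))"

lemma dom_integrable: "integrable M (dom N)"
proof -
  have "dom N = (\<lambda>\<omega>. exp (\<alpha> * T + N / R0) * (2 * (V \<omega>)\<^sup>2 +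
      ((2 * R1)\<^sup>2 / R0 + 2 * (2 * R1) * b2 + 4 * (2 * R1) + 8 * Cf * T) * V \<omega> +
      (2 * (2 * R1) * b1 * T + 2 * (2 * (2 * R1) + 2 * Cf * T) * (2 * Cf * T))))"
    by (simp add: fun_eq_iff dom_def power2_eq_square algebra_simps)
  then show ?thesis
    using V_sq_integrable V_integrable by simp
qed

lemma DD_path:
  assumes "0 \<le> N"
  shows "AE \<omega> in M. (\<lambda>n. max (DD n N \<omega> - hh N \<omega>) 0) \<longlonglongrightarrow> 0 \<and>
    (\<forall>n. max (DD n N \<omega> - hh N \<omega>) 0 \<le> dom N \<omega>)"
  using AE_path_pair V_eq
proof eventually_elim
  case (elim \<omega>)
  interpret rp: reflected_pair T R0 "2 * R1" "2 * Cf" Kfy Kfz \<phi> "\<lambda>t. Y t \<omega>" "\<lambda>t. Y' t \<omega>"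
    "\<lambda>t. K t \<omega>" "\<lambda>t. K' t \<omega>" "\<lambda>t. J t \<omega> - J' t \<omega>"
    "\<lambda>t. f t \<omega> (Y t \<omega>) (Z t \<omega>) - f t \<omega> (Y' t \<omega>) (Z' t \<omega>)" "\<lambda>t. Z t \<omega> - Z' t \<omega>"
    by (rule elim(1))
  have v: "rp.vv 0 T = V \<omega>" using elim(2) by (simp add: rp.vv_def)
  have al: "rp.\<alpha> = \<alpha>" by (simp add: rp.\<alpha>_def \<alpha>_def)
  have h: "rp.h N = hh N \<omega>"
    by (simp add: rp.h_def[OF t0] rp.Gm_def[OF t0] hh_def v al)
  have D: "rp.D t0 n N = DD n N \<omega>" for n
    by (simp add: rp.D_def[OF t0] rp.G_def[OF t0] rp.L_def[OF t0] DD_def GG_def LL_def dJ_def E2_def X_def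
        rp.x_def rp.S_def al del: sum.lessThan_Suc)
  have dm: "rp.Gm N * ((2 * R1)\<^sup>2 / R0 * rp.vv 0 T + 2 * (2 * R1) * (rp.c1 * T + rp.c2 * rp.vv 0 T) +
      2 * (2 * (2 * R1) + rp.vv 0 T + 2 * Cf * T) * (rp.vv 0 T + 2 * Cf * T)) = dom N \<omega>"
    by (simp add: rp.Gm_def[OF t0] v al dom_def rp.c1_def rp.c2_def b1_def b2_def)
  show ?case
    using rp.energy_tendsto[OF t0 assms] rp.energy_bound[OF t0 assms] unfolding h D dm by blast
qed

text \<open>This is the limit of fine grids at fixed N. \<open>DD\<close> is at most
  \<open>hh\<close> plus the positive part of the excess, whose mean tends to 0 by dominated
  convergence, and the left-hand side does not depend on the grid.\<close>

lemma energy_le_hh: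
  assumes N: "0 \<le> N"
  shows "(\<integral>\<omega>. E2 t0 T \<omega> \<partial>M) / 2 + (\<integral>\<omega>. (norm (X t0 \<omega>))\<^sup>2 \<partial>M) \<le> (\<integral>\<omega>. hh N \<omega> \<partial>M)"
proof -
  have int: "integrable M (\<lambda>\<omega>. max (DD n N \<omega> - hh N \<omega>) 0)" for n
    by (intro integrable_max Bochner_Integration.integrable_diff DD_expectation(1)[OF N] hh_integrable) auto
  have "(\<lambda>n. \<integral>\<omega>. max (DD n N \<omega> - hh N \<omega>) 0 \<partial>M) \<longlonglongrightarrow> (\<integral>\<omega>. 0 \<partial>M)"
  proof (rule integral_dominated_convergence[where w = "dom N"])
    show "AE \<omega> in M. (\<lambda>n. max (DD n N \<omega> - hh N \<omega>) 0) \<longlonglongrightarrow> 0"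
      using DD_path[OF N] by eventually_elim blast
    show "AE \<omega> in M. norm (max (DD n N \<omega> - hh N \<omega>) 0) \<le> dom N \<omega>" for n
      using DD_path[OF N] by eventually_elim simp
  qed (use int dom_integrable in \<open>auto intro: borel_measurable_integrable\<close>)
  then have "(\<lambda>n. (\<integral>\<omega>. hh N \<omega> \<partial>M) + (\<integral>\<omega>. max (DD n N \<omega> - hh N \<omega>) 0 \<partial>M)) \<longlonglongrightarrow> (\<integral>\<omega>. hh N \<omega> \<partial>M) + 0"
    by (intro tendsto_add tendsto_const) simp
  moreover have "(\<integral>\<omega>. E2 t0 T \<omega> \<partial>M) / 2 + (\<integral>\<omega>. (norm (X t0 \<omega>))\<^sup>2 \<partial>M) \<le>
      (\<integral>\<omega>. hh N \<omega> \<partial>M) + (\<integral>\<omega>. max (DD n N \<omega> - hh N \<omega>) 0 \<partial>M)" for n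
  proof -
    have "(\<integral>\<omega>. DD n N \<omega> \<partial>M) \<le> (\<integral>\<omega>. hh N \<omega> + max (DD n N \<omega> - hh N \<omega>) 0 \<partial>M)"
      by (intro integral_mono DD_expectation(1)[OF N] Bochner_Integration.integrable_add hh_integrable int) auto
    also have "\<dots> = (\<integral>\<omega>. hh N \<omega> \<partial>M) + (\<integral>\<omega>. max (DD n N \<omega> - hh N \<omega>) 0 \<partial>M)"
      by (rule Bochner_Integration.integral_add[OF hh_integrable int])
    finally show ?thesis using DD_expectation(3)[OF N, of n] by simp
  qed
  ultimately show ?thesis by (intro LIMSEQ_le_const) auto
qed

text \<open>For a fixed outcome the term is 0 as soon as N reaches V. Before that, N < V gives exp(N
  / R0) (V - N) <= exp(V / R0) V, a dominating function that is integrable by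
  \<open>V_exp_integrable\<close>.\<close>

lemma hh_tendsto: "(\<lambda>n. \<integral>\<omega>. hh (real n) \<omega> \<partial>M) \<longlonglongrightarrow> 0"
proof -
  define c where "c = exp (\<alpha> * T) * ((2 * R1)\<^sup>2 / R0)"
  have c: "0 \<le> c" using R0_pos by (simp add: c_def)
  have "(\<lambda>n. \<integral>\<omega>. hh (real n) \<omega> \<partial>M) \<longlonglongrightarrow> (\<integral>\<omega>. 0 \<partial>M)"
  proof (rule integral_dominated_convergence[where w = "\<lambda>\<omega>. c * (exp (V \<omega> / R0) * V \<omega>)"])
    show "integrable M (\<lambda>\<omega>. c * (exp (V \<omega> / R0) * V \<omega>))" using V_exp_integrable by simp
    show "AE \<omega> in M. (\<lambda>n. hh (real n) \<omega>) \<longlonglongrightarrow> 0"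
    proof (rule AE_I2)
      fix \<omega>
      obtain m where "V \<omega> \<le> real m" using real_arch_simple by blast
      then have "\<forall>\<^sub>F n in sequentially. hh (real n) \<omega> = 0"
        unfolding eventually_sequentially by (intro exI[of _ m]) (auto simp: hh_def max_def)
      then show "(\<lambda>n. hh (real n) \<omega>) \<longlonglongrightarrow> 0" by (rule tendsto_eventually)
    qed
    show "AE \<omega> in M. norm (hh (real n) \<omega>) \<le> c * (exp (V \<omega> / R0) * V \<omega>)" for n
      using V_nonneg
    proof eventually_elim
      case (elim \<omega>)
      have "hh (real n) \<omega> = c * (exp (real n / R0) * max (V \<omega> - real n) 0)"
        by (simp add: hh_def c_def exp_add)
      moreover have "exp (real n / R0) * max (V \<omega> - real n) 0 \<le> exp (V \<omega> / R0) * V \<omega>"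
      proof (cases "V \<omega> \<le> real n")
        case True
        then show ?thesis using elim by (simp add: max_def)
      next
        case False
        then show ?thesis using elim R0_pos by (intro mult_mono) (auto intro!: divide_right_mono)
      qed
      ultimately show ?case using c by (simp add: abs_mult mult_left_mono)
    qed
  qed (use hh_integrable in \<open>auto intro: borel_measurable_integrable\<close>)
  then show ?thesis by simp
qed

lemma energy_zero:
  "(\<integral>\<omega>. E2 t0 T \<omega> \<partial>M) = 0" "AE \<omega> in M. X t0 \<omega> = 0"
proof -
  have "(\<integral>\<omega>. E2 t0 T \<omega> \<partial>M) / 2 + (\<integral>\<omega>. (norm (X t0 \<omega>))\<^sup>2 \<partial>M) \<le> 0"
    by (rule LIMSEQ_le_const[OF hh_tendsto]) (use energy_le_hh in auto)
  moreover have "0 \<le> (\<integral>\<omega>. E2 t0 T \<omega> \<partial>M)" by (intro integral_nonneg_AE AE_I2 E2_nonneg)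
  moreover have "0 \<le> (\<integral>\<omega>. (norm (X t0 \<omega>))\<^sup>2 \<partial>M)" by (intro integral_nonneg_AE AE_I2) auto
  ultimately have 0: "(\<integral>\<omega>. E2 t0 T \<omega> \<partial>M) = 0" "(\<integral>\<omega>. (norm (X t0 \<omega>))\<^sup>2 \<partial>M) = 0" by linarith+
  show "(\<integral>\<omega>. E2 t0 T \<omega> \<partial>M) = 0" by (rule 0)
  have "AE \<omega> in M. (norm (X t0 \<omega>))\<^sup>2 = 0"
    using integral_nonneg_eq_0_iff_AE[OF DD_expectation(2)[OF order_refl]] 0(2) by simp
  then show "AE \<omega> in M. X t0 \<omega> = 0" by eventually_elim simp
qed

end

end

section \<open>Uniqueness\<close>

lemma continuous_on_Icc_at_right:
  fixes g :: "real \<Rightarrow> 'a::topological_space"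
  assumes "continuous_on {a..b} g" "t \<in> {a..<b}"
  shows "continuous (at_right t) g"
proof -
  have "continuous (at t within {a..b}) g"
    using assms by (simp add: continuous_on_eq_continuous_within)
  then have "continuous (at t within {t..b}) g"
    by (rule continuous_within_subset) (use assms in auto)
  then show ?thesis using assms by (simp add: at_within_Icc_at_right)
qed

text \<open>The points of all grids form a countable dense set. It turns statements that hold almost
  surely at each fixed time into one for whole paths.\<close>

lemma zero_on_grids_imp_zero:
  fixes g :: "real \<Rightarrow> 'a::real_normed_vector"
  assumes "a < b" "continuous_on {a..b} g" "\<And>n i. i \<le> Suc n \<Longrightarrow> g (grid a b n i) = 0" "t \<in> {a..b}"
  shows "g t = 0"
proof -
  obtain r where r: "\<And>n x. x \<in> {a..b} \<Longrightarrow> r n x \<le> Suc n"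
    "\<And>x. x \<in> {a..b} \<Longrightarrow> (\<lambda>n. g (grid a b n (r n x))) \<longlonglongrightarrow> g x"
    using grid_round_up[OF assms(1) continuous_on_Icc_at_right[OF assms(2)]] by metis
  have "(\<lambda>n. g (grid a b n (r n t))) = (\<lambda>n. 0)"
    using r(1)[OF assms(4)] assms(3) by (intro ext) blast
  then show ?thesis using r(2)[OF assms(4)] by (simp add: LIMSEQ_const_iff)
qed

lemma measurable_eq_set:
  fixes g h :: "'s \<Rightarrow> 'a::euclidean_space"
  assumes "g \<in> borel_measurable N" "h \<in> borel_measurable N"
  shows "{x \<in> space N. g x = h x} \<in> sets N"
proof -
  have "(\<lambda>x. g x - h x) -` {0} \<inter> space N \<in> sets N"
    by (rule measurable_sets[OF borel_measurable_diff[OF assms]]) simp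
  moreover have "(\<lambda>x. g x - h x) -` {0} \<inter> space N = {x \<in> space N. g x = h x}" by auto
  ultimately show ?thesis by simp
qed

context two_solutions
begin

lemma grid_lt: "i < Suc n \<Longrightarrow> 0 \<le> grid 0 T n i \<and> grid 0 T n i < T"
  using T_pos by (simp add: grid_def divide_less_eq del: of_nat_Suc)

lemma X_zero: "AE \<omega> in M. \<forall>t\<in>{0..T}. X t \<omega> = 0"
proof -
  have "AE \<omega> in M. i < Suc n \<longrightarrow> X (grid 0 T n i) \<omega> = 0" for n i
    using energy_zero(2)[of "grid 0 T n i"] grid_lt[of i n] by (cases "i < Suc n") auto
  then have "AE \<omega> in M. \<forall>n i. i < Suc n \<longrightarrow> X (grid 0 T n i) \<omega> = 0"
    by (simp add: AE_all_countable)
  with AE_path_pair show ?thesis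
  proof eventually_elim
    case (elim \<omega>)
    note rp = reflected_pair.y_cont[OF elim(1)] reflected_pair.terminal[OF elim(1)]
    have "continuous_on {0..T} (\<lambda>t. X t \<omega>)" unfolding X_def using rp by (intro continuous_intros)
    moreover have "X (grid 0 T n i) \<omega> = 0" if "i \<le> Suc n" for n i
      \<comment> \<open>The energy estimate covers starting times below T only; at T both solutions
        have the value \<open>\<xi>\<close>.\<close>
      using elim(2) rp(3) that by (cases "i = Suc n") (auto simp: X_def)
    ultimately show ?case using zero_on_grids_imp_zero[OF T_pos] by blast
  qed
qed

lemma E2_zero:
  assumes "t \<in> {0..T}"
  shows "AE \<omega> in M. E2 0 t \<omega> = 0"
proof -
  have int: "integrable M (E2 0 T)" using T_pos by (intro E2_integrable) auto
  have "AE \<omega> in M. E2 0 T \<omega> = 0"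
    using integral_nonneg_eq_0_iff_AE[OF int] energy_zero(1)[of 0] T_pos E2_nonneg by simp
  moreover have "AE \<omega> in M. E2 0 T \<omega> = E2 0 t \<omega> + E2 t T \<omega>"
    using assms by (intro E2_add) auto
  ultimately show ?thesis
  proof eventually_elim
    case (elim \<omega>)
    then show ?case using E2_nonneg[of 0 t \<omega>] E2_nonneg[of t T \<omega>] by linarith
  qed
qed

text \<open>The isometry with weight 1 turns vanishing energy of Z - Z' into vanishing increments of
  J - J'. Increments from 0 suffice, since only these enter the equation.\<close>

lemma dJ_zero: "AE \<omega> in M. \<forall>t\<in>{0..T}. dJ 0 t \<omega> = 0"
proof -
  have "AE \<omega> in M. dJ 0 t \<omega> = 0" if t: "t \<in> {0..T}" for t
  proof -
    have "0 \<le> (0::real)" "0 \<le> t" "t \<le> T" "(\<lambda>_. 1 :: real) \<in> borel_measurable (F 0)"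
      "AE \<omega> in M. \<bar>1 :: real\<bar> \<le> 1" "0 \<le> (1 :: real)"
      using t by auto
    note iso = ito_isometry[OF this]
    have "(\<integral>\<omega>. 1 * E2 0 t \<omega> \<partial>M) = (\<integral>\<omega>. 0 \<partial>M)"
      by (rule integral_cong_AE) (use E2_zero[OF t] borel_measurable_integrable[OF iso(2)] in auto)
    then have "(\<integral>\<omega>. 1 * (norm (dJ 0 t \<omega>))\<^sup>2 \<partial>M) = 0" using iso(3) by simp
    then have "AE \<omega> in M. 1 * (norm (dJ 0 t \<omega>))\<^sup>2 = 0"
      using integral_nonneg_eq_0_iff_AE[OF iso(1)] by simp
    then show ?thesis by eventually_elim simp
  qed
  from this[OF grid_in[OF less_imp_le[OF T_pos]]]
  have "AE \<omega> in M. i \<le> Suc n \<longrightarrow> dJ 0 (grid 0 T n i) \<omega> = 0" for n i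
    by (cases "i \<le> Suc n") auto
  then have "AE \<omega> in M. \<forall>n i. i \<le> Suc n \<longrightarrow> dJ 0 (grid 0 T n i) \<omega> = 0"
    by (simp add: AE_all_countable)
  with AE_path_pair show ?thesis
  proof eventually_elim
    case (elim \<omega>)
    have "continuous_on {0..T} (\<lambda>t. dJ 0 t \<omega>)"
      unfolding dJ_def
      by (rule continuous_on_diff[OF reflected_pair.j_cont[OF elim(1)] continuous_on_const])
    then show ?case using zero_on_grids_imp_zero[OF T_pos] elim(2) by blast
  qed
qed

lemma Z_zero_path: "AE \<omega> in M. AE t in lborel. t \<in> {0..T} \<longrightarrow> Z t \<omega> = Z' t \<omega>"
proof -
  have "T \<in> {0..T}" using T_pos by simp
  from AE_path_pair E2_zero[OF this] show ?thesis
  proof eventually_elim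
    case (elim \<omega>)
    have int: "set_integrable lborel {0<..T} (\<lambda>t. (norm (Z t \<omega> - Z' t \<omega>))\<^sup>2)"
      by (rule set_integrable_subset[OF reflected_pair.zd_int[OF elim(1)]]) auto
    have "E2 0 T \<omega> = 0" by (rule elim(2))
    then have "AE t in lborel. indicator {0<..T} t *\<^sub>R (norm (Z t \<omega> - Z' t \<omega>))\<^sup>2 = 0"
      using integral_nonneg_eq_0_iff_AE[OF int[unfolded set_integrable_def]]
      unfolding E2_def set_lebesgue_integral_def by simp
    \<comment> \<open>The energy is taken over a window that excludes the time 0, which is therefore
      removed as a null set.\<close>
    with AE_lborel_singleton[of 0] show ?case
      by eventually_elim (auto split: split_indicator_asm)
  qed
qed

text \<open>By Fubini's theorem the order of the two almost-everywhere quantifiers can be exchanged.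
  This rests on joint measurability of the set where Z and Z' agree, which progressive measurability
  supplies.\<close>

lemma Z_zero: "AE (t, \<omega>) in time_measure T \<Otimes>\<^sub>M M. Z t \<omega> = Z' t \<omega>"
proof -
  interpret Q: pair_sigma_finite M "time_measure T" by (rule pair_Q)
  interpret Q': pair_sigma_finite "time_measure T" M ..
  have m: "(\<lambda>(\<omega>, t). Z t \<omega>) \<in> borel_measurable Q" "(\<lambda>(\<omega>, t). Z' t \<omega>) \<in> borel_measurable Q"
    using sol_adapted(4)[OF sol] sol_adapted(4)[OF sol'] T_pos
    by (auto intro!: progressive_swap simp: space_H2_def)
  from this[THEN measurable_pair_swap]
  have m': "(\<lambda>(t, \<omega>). Z t \<omega>) \<in> borel_measurable (time_measure T \<Otimes>\<^sub>M M)"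
    "(\<lambda>(t, \<omega>). Z' t \<omega>) \<in> borel_measurable (time_measure T \<Otimes>\<^sub>M M)" by simp_all
  have "AE \<omega> in M. AE t in time_measure T. Z t \<omega> = Z' t \<omega>"
    using Z_zero_path
  proof eventually_elim
    case (elim \<omega>)
    then show ?case unfolding time_measure_def by (subst AE_restrict_space_iff) simp_all
  qed
  moreover have "{x \<in> space Q. Z (snd x) (fst x) = Z' (snd x) (fst x)} \<in> sets Q"
    using measurable_eq_set[OF m] by (simp add: case_prod_beta')
  ultimately have "AE t in time_measure T. AE \<omega> in M. Z t \<omega> = Z' t \<omega>"
    by (subst Q.AE_commute[symmetric]) auto
  moreover have "{x \<in> space (time_measure T \<Otimes>\<^sub>M M). Z (fst x) (snd x) = Z' (fst x) (snd x)} \<in> sets (time_measure T \<Otimes>\<^sub>M M)"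
    using measurable_eq_set[OF m'] by (simp add: case_prod_beta')
  ultimately have "AE x in time_measure T \<Otimes>\<^sub>M M. Z (fst x) (snd x) = Z' (fst x) (snd x)"
    by (intro Q'.AE_pair_measure) auto
  then show ?thesis by (simp add: case_prod_beta')
qed

text \<open>Once X, the increments of J - J' and the drift difference vanish, the equation for the
  difference leaves only the reflection terms, and both of these start at 0.\<close>

lemma K_eq: "AE \<omega> in M. \<forall>t\<in>{0..T}. K t \<omega> = K' t \<omega>"
  using AE_path_pair X_zero dJ_zero Z_zero_path sol_path[OF sol] sol_path[OF sol']
proof eventually_elim
  case (elim \<omega>)
  let ?\<delta> = "\<lambda>t. f t \<omega> (Y t \<omega>) (Z t \<omega>) - f t \<omega> (Y' t \<omega>) (Z' t \<omega>)"
  show ?case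
  proof
    fix t assume t: "t \<in> {0..T}"
    have "AE r in lborel. indicator {0<..t} r *\<^sub>R ?\<delta> r = 0"
      using elim(4)
    proof eventually_elim
      case (elim r)
      show ?case
      proof (cases "r \<in> {0<..t}")
        case True
        then have r: "r \<in> {0..T}" using t by auto
        then have "Y r \<omega> = Y' r \<omega>" "Z r \<omega> = Z' r \<omega>"
          using \<open>\<forall>t\<in>{0..T}. X t \<omega> = 0\<close> elim by (auto simp: X_def)
        then show ?thesis by simp
      qed simp
    qed
    then have \<delta>: "(LINT r:{0<..t}|lborel. ?\<delta> r) = 0"
      unfolding set_lebesgue_integral_def by (rule integral_eq_zero_AE)
    have "(Y t \<omega> - Y' t \<omega>) - (Y 0 \<omega> - Y' 0 \<omega>) = ((K t \<omega> - K 0 \<omega>) - (K' t \<omega> - K' 0 \<omega>)) +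
        ((J t \<omega> - J' t \<omega>) - (J 0 \<omega> - J' 0 \<omega>)) - (LINT r:{0<..t}|lborel. ?\<delta> r)"
      by (rule reflected_pair.eq[OF elim(1)]) (use t in auto)
    moreover have "Y t \<omega> - Y' t \<omega> = 0" "Y 0 \<omega> - Y' 0 \<omega> = 0"
      using elim(2) t T_pos by (auto simp: X_def)
    moreover have "(J t \<omega> - J' t \<omega>) - (J 0 \<omega> - J' 0 \<omega>) = 0"
      using elim(3) t unfolding dJ_def by blast
    moreover have "K 0 \<omega> = 0" "K' 0 \<omega> = 0" using elim(5,6) by auto
    ultimately show "K t \<omega> = K' t \<omega>" unfolding \<delta> by simp
  qed
qed

end

lemma closure_sublevel_bounded:
  fixes \<phi> :: "real ^ 'n \<Rightarrow> real"
  assumes "compactness_cond \<phi>"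
  shows "\<exists>R1. \<forall>y\<in>closure (sublevel \<phi>). norm y \<le> R1"
proof -
  obtain R1 where R1: "\<And>y. norm y \<ge> R1 \<Longrightarrow> \<phi> y > 0"
    using assms by (auto simp: compactness_cond_def)
  have "sublevel \<phi> \<subseteq> cball 0 R1"
  proof
    fix y assume "y \<in> sublevel \<phi>"
    then have "\<not> norm y \<ge> R1" using R1[of y] by (auto simp: sublevel_def)
    then show "y \<in> cball 0 R1" by simp
  qed
  then have "closure (sublevel \<phi>) \<subseteq> cball 0 R1" by (rule closure_minimal) simp
  then show ?thesis by (intro exI[of _ R1]) auto
qed

theorem corollary2p2:
  fixes M :: "'w measure"
    and T R0 :: real
    and W :: "real \<Rightarrow> 'w \<Rightarrow> real ^ 'm"
    and \<phi> :: "real ^ 'n \<Rightarrow> real"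
    and \<xi> :: "'w \<Rightarrow> real ^ 'n"
    and f :: "real \<Rightarrow> 'w \<Rightarrow> real ^ 'n \<Rightarrow> real ^ 'm ^ 'n \<Rightarrow> real ^ 'n"
    and Y Y' :: "real \<Rightarrow> 'w \<Rightarrow> real ^ 'n"
    and Z Z' :: "real \<Rightarrow> 'w \<Rightarrow> real ^ 'm ^ 'n"
    and K K' :: "real \<Rightarrow> 'w \<Rightarrow> real ^ 'n"
  assumes "T > 0"
    and "prob_space M" and "complete_measure M"
    and "brownian_motion M T W"
    and "standing_domain \<phi>"
    and "exterior_sphere_constant \<phi> R0"
    and "standing_data M (completed_filtration M W) T \<phi> \<xi> f"
    and "(Y, Z, K) \<in> class_U M (completed_filtration M W) T W \<phi> R0 \<xi> f 2"
    and "(Y', Z', K') \<in> class_U M (completed_filtration M W) T W \<phi> R0 \<xi> f 2"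
  shows "(AE \<omega> in M. \<forall>t\<in>{0..T}. Y t \<omega> = Y' t \<omega>)
    \<and> (AE (t, \<omega>) in time_measure T \<Otimes>\<^sub>M M. Z t \<omega> = Z' t \<omega>)
    \<and> (AE \<omega> in M. \<forall>t\<in>{0..T}. K t \<omega> = K' t \<omega>)"
proof -
  obtain R1 where R1: "\<And>y. y \<in> closure (sublevel \<phi>) \<Longrightarrow> norm y \<le> R1"
    using closure_sublevel_bounded[of \<phi>] assms(5) by (auto simp: standing_domain_def)
  obtain Kfy Kfz where Kf: "0 \<le> Kfy" "0 \<le> Kfz"
    and lip: "\<And>t \<omega> y y' z z'. t \<in> {0..T} \<Longrightarrow> \<omega> \<in> space M \<Longrightarrow>
      norm (f t \<omega> y z - f t \<omega> y' z') \<le> Kfy * norm (y - y') + Kfz * norm (z - z')"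
  proof -
    have "\<exists>Kfy\<ge>0. \<exists>Kfz\<ge>0. \<forall>t\<in>{0..T}. \<forall>\<omega>\<in>space M. \<forall>y y' z z'.
        norm (f t \<omega> y z - f t \<omega> y' z') \<le> Kfy * norm (y - y') + Kfz * norm (z - z')"
      using assms(7) unfolding standing_data_def by (elim conjE)
    then show ?thesis using that by fast
  qed
  obtain S where S: "compact S"
    "\<And>t \<omega> y z. t \<in> {0..T} \<Longrightarrow> \<omega> \<in> space M \<Longrightarrow> y \<notin> S \<Longrightarrow> f t \<omega> y z = 0"
  proof -
    have "\<exists>S. compact S \<and> (\<forall>t\<in>{0..T}. \<forall>\<omega>\<in>space M. \<forall>y z. y \<notin> S \<longrightarrow> f t \<omega> y z = 0)"
      using assms(7) unfolding standing_data_def by (elim conjE)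
    then show ?thesis using that by fast
  qed
  \<comment> \<open>A compact set is bounded and the space is not, so there is a point at which f
    vanishes for every z.\<close>
  have "S \<noteq> UNIV" using compact_imp_bounded[OF S(1)] not_bounded_UNIV by auto
  then obtain y0 where y0: "y0 \<notin> S" by auto
  have basis: "brownian_basis M T W"
    using assms(2-4) by (simp add: brownian_basis_def brownian_basis_axioms_def)
  interpret reflected_data M T W \<phi> R0 \<xi> f Kfy Kfz R1 y0
  proof (intro reflected_data.intro basis reflected_data_axioms.intro)
    show "progressive (completed_filtration M W) T (\<lambda>t \<omega>. f t \<omega> y z)" for y z
      using assms(7) unfolding standing_data_def by (elim conjE) (erule allE, erule allE)
    show "f t \<omega> y0 z = 0" if "t \<in> {0..T}" "\<omega> \<in> space M" for t \<omega> z
      using S(2)[OF that y0] .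
  qed (use assms R1 Kf lip in \<open>auto simp: standing_domain_def\<close>)
  have sol_ex: "\<exists>J p. sol Y Z K J p"
    if "(Y, Z, K) \<in> class_U M (completed_filtration M W) T W \<phi> R0 \<xi> f 2" for Y Z K
    using that unfolding class_U_def rbsde_solution_def sol_def by blast
  obtain J p where "sol Y Z K J p" using sol_ex[OF assms(8)] by blast
  moreover obtain J' p' where "sol Y' Z' K' J' p'" using sol_ex[OF assms(9)] by blast
  ultimately interpret two_solutions M T W \<phi> R0 \<xi> f Kfy Kfz R1 y0 Y Y' Z Z' K K' J J' p p'
    by unfold_locales
  show ?thesis
    using X_zero Z_zero K_eq by (simp add: X_def)
qed

end
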